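(* Let $\mathcal{A}$ be an AB4-category, $\mathscr{D}$ a small category, and $f:X\to Y$ a morphism between $X,Y\in\mathrm{Set}^{\mathscr{D}^{op}}$. Then for an arbitrary functor $F:(\mathscr{D}/X)^{op}\to\mathcal{A}$ there are natural isomorphisms $\varinjlim^{(\mathscr{D}/X)^{op}}_nF\xrightarrow{\cong}\varinjlim^{(\mathscr{D}/Y)^{op}}_nf_*F$ (for all $n\ge0$).
   Context: **AB4-category.** An Abelian category with all small coproducts in which coproducts are exact (Grothendieck's axioms AB3, AB4). **Satellites of the colimit.** For a small category $\mathscr{C}$ and an AB4-category $\mathcal{A}$, $\varinjlim^{\mathscr{C}}_n:\mathcal{A}^{\mathscr{C}}\to\mathcal{A}$, $n\ge 0$, denote the left satellites (universal homological $\partial$-functor) of $\varinjlim^{\mathscr{C}}$. It is known that $\varinjlim^{\mathscr{C}}_nF$ is naturally isomorphic to the $n$-th homology of the complex $\bigoplus_{c_0\to\cdots\to c_n}F(c_0)$ with the usual alternating-sum differentials. **Category $\mathscr{D}/X$.** For $X:\mathscr{D}^{op}\to\mathrm{Set}$, objects of $\mathscr{D}/X$ are natural transformations $\tilde x:h_d=\mathscr{D}(-,d)\to X$, equivalently elements $x\in X(d)$, $d=\mathrm{dom}\,x\in\mathrm{Ob}\,\mathscr{D}$; morphisms $\tilde x_1\to\tilde x_2$ are $\alpha\in\mathscr{D}(\mathrm{dom}\,x_1,\mathrm{dom}\,x_2)$ with $\tilde x_2\circ h_\alpha=\tilde x_1$, i.e. $X(\alpha)(x_2)=x_1$. A morphism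 $f:X\to Y$ induces $\mathscr{D}/f:\mathscr{D}/X\to\mathscr{D}/Y$, $\tilde x\mapsto f\circ\tilde x$, $\alpha\mapsto\alpha$. **Direct image.** $f_*F:(\mathscr{D}/Y)^{op}\to\mathcal{A}$ is (isomorphic to) the left Kan extension of $F$ along $(\mathscr{D}/f)^{op}$; explicitly $f_*F(\tilde y)=\coprod_{x\in f^{-1}_{\mathrm{dom}\,y}(y)}F(\tilde x)$, and for $\beta:\tilde y\to\tilde z$ in $\mathscr{D}/Y$, $(f_*F)(\beta):f_*F(\tilde z)\to f_*F(\tilde y)$ is determined by $(f_*F)(\beta)\circ in_{\tilde x}=in_{\tilde x\circ h_\beta}\circ F(\tilde x\circ h_\beta\xrightarrow{\beta}\tilde x)$ for $x\in f^{-1}_{\mathrm{dom}\,z}(z)$. *)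

theory Defs
  imports "HOL-Algebra.Group" "HOL-Library.FuncSet" "HOL-Library.Equipollence"
begin

section \<open>Categories, functors and natural transformations\<close>

record ('o, 'm) category =
  Ob :: "'o set"
  Arr :: "'m set"
  Dom :: "'m \<Rightarrow> 'o"
  Cod :: "'m \<Rightarrow> 'o"
  Ide :: "'o \<Rightarrow> 'm"
  Comp :: "'m \<Rightarrow> 'm \<Rightarrow> 'm"  (infixl "\<cdot>\<index>" 70)  \<comment> \<open>\<open>g \<cdot> f\<close>: first \<open>f\<close>, then \<open>g\<close>\<close>

definition Hom :: "('o, 'm, 'z) category_scheme \<Rightarrow> 'o \<Rightarrow> 'o \<Rightarrow> 'm set" where
  "Hom C a b = {f \<in> Arr C. Dom C f = a \<and> Cod C f = b}"

locale category =
  fixes C :: "('o, 'm, 'z) category_scheme" (structure)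
  assumes Dom_in_Ob: "f \<in> Arr C \<Longrightarrow> Dom C f \<in> Ob C"
    and Cod_in_Ob: "f \<in> Arr C \<Longrightarrow> Cod C f \<in> Ob C"
    and Ide_in_Hom: "a \<in> Ob C \<Longrightarrow> Ide C a \<in> Hom C a a"
    and Comp_in_Hom: "f \<in> Hom C a b \<Longrightarrow> g \<in> Hom C b c \<Longrightarrow> g \<cdot> f \<in> Hom C a c"
    and Comp_Ide_right: "f \<in> Hom C a b \<Longrightarrow> f \<cdot> Ide C a = f"
    and Comp_Ide_left: "f \<in> Hom C a b \<Longrightarrow> Ide C b \<cdot> f = f"
    and Comp_assoc: "f \<in> Hom C a b \<Longrightarrow> g \<in> Hom C b c \<Longrightarrow> h \<in> Hom C c d
                      \<Longrightarrow> h \<cdot> (g \<cdot> f) = h \<cdot> g \<cdot> f"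

text \<open>
  Smallness is relative to a type \<open>'u\<close>, which is to be infinite: a set is small
  when it injects into \<open>'u\<close>. The category of small sets is accordingly represented by
  the category of subsets of \<open>'u\<close>, and ``all small coproducts'' are those indexed by
  subsets of \<open>'u\<close>.
\<close>

definition small_category :: "'u itself \<Rightarrow> ('o, 'm, 'z) category_scheme \<Rightarrow> bool" where
  "small_category U C \<longleftrightarrow>
     category C \<and> Ob C \<lesssim> (UNIV :: 'u set) \<and> Arr C \<lesssim> (UNIV :: 'u set)"

definition op :: "('o, 'm, 'z) category_scheme \<Rightarrow> ('o, 'm) category" where
  "op C = \<lparr>Ob = Ob C, Arr = Arr C, Dom = Cod C, Cod = Dom C, Ide = Ide C,
           Comp = (\<lambda>g f. f \<cdot>\<^bsub>C\<^esub> g)\<rparr>"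

text \<open>Arrows that carry their source and target.\<close>

datatype ('s, 't) mor = Mor (src: 's) (body: 't) (tgt: 's)

definition set_cat :: "('u set, ('u set, 'u \<Rightarrow> 'u) mor) category" where
  "set_cat = \<lparr>Ob = UNIV, Arr = {Mor S g T | S g T. g \<in> S \<rightarrow>\<^sub>E T}, Dom = src, Cod = tgt,
              Ide = (\<lambda>S. Mor S (\<lambda>x\<in>S. x) S),
              Comp = (\<lambda>h g. Mor (src g) (compose (src g) (body h) (body g)) (tgt h))\<rparr>"

record ('o, 'm, 'p, 'n) functor_data =
  FOb :: "'o \<Rightarrow> 'p"
  FAr :: "'m \<Rightarrow> 'n"

definition is_functor ::
  "('o, 'm, 'y) category_scheme \<Rightarrow> ('p, 'n, 'z) category_scheme
    \<Rightarrow> ('o, 'm, 'p, 'n) functor_data \<Rightarrow> bool" where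
  "is_functor C A F \<longleftrightarrow>
     (\<forall>a\<in>Ob C. FOb F a \<in> Ob A) \<and>
     (\<forall>u\<in>Arr C. FAr F u \<in> Hom A (FOb F (Dom C u)) (FOb F (Cod C u))) \<and>
     (\<forall>a\<in>Ob C. FAr F (Ide C a) = Ide A (FOb F a)) \<and>
     (\<forall>u\<in>Arr C. \<forall>v\<in>Arr C. Dom C v = Cod C u \<longrightarrow>
        FAr F (v \<cdot>\<^bsub>C\<^esub> u) = FAr F v \<cdot>\<^bsub>A\<^esub> FAr F u)"

definition functor_comp ::
  "('p, 'n, 'q, 'k) functor_data \<Rightarrow> ('o, 'm, 'p, 'n) functor_data
    \<Rightarrow> ('o, 'm, 'q, 'k) functor_data" where
  "functor_comp G F = \<lparr>FOb = (\<lambda>a. FOb G (FOb F a)), FAr = (\<lambda>u. FAr G (FAr F u))\<rparr>"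

definition is_nat_trans ::
  "('o, 'm, 'y) category_scheme \<Rightarrow> ('p, 'n, 'z) category_scheme
    \<Rightarrow> ('o, 'm, 'p, 'n) functor_data \<Rightarrow> ('o, 'm, 'p, 'n) functor_data \<Rightarrow> ('o \<Rightarrow> 'n) \<Rightarrow> bool" where
  "is_nat_trans C A F G \<eta> \<longleftrightarrow>
     (\<forall>a\<in>Ob C. \<eta> a \<in> Hom A (FOb F a) (FOb G a)) \<and>
     (\<forall>u\<in>Arr C. \<eta> (Cod C u) \<cdot>\<^bsub>A\<^esub> FAr F u = FAr G u \<cdot>\<^bsub>A\<^esub> \<eta> (Dom C u))"

definition is_iso :: "('o, 'm, 'z) category_scheme \<Rightarrow> 'm \<Rightarrow> bool" where
  "is_iso C f \<longleftrightarrow> f \<in> Arr C \<and>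
     (\<exists>g \<in> Hom C (Cod C f) (Dom C f).
        g \<cdot>\<^bsub>C\<^esub> f = Ide C (Dom C f) \<and> f \<cdot>\<^bsub>C\<^esub> g = Ide C (Cod C f))"

definition is_nat_iso ::
  "('o, 'm, 'y) category_scheme \<Rightarrow> ('p, 'n, 'z) category_scheme
    \<Rightarrow> ('o, 'm, 'p, 'n) functor_data \<Rightarrow> ('o, 'm, 'p, 'n) functor_data \<Rightarrow> ('o \<Rightarrow> 'n) \<Rightarrow> bool" where
  "is_nat_iso C A F G \<eta> \<longleftrightarrow> is_nat_trans C A F G \<eta> \<and> (\<forall>a\<in>Ob C. is_iso A (\<eta> a))"


section \<open>Abelian categories and the axioms AB3, AB4\<close>

record ('o, 'm) preadditive = "('o, 'm) category" +
  Zero :: "'o \<Rightarrow> 'o \<Rightarrow> 'm"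
  Add :: "'m \<Rightarrow> 'm \<Rightarrow> 'm"

definition Hom_group ::
  "('o, 'm, 'z) preadditive_scheme \<Rightarrow> 'o \<Rightarrow> 'o \<Rightarrow> 'm monoid" where
  "Hom_group A a b = \<lparr>carrier = Hom A a b, mult = Add A, one = Zero A a b\<rparr>"

locale preadditive_category = category A
  for A :: "('o, 'm, 'z) preadditive_scheme" (structure) +
  assumes Hom_comm_group: "a \<in> Ob A \<Longrightarrow> b \<in> Ob A \<Longrightarrow> comm_group (Hom_group A a b)"
    and Comp_Add_left: "f \<in> Hom A a b \<Longrightarrow> g \<in> Hom A b c \<Longrightarrow> h \<in> Hom A b c
                         \<Longrightarrow> Add A g h \<cdot> f = Add A (g \<cdot> f) (h \<cdot> f)"
    and Comp_Add_right: "f \<in> Hom A a b \<Longrightarrow> g \<in> Hom A a b \<Longrightarrow> h \<in> Hom A b c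
                         \<Longrightarrow> h \<cdot> Add A f g = Add A (h \<cdot> f) (h \<cdot> g)"

definition is_mono :: "('o, 'm, 'z) category_scheme \<Rightarrow> 'm \<Rightarrow> bool" where
  "is_mono A f \<longleftrightarrow> f \<in> Arr A \<and>
     (\<forall>g\<in>Arr A. \<forall>h\<in>Arr A. Dom A g = Dom A h \<and> Cod A g = Dom A f \<and> Cod A h = Dom A f \<and>
        f \<cdot>\<^bsub>A\<^esub> g = f \<cdot>\<^bsub>A\<^esub> h \<longrightarrow> g = h)"

definition is_epi :: "('o, 'm, 'z) category_scheme \<Rightarrow> 'm \<Rightarrow> bool" where
  "is_epi A f \<longleftrightarrow> f \<in> Arr A \<and>
     (\<forall>g\<in>Arr A. \<forall>h\<in>Arr A. Cod A g = Cod A h \<and> Dom A g = Cod A f \<and> Dom A h = Cod A f \<and>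
        g \<cdot>\<^bsub>A\<^esub> f = h \<cdot>\<^bsub>A\<^esub> f \<longrightarrow> g = h)"

definition is_kernel :: "('o, 'm, 'z) preadditive_scheme \<Rightarrow> 'm \<Rightarrow> 'm \<Rightarrow> bool" where
  "is_kernel A k f \<longleftrightarrow>
     f \<in> Arr A \<and> k \<in> Arr A \<and> Cod A k = Dom A f \<and> f \<cdot>\<^bsub>A\<^esub> k = Zero A (Dom A k) (Cod A f) \<and>
     (\<forall>h\<in>Arr A. Cod A h = Dom A f \<and> f \<cdot>\<^bsub>A\<^esub> h = Zero A (Dom A h) (Cod A f) \<longrightarrow>
        (\<exists>!u. u \<in> Hom A (Dom A h) (Dom A k) \<and> k \<cdot>\<^bsub>A\<^esub> u = h))"

definition is_cokernel :: "('o, 'm, 'z) preadditive_scheme \<Rightarrow> 'm \<Rightarrow> 'm \<Rightarrow> bool" where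
  "is_cokernel A q f \<longleftrightarrow>
     f \<in> Arr A \<and> q \<in> Arr A \<and> Dom A q = Cod A f \<and> q \<cdot>\<^bsub>A\<^esub> f = Zero A (Dom A f) (Cod A q) \<and>
     (\<forall>h\<in>Arr A. Dom A h = Cod A f \<and> h \<cdot>\<^bsub>A\<^esub> f = Zero A (Dom A f) (Cod A h) \<longrightarrow>
        (\<exists>!u. u \<in> Hom A (Cod A q) (Cod A h) \<and> u \<cdot>\<^bsub>A\<^esub> q = h))"

locale abelian_category = preadditive_category A
  for A :: "('o, 'm, 'z) preadditive_scheme" (structure) +
  assumes zero_object: "\<exists>z\<in>Ob A. \<forall>a\<in>Ob A. (\<exists>!f. f \<in> Hom A z a) \<and> (\<exists>!f. f \<in> Hom A a z)"
    and biproduct: "a \<in> Ob A \<Longrightarrow> b \<in> Ob A \<Longrightarrow>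
      \<exists>c\<in>Ob A. \<exists>i1\<in>Hom A a c. \<exists>i2\<in>Hom A b c. \<exists>p1\<in>Hom A c a. \<exists>p2\<in>Hom A c b.
        p1 \<cdot> i1 = Ide A a \<and> p2 \<cdot> i2 = Ide A b \<and> Add A (i1 \<cdot> p1) (i2 \<cdot> p2) = Ide A c"
    and has_kernel: "f \<in> Arr A \<Longrightarrow> \<exists>k. is_kernel A k f"
    and has_cokernel: "f \<in> Arr A \<Longrightarrow> \<exists>q. is_cokernel A q f"
    and mono_is_kernel: "is_mono A f \<Longrightarrow> \<exists>g. is_kernel A f g"
    and epi_is_cokernel: "is_epi A f \<Longrightarrow> \<exists>g. is_cokernel A f g"

definition is_image :: "('o, 'm, 'z) preadditive_scheme \<Rightarrow> 'm \<Rightarrow> 'm \<Rightarrow> bool" where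
  "is_image A m f \<longleftrightarrow> (\<exists>q. is_cokernel A q f \<and> is_kernel A m q)"

definition exact :: "('o, 'm, 'z) preadditive_scheme \<Rightarrow> 'm \<Rightarrow> 'm \<Rightarrow> bool" where
  "exact A f g \<longleftrightarrow> (\<exists>m. is_image A m f \<and> is_kernel A m g)"

text \<open>\<open>0 \<rightarrow> a \<rightarrow> b \<rightarrow> c \<rightarrow> 0\<close>, with \<open>f : a \<rightarrow> b\<close> and \<open>g : b \<rightarrow> c\<close>.\<close>

definition short_exact :: "('o, 'm, 'z) preadditive_scheme \<Rightarrow> 'm \<Rightarrow> 'm \<Rightarrow> bool" where
  "short_exact A f g \<longleftrightarrow> is_kernel A f g \<and> is_cokernel A g f"

definition is_coproduct ::
  "('o, 'm, 'z) category_scheme \<Rightarrow> 'i set \<Rightarrow> ('i \<Rightarrow> 'o) \<Rightarrow> 'o \<Rightarrow> ('i \<Rightarrow> 'm) \<Rightarrow> bool" where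
  "is_coproduct A I F c inc \<longleftrightarrow>
     c \<in> Ob A \<and> (\<forall>i\<in>I. inc i \<in> Hom A (F i) c) \<and>
     (\<forall>x\<in>Ob A. \<forall>g. (\<forall>i\<in>I. g i \<in> Hom A (F i) x) \<longrightarrow>
        (\<exists>!h. h \<in> Hom A c x \<and> (\<forall>i\<in>I. h \<cdot>\<^bsub>A\<^esub> inc i = g i)))"

definition AB3 :: "'u itself \<Rightarrow> ('o, 'm, 'z) category_scheme \<Rightarrow> bool" where
  "AB3 U A \<longleftrightarrow>
     (\<forall>(I :: 'u set) F. (\<forall>i\<in>I. F i \<in> Ob A) \<longrightarrow> (\<exists>c inc. is_coproduct A I F c inc))"

definition AB4 :: "'u itself \<Rightarrow> ('o, 'm, 'z) preadditive_scheme \<Rightarrow> bool" where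
  "AB4 U A \<longleftrightarrow>
     (\<forall>(I :: 'u set) f g a ia b ib c ic F G.
        (\<forall>i\<in>I. short_exact A (f i) (g i)) \<and>
        is_coproduct A I (\<lambda>i. Dom A (f i)) a ia \<and>
        is_coproduct A I (\<lambda>i. Dom A (g i)) b ib \<and>
        is_coproduct A I (\<lambda>i. Cod A (g i)) c ic \<and>
        F \<in> Hom A a b \<and> (\<forall>i\<in>I. F \<cdot>\<^bsub>A\<^esub> ia i = ib i \<cdot>\<^bsub>A\<^esub> f i) \<and>
        G \<in> Hom A b c \<and> (\<forall>i\<in>I. G \<cdot>\<^bsub>A\<^esub> ib i = ic i \<cdot>\<^bsub>A\<^esub> g i) \<longrightarrow>
        short_exact A F G)"

definition AB4_category :: "'u itself \<Rightarrow> ('o, 'm, 'z) preadditive_scheme \<Rightarrow> bool" where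
  "AB4_category U A \<longleftrightarrow> abelian_category A \<and> AB3 U A \<and> AB4 U A"

text \<open>A chosen coproduct, and the arrow out of it with prescribed components.\<close>

definition coprod :: "('o, 'm, 'z) category_scheme \<Rightarrow> 'i set \<Rightarrow> ('i \<Rightarrow> 'o) \<Rightarrow> 'o \<times> ('i \<Rightarrow> 'm)" where
  "coprod A I F = (SOME p. is_coproduct A I F (fst p) (snd p))"

definition coprod_ob :: "('o, 'm, 'z) category_scheme \<Rightarrow> 'i set \<Rightarrow> ('i \<Rightarrow> 'o) \<Rightarrow> 'o" where
  "coprod_ob A I F = fst (coprod A I F)"

definition coprod_in :: "('o, 'm, 'z) category_scheme \<Rightarrow> 'i set \<Rightarrow> ('i \<Rightarrow> 'o) \<Rightarrow> 'i \<Rightarrow> 'm" where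
  "coprod_in A I F = snd (coprod A I F)"

definition coprod_desc ::
  "('o, 'm, 'z) category_scheme \<Rightarrow> 'i set \<Rightarrow> ('i \<Rightarrow> 'o) \<Rightarrow> 'o \<Rightarrow> ('i \<Rightarrow> 'm) \<Rightarrow> 'm" where
  "coprod_desc A I F x g =
     (THE h. h \<in> Hom A (coprod_ob A I F) x \<and> (\<forall>i\<in>I. h \<cdot>\<^bsub>A\<^esub> coprod_in A I F i = g i))"


section \<open>The functor category \<open>A\<^sup>C\<close>\<close>

text \<open>
  Functors and natural transformations are made extensional so that two of them are equal
  as soon as they agree on \<open>C\<close>. The additive structure is pointwise.
\<close>

definition fun_cat ::
  "('o, 'm, 'y) category_scheme \<Rightarrow> ('p, 'n, 'z) preadditive_scheme
    \<Rightarrow> (('o, 'm, 'p, 'n) functor_data, (('o, 'm, 'p, 'n) functor_data, 'o \<Rightarrow> 'n) mor) preadditive"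
  where
  "fun_cat C A =
     (let functors = {F. is_functor C A F \<and> FOb F \<in> extensional (Ob C)
                                          \<and> FAr F \<in> extensional (Arr C)}
      in \<lparr>Ob = functors,
          Arr = {Mor F \<eta> G | F \<eta> G. F \<in> functors \<and> G \<in> functors \<and>
                                    is_nat_trans C A F G \<eta> \<and> \<eta> \<in> extensional (Ob C)},
          Dom = src, Cod = tgt,
          Ide = (\<lambda>F. Mor F (\<lambda>a\<in>Ob C. Ide A (FOb F a)) F),
          Comp = (\<lambda>s t. Mor (src t) (\<lambda>a\<in>Ob C. body s a \<cdot>\<^bsub>A\<^esub> body t a) (tgt s)),
          Zero = (\<lambda>F G. Mor F (\<lambda>a\<in>Ob C. Zero A (FOb F a) (FOb G a)) G),
          Add = (\<lambda>s t. Mor (src s) (\<lambda>a\<in>Ob C. Add A (body s a) (body t a)) (tgt s))\<rparr>)"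


section \<open>Colimits and their left satellites\<close>

definition is_colimit ::
  "('o, 'm, 'y) category_scheme \<Rightarrow> ('p, 'n, 'z) category_scheme
    \<Rightarrow> ('o, 'm, 'p, 'n) functor_data \<Rightarrow> 'p \<Rightarrow> ('o \<Rightarrow> 'n) \<Rightarrow> bool" where
  "is_colimit C A F c \<iota> \<longleftrightarrow>
     c \<in> Ob A \<and> (\<forall>i\<in>Ob C. \<iota> i \<in> Hom A (FOb F i) c) \<and>
     (\<forall>u\<in>Arr C. \<iota> (Cod C u) \<cdot>\<^bsub>A\<^esub> FAr F u = \<iota> (Dom C u)) \<and>
     (\<forall>x\<in>Ob A. \<forall>\<kappa>. (\<forall>i\<in>Ob C. \<kappa> i \<in> Hom A (FOb F i) x) \<and>
                   (\<forall>u\<in>Arr C. \<kappa> (Cod C u) \<cdot>\<^bsub>A\<^esub> FAr F u = \<kappa> (Dom C u)) \<longrightarrow>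
        (\<exists>!h. h \<in> Hom A c x \<and> (\<forall>i\<in>Ob C. h \<cdot>\<^bsub>A\<^esub> \<iota> i = \<kappa> i)))"

text \<open>\<open>L\<close> is a colimit functor \<open>A\<^sup>C \<rightarrow> A\<close> (for some choice of colimits).\<close>

definition is_colimit_functor ::
  "('o, 'm, 'y) category_scheme \<Rightarrow> ('p, 'n, 'z) preadditive_scheme
    \<Rightarrow> (('o, 'm, 'p, 'n) functor_data, (('o, 'm, 'p, 'n) functor_data, 'o \<Rightarrow> 'n) mor, 'p, 'n)
        functor_data \<Rightarrow> bool" where
  "is_colimit_functor C A L \<longleftrightarrow>
     is_functor (fun_cat C A) A L \<and>
     (\<exists>\<iota>. (\<forall>F\<in>Ob (fun_cat C A). is_colimit C A F (FOb L F) (\<iota> F)) \<and>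
          (\<forall>s\<in>Arr (fun_cat C A). \<forall>i\<in>Ob C.
             FAr L s \<cdot>\<^bsub>A\<^esub> \<iota> (src s) i = \<iota> (tgt s) i \<cdot>\<^bsub>A\<^esub> body s i))"

definition is_additive_functor ::
  "('o, 'm, 'y) preadditive_scheme \<Rightarrow> ('p, 'n, 'z) preadditive_scheme
    \<Rightarrow> ('o, 'm, 'p, 'n) functor_data \<Rightarrow> bool" where
  "is_additive_functor B A F \<longleftrightarrow> is_functor B A F \<and>
     (\<forall>s\<in>Arr B. \<forall>t\<in>Arr B. Dom B s = Dom B t \<and> Cod B s = Cod B t \<longrightarrow>
        FAr F (Add B s t) = Add A (FAr F s) (FAr F t))"

text \<open>
  A homological \<open>\<partial>\<close>-functor consists of functors \<open>T\<^sub>n\<close> and, for each short exact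
  sequence \<open>0 \<rightarrow> a \<rightarrow> b \<rightarrow> c \<rightarrow> 0\<close> given by \<open>f\<close> and \<open>g\<close>, connecting arrows
  \<open>conn T n f g : T\<^sub>n\<^sub>+\<^sub>1 c \<rightarrow> T\<^sub>n a\<close>. The last exactness condition is the end
  \<open>T\<^sub>0 b \<rightarrow> T\<^sub>0 c \<rightarrow> 0\<close> of the long exact sequence.
\<close>

record ('o, 'm, 'p, 'n) delta_data =
  deg :: "nat \<Rightarrow> ('o, 'm, 'p, 'n) functor_data"
  conn :: "nat \<Rightarrow> 'm \<Rightarrow> 'm \<Rightarrow> 'n"

definition is_delta_functor ::
  "('o, 'm, 'y) preadditive_scheme \<Rightarrow> ('p, 'n, 'z) preadditive_scheme
    \<Rightarrow> ('o, 'm, 'p, 'n) delta_data \<Rightarrow> bool" where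
  "is_delta_functor B A T \<longleftrightarrow>
     (\<forall>n. is_additive_functor B A (deg T n)) \<and>
     (\<forall>n f g. short_exact B f g \<longrightarrow>
        conn T n f g \<in> Hom A (FOb (deg T (Suc n)) (Cod B g)) (FOb (deg T n) (Dom B f))) \<and>
     (\<forall>n f g f' g' u v w. short_exact B f g \<and> short_exact B f' g' \<and>
        u \<in> Hom B (Dom B f) (Dom B f') \<and> v \<in> Hom B (Cod B f) (Cod B f') \<and>
        w \<in> Hom B (Cod B g) (Cod B g') \<and>
        v \<cdot>\<^bsub>B\<^esub> f = f' \<cdot>\<^bsub>B\<^esub> u \<and> w \<cdot>\<^bsub>B\<^esub> g = g' \<cdot>\<^bsub>B\<^esub> v \<longrightarrow>
        conn T n f' g' \<cdot>\<^bsub>A\<^esub> FAr (deg T (Suc n)) w = FAr (deg T n) u \<cdot>\<^bsub>A\<^esub> conn T n f g) \<and>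
     (\<forall>f g. short_exact B f g \<longrightarrow>
        (\<forall>n. exact A (FAr (deg T n) f) (FAr (deg T n) g) \<and>
             exact A (FAr (deg T (Suc n)) g) (conn T n f g) \<and>
             exact A (conn T n f g) (FAr (deg T n) f)) \<and>
        is_epi A (FAr (deg T 0) g))"

definition is_delta_morphism ::
  "('o, 'm, 'y) preadditive_scheme \<Rightarrow> ('p, 'n, 'z) preadditive_scheme
    \<Rightarrow> ('o, 'm, 'p, 'n) delta_data \<Rightarrow> ('o, 'm, 'p, 'n) delta_data \<Rightarrow> (nat \<Rightarrow> 'o \<Rightarrow> 'n) \<Rightarrow> bool" where
  "is_delta_morphism B A S T \<phi> \<longleftrightarrow>
     (\<forall>n. is_nat_trans B A (deg S n) (deg T n) (\<phi> n)) \<and>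
     (\<forall>n f g. short_exact B f g \<longrightarrow>
        \<phi> n (Dom B f) \<cdot>\<^bsub>A\<^esub> conn S n f g = conn T n f g \<cdot>\<^bsub>A\<^esub> \<phi> (Suc n) (Cod B g))"

definition is_universal_delta_functor ::
  "('o, 'm, 'y) preadditive_scheme \<Rightarrow> ('p, 'n, 'z) preadditive_scheme
    \<Rightarrow> ('o, 'm, 'p, 'n) delta_data \<Rightarrow> bool" where
  "is_universal_delta_functor B A T \<longleftrightarrow>
     is_delta_functor B A T \<and>
     (\<forall>S \<psi>. is_delta_functor B A S \<and> is_nat_trans B A (deg S 0) (deg T 0) \<psi> \<longrightarrow>
        (\<exists>\<phi>. is_delta_morphism B A S T \<phi> \<and> (\<forall>b\<in>Ob B. \<phi> 0 b = \<psi> b)) \<and>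
        (\<forall>\<phi> \<phi>'. is_delta_morphism B A S T \<phi> \<and> (\<forall>b\<in>Ob B. \<phi> 0 b = \<psi> b) \<and>
                is_delta_morphism B A S T \<phi>' \<and> (\<forall>b\<in>Ob B. \<phi>' 0 b = \<psi> b) \<longrightarrow>
                (\<forall>n. \<forall>b\<in>Ob B. \<phi> n b = \<phi>' n b)))"

definition is_left_satellites ::
  "('o, 'm, 'y) preadditive_scheme \<Rightarrow> ('p, 'n, 'z) preadditive_scheme
    \<Rightarrow> ('o, 'm, 'p, 'n) functor_data \<Rightarrow> ('o, 'm, 'p, 'n) delta_data \<Rightarrow> bool" where
  "is_left_satellites B A L T \<longleftrightarrow>
     is_universal_delta_functor B A T \<and> (\<exists>\<eta>. is_nat_iso B A (deg T 0) L \<eta>)"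

text \<open>\<open>deg T n\<close> is the \<open>n\<close>-th left satellite of the colimit over \<open>C\<close>.\<close>

definition is_colim_satellites ::
  "('o, 'm, 'y) category_scheme \<Rightarrow> ('p, 'n, 'z) preadditive_scheme
    \<Rightarrow> (('o, 'm, 'p, 'n) functor_data, (('o, 'm, 'p, 'n) functor_data, 'o \<Rightarrow> 'n) mor, 'p, 'n)
        delta_data \<Rightarrow> bool" where
  "is_colim_satellites C A T \<longleftrightarrow>
     (\<exists>L. is_colimit_functor C A L \<and> is_left_satellites (fun_cat C A) A L T)"


section \<open>The category \<open>D/X\<close> and the direct image\<close>

text \<open>
  For a presheaf \<open>X\<close> on \<open>D\<close>, objects of \<open>D/X\<close> are pairs \<open>(d, x)\<close> with \<open>x \<in> X(d)\<close>, which
  by the Yoneda lemma stand for the natural transformations from \<open>D(-, d)\<close> to \<open>X\<close>.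
\<close>

definition elements_cat ::
  "('o, 'm, 'z) category_scheme \<Rightarrow> ('o, 'm, 'u set, ('u set, 'u \<Rightarrow> 'u) mor) functor_data
    \<Rightarrow> ('o \<times> 'u, ('o \<times> 'u, 'm) mor) category" where
  "elements_cat D X =
     \<lparr>Ob = {(d, x). d \<in> Ob D \<and> x \<in> FOb X d},
      Arr = {Mor (d, x) \<alpha> (e, y) | d x \<alpha> e y.
               \<alpha> \<in> Hom D d e \<and> x \<in> FOb X d \<and> y \<in> FOb X e \<and> body (FAr X \<alpha>) y = x},
      Dom = src, Cod = tgt,
      Ide = (\<lambda>p. Mor p (Ide D (fst p)) p),
      Comp = (\<lambda>t s. Mor (src s) (body t \<cdot>\<^bsub>D\<^esub> body s) (tgt t))\<rparr>"

text \<open>The fibre of \<open>f : X \<rightarrow> Y\<close> over an object \<open>(d, y)\<close> of \<open>D/Y\<close>.\<close>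

definition fibre ::
  "('o, 'm, 'u set, ('u set, 'u \<Rightarrow> 'u) mor) functor_data \<Rightarrow> ('o \<Rightarrow> ('u set, 'u \<Rightarrow> 'u) mor)
    \<Rightarrow> 'o \<times> 'u \<Rightarrow> 'u set" where
  "fibre X f q = {x \<in> FOb X (fst q). body (f (fst q)) x = snd q}"

definition direct_image_ob ::
  "('o, 'm, 'y) category_scheme \<Rightarrow> ('p, 'n, 'z) category_scheme
    \<Rightarrow> ('o, 'm, 'u set, ('u set, 'u \<Rightarrow> 'u) mor) functor_data
    \<Rightarrow> ('o, 'm, 'u set, ('u set, 'u \<Rightarrow> 'u) mor) functor_data
    \<Rightarrow> ('o \<Rightarrow> ('u set, 'u \<Rightarrow> 'u) mor)
    \<Rightarrow> ('o \<times> 'u, ('o \<times> 'u, 'm) mor, 'p, 'n) functor_data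
    \<Rightarrow> ('o \<times> 'u, ('o \<times> 'u, 'm) mor, 'p, 'n) functor_data" where
  "direct_image_ob D A X Y f F =
     (let fam = (\<lambda>q x. FOb F (fst q, x))
      in \<lparr>FOb = (\<lambda>q\<in>Ob (elements_cat D Y). coprod_ob A (fibre X f q) (fam q)),
          FAr = (\<lambda>b\<in>Arr (elements_cat D Y).
            let q = src b; r = tgt b; \<beta> = body b
            in coprod_desc A (fibre X f r) (fam r) (coprod_ob A (fibre X f q) (fam q))
                 (\<lambda>x. let x' = body (FAr X \<beta>) x
                      in coprod_in A (fibre X f q) (fam q) x'
                           \<cdot>\<^bsub>A\<^esub> FAr F (Mor (fst q, x') \<beta> (fst r, x))))\<rparr>)"

text \<open>
  The functor \<open>f\<^sub>*\<close> from \<open>A\<close>-valued functors on \<open>(D/X)\<^sup>o\<^sup>p\<close> to those on \<open>(D/Y)\<^sup>o\<^sup>p\<close>; on a natural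
  transformation \<open>\<eta>\<close> it is characterised by \<open>(f\<^sub>* \<eta>)\<^sub>y \<cdot> in\<^sub>x = in\<^sub>x \<cdot> \<eta>\<^sub>x\<close>.
\<close>

definition direct_image ::
  "('o, 'm, 'y) category_scheme \<Rightarrow> ('p, 'n, 'z) category_scheme
    \<Rightarrow> ('o, 'm, 'u set, ('u set, 'u \<Rightarrow> 'u) mor) functor_data
    \<Rightarrow> ('o, 'm, 'u set, ('u set, 'u \<Rightarrow> 'u) mor) functor_data
    \<Rightarrow> ('o \<Rightarrow> ('u set, 'u \<Rightarrow> 'u) mor)
    \<Rightarrow> (('o \<times> 'u, ('o \<times> 'u, 'm) mor, 'p, 'n) functor_data,
        (('o \<times> 'u, ('o \<times> 'u, 'm) mor, 'p, 'n) functor_data, 'o \<times> 'u \<Rightarrow> 'n) mor,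
        ('o \<times> 'u, ('o \<times> 'u, 'm) mor, 'p, 'n) functor_data,
        (('o \<times> 'u, ('o \<times> 'u, 'm) mor, 'p, 'n) functor_data, 'o \<times> 'u \<Rightarrow> 'n) mor) functor_data"
  where
  "direct_image D A X Y f =
     \<lparr>FOb = direct_image_ob D A X Y f,
      FAr = (\<lambda>s. Mor (direct_image_ob D A X Y f (src s))
        (\<lambda>q\<in>Ob (elements_cat D Y).
           let fam = (\<lambda>F x. FOb F (fst q, x))
           in coprod_desc A (fibre X f q) (fam (src s)) (coprod_ob A (fibre X f q) (fam (tgt s)))
                (\<lambda>x. coprod_in A (fibre X f q) (fam (tgt s)) x \<cdot>\<^bsub>A\<^esub> body s (fst q, x)))
        (direct_image_ob D A X Y f (tgt s)))\<rparr>"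

end

theory Submission
  imports Defs
begin

text \<open>
  The proof is formal and needs no explicit complexes. By AB4 the direct image \<open>f\<^sub>*\<close> is exact; it is
  left adjoint to the restriction \<open>f\<^sup>*\<close>, which is exact as well, and \<open>colim\<^sub>X = colim\<^sub>Y f\<^sub>*\<close>.
  Hence \<open>S f\<^sub>*\<close> and \<open>T f\<^sup>*\<close> are homological \<open>\<partial>\<close>-functors, and the isomorphism
  \<open>\<theta> : T\<^sub>0 \<cong> S\<^sub>0 f\<^sub>*\<close> yields \<open>\<phi> : S f\<^sub>* \<rightarrow> T\<close> extending \<open>\<theta>\<^sup>-\<^sup>1\<close> by universality of \<open>T\<close>, and
  \<open>\<chi> : T f\<^sup>* \<rightarrow> S\<close> extending \<open>S\<^sub>0 \<epsilon> \<cdot> \<theta> f\<^sup>*\<close> by universality of \<open>S\<close>. Put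
  \<open>\<psi> = \<chi> f\<^sub>* \<cdot> T \<eta> : T \<rightarrow> S f\<^sub>*\<close>. In degree \<open>0\<close> it is \<open>\<theta>\<close>, so \<open>\<phi> \<cdot> \<psi> = id\<close> by uniqueness for \<open>T\<close>.
  Uniqueness for \<open>S\<close> gives \<open>\<chi> \<cdot> \<phi> f\<^sup>* = S \<epsilon>\<close>, so \<open>\<psi> \<cdot> \<phi> = S (\<epsilon> f\<^sub>* \<cdot> f\<^sub>* \<eta>) = id\<close> by a triangle identity,
  although \<open>S f\<^sub>*\<close> is not known to be universal beforehand.
\<close>

section \<open>Functors and delta-functors\<close>

text \<open>Universality only produces morphisms whose target is \<open>T\<close> or
  \<open>S\<close>, whereas the wanted isomorphism ends in \<open>S f\<^sub>*\<close>. The usual way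
  out, effaceability of the higher \<open>S\<^sub>n f\<^sub>*\<close>, takes resolutions or the bar
  complex as extra input; the adjunction replaces it. Precomposition reverses the roles of adjoint
  functors: precomposition with \<open>f\<^sup>*\<close> is left adjoint to precomposition with
  \<open>f\<^sub>*\<close>, and exactness of both functors carries this over to delta-functors. A
  morphism \<open>T \<rightarrow> S f\<^sub>*\<close> is therefore the same thing as a morphism
  \<open>T f\<^sup>* \<rightarrow> S\<close>, whose target is universal; \<open>\<psi>\<close> is
  what \<open>\<chi>\<close> transposes back to. The degree-zero part prescribed for
  \<open>\<chi>\<close> is the transpose of \<open>\<theta>\<close>, which is why
  \<open>\<psi>\<close> starts with \<open>\<theta>\<close>. Exactness of coproducts is spent at one
  point, the exactness of \<open>f\<^sub>*\<close>. Both exactness claims rest on the fact that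
  short exactness in a functor category is decided objectwise, and this has to be derived from the
  universal properties of kernels and cokernels.\<close>

lemma Hom_iff: "f \<in> Hom C a b \<longleftrightarrow> f \<in> Arr C \<and> Dom C f = a \<and> Cod C f = b"
  by (auto simp: Hom_def)

lemma functor_Ob: "is_functor C A F \<Longrightarrow> a \<in> Ob C \<Longrightarrow> FOb F a \<in> Ob A"
  by (simp add: is_functor_def)

lemma functor_Hom: "is_functor C A F \<Longrightarrow> u \<in> Hom C a b \<Longrightarrow> FAr F u \<in> Hom A (FOb F a) (FOb F b)"
  by (auto simp: is_functor_def Hom_iff)

lemma functor_Ide: "is_functor C A F \<Longrightarrow> a \<in> Ob C \<Longrightarrow> FAr F (Ide C a) = Ide A (FOb F a)"
  by (simp add: is_functor_def)

lemma functor_Comp: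
  "is_functor C A F \<Longrightarrow> u \<in> Hom C a b \<Longrightarrow> v \<in> Hom C b c
    \<Longrightarrow> FAr F (v \<cdot>\<^bsub>C\<^esub> u) = FAr F v \<cdot>\<^bsub>A\<^esub> FAr F u"
  by (auto simp: is_functor_def Hom_iff)

lemma nat_trans_Hom: "is_nat_trans C A F G \<eta> \<Longrightarrow> a \<in> Ob C \<Longrightarrow> \<eta> a \<in> Hom A (FOb F a) (FOb G a)"
  by (simp add: is_nat_trans_def)

lemma nat_trans_square:
  "is_nat_trans C A F G \<eta> \<Longrightarrow> u \<in> Hom C a b \<Longrightarrow> \<eta> b \<cdot>\<^bsub>A\<^esub> FAr F u = FAr G u \<cdot>\<^bsub>A\<^esub> \<eta> a"
  by (auto simp: is_nat_trans_def Hom_iff)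

lemma FOb_functor_comp [simp]: "FOb (functor_comp G F) a = FOb G (FOb F a)"
  by (simp add: functor_comp_def)

lemma FAr_functor_comp [simp]: "FAr (functor_comp G F) u = FAr G (FAr F u)"
  by (simp add: functor_comp_def)

lemma is_functor_functor_comp:
  assumes F: "is_functor B C F" and G: "is_functor C A G"
  shows "is_functor B A (functor_comp G F)"
  using assms unfolding is_functor_def by (simp add: Hom_iff)

lemma is_nat_trans_whisker_left:
  assumes "is_nat_trans B C F G \<eta>" and "is_functor B C F" and "is_functor B C G"
    and H: "is_functor C A H" and B: "category B"
  shows "is_nat_trans B A (functor_comp H F) (functor_comp H G) (\<lambda>b. FAr H (\<eta> b))"
  unfolding is_nat_trans_def
proof (intro conjI ballI)
  fix a assume "a \<in> Ob B"
  then show "FAr H (\<eta> a) \<in> Hom A (FOb (functor_comp H F) a) (FOb (functor_comp H G) a)"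
    using functor_Hom[OF H] nat_trans_Hom[OF assms(1)] by simp
next
  fix u assume u: "u \<in> Arr B"
  have D: "Dom B u \<in> Ob B" and E: "Cod B u \<in> Ob B" and uH: "u \<in> Hom B (Dom B u) (Cod B u)"
    using u B by (auto simp: category_def Hom_iff)
  show "FAr H (\<eta> (Cod B u)) \<cdot>\<^bsub>A\<^esub> FAr (functor_comp H F) u
        = FAr (functor_comp H G) u \<cdot>\<^bsub>A\<^esub> FAr H (\<eta> (Dom B u))"
    using functor_Comp[OF H functor_Hom[OF assms(2) uH] nat_trans_Hom[OF assms(1) E]]
      functor_Comp[OF H nat_trans_Hom[OF assms(1) D] functor_Hom[OF assms(3) uH]]
      nat_trans_square[OF assms(1) uH] by simp
qed

lemma is_nat_trans_whisker_right:
  assumes "is_functor B C F" and "is_nat_trans C A G H \<eta>"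
  shows "is_nat_trans B A (functor_comp G F) (functor_comp H F) (\<lambda>b. \<eta> (FOb F b))"
  using assms unfolding is_nat_trans_def is_functor_def by (simp add: Hom_iff) metis

lemma is_nat_trans_compose:
  assumes A: "category A" and B: "category B"
    and F: "is_functor B A F" and G: "is_functor B A G" and H: "is_functor B A H"
    and \<phi>: "is_nat_trans B A F G \<phi>" and \<psi>: "is_nat_trans B A G H \<psi>"
  shows "is_nat_trans B A F H (\<lambda>b. \<psi> b \<cdot>\<^bsub>A\<^esub> \<phi> b)"
  unfolding is_nat_trans_def
proof (intro conjI ballI)
  fix a assume "a \<in> Ob B"
  then show "\<psi> a \<cdot>\<^bsub>A\<^esub> \<phi> a \<in> Hom A (FOb F a) (FOb H a)"
    using category.Comp_in_Hom[OF A] nat_trans_Hom[OF \<phi>] nat_trans_Hom[OF \<psi>] by blast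
next
  fix u assume u: "u \<in> Arr B"
  have a: "Dom B u \<in> Ob B" and b: "Cod B u \<in> Ob B" and uH: "u \<in> Hom B (Dom B u) (Cod B u)"
    using u B by (auto simp: category_def Hom_iff)
  show "\<psi> (Cod B u) \<cdot>\<^bsub>A\<^esub> \<phi> (Cod B u) \<cdot>\<^bsub>A\<^esub> FAr F u = FAr H u \<cdot>\<^bsub>A\<^esub> (\<psi> (Dom B u) \<cdot>\<^bsub>A\<^esub> \<phi> (Dom B u))"
    using category.Comp_assoc[OF A functor_Hom[OF F uH] nat_trans_Hom[OF \<phi> b] nat_trans_Hom[OF \<psi> b]]
      category.Comp_assoc[OF A nat_trans_Hom[OF \<phi> a] functor_Hom[OF G uH] nat_trans_Hom[OF \<psi> b]]
      category.Comp_assoc[OF A nat_trans_Hom[OF \<phi> a] nat_trans_Hom[OF \<psi> a] functor_Hom[OF H uH]]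
      nat_trans_square[OF \<phi> uH] nat_trans_square[OF \<psi> uH] by metis
qed

text \<open>Composing with it gives back the same record, an equation and not just an isomorphism.
  Whiskering by a unit thus starts at \<open>T\<close> itself, and whiskering by a counit ends at
  \<open>S\<close> itself.\<close>

definition id_functor :: "('o, 'm, 'o, 'm) functor_data" where
  "id_functor = \<lparr>FOb = (\<lambda>a. a), FAr = (\<lambda>u. u)\<rparr>"

lemma id_functor_simps [simp]: "FOb id_functor a = a" "FAr id_functor u = u"
  by (simp_all add: id_functor_def)

lemma functor_comp_id [simp]: "functor_comp F id_functor = F" "functor_comp id_functor F = F"
  by (simp_all add: functor_comp_def)

lemma functor_comp_assoc: "functor_comp (functor_comp H G) F = functor_comp H (functor_comp G F)"
  by (simp add: functor_comp_def)

section \<open>Exact functors and their composites with delta-functors\<close>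

definition is_exact_functor ::
  "('o, 'm, 'y) preadditive_scheme \<Rightarrow> ('p, 'n, 'z) preadditive_scheme
    \<Rightarrow> ('o, 'm, 'p, 'n) functor_data \<Rightarrow> bool" where
  "is_exact_functor B C F \<longleftrightarrow> is_additive_functor B C F \<and>
     (\<forall>f g. short_exact B f g \<longrightarrow> short_exact C (FAr F f) (FAr F g))"

lemma exact_functorD:
  assumes "is_exact_functor B C F"
  shows "is_functor B C F" and "is_additive_functor B C F"
    and "short_exact B f g \<Longrightarrow> short_exact C (FAr F f) (FAr F g)"
  using assms by (auto simp: is_exact_functor_def is_additive_functor_def)

lemma is_additive_functor_comp:
  assumes "is_additive_functor B C F" and "is_additive_functor C A G"
  shows "is_additive_functor B A (functor_comp G F)"
  using assms is_functor_functor_comp[of B C F A G] functor_Hom[of B C F]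
  unfolding is_additive_functor_def by (simp add: Hom_iff)

lemma is_exact_functor_comp:
  assumes "is_exact_functor B C F" and "is_exact_functor C A G"
  shows "is_exact_functor B A (functor_comp G F)"
  using assms is_additive_functor_comp[of B C F A G] unfolding is_exact_functor_def by simp

lemma is_functor_id: "category B \<Longrightarrow> is_functor B B id_functor"
  by (auto simp: is_functor_def Hom_iff)

lemma is_exact_functor_id: "category B \<Longrightarrow> is_exact_functor B B id_functor"
  by (simp add: is_exact_functor_def is_additive_functor_def is_functor_id)

lemma short_exact_arrows:
  assumes "short_exact B f g"
  shows "f \<in> Hom B (Dom B f) (Cod B f)" and "g \<in> Hom B (Cod B f) (Cod B g)"
  using assms by (auto simp: short_exact_def is_kernel_def Hom_iff)

definition delta_comp ::
  "('p, 'n, 'q, 'k) delta_data \<Rightarrow> ('o, 'm, 'p, 'n) functor_data \<Rightarrow> ('o, 'm, 'q, 'k) delta_data" where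
  "delta_comp T F = \<lparr>deg = (\<lambda>n. functor_comp (deg T n) F),
                     conn = (\<lambda>n f g. conn T n (FAr F f) (FAr F g))\<rparr>"

lemma delta_comp_simps [simp]:
  "deg (delta_comp T F) n = functor_comp (deg T n) F"
  "conn (delta_comp T F) n f g = conn T n (FAr F f) (FAr F g)"
  by (simp_all add: delta_comp_def)

lemma delta_comp_id [simp]: "delta_comp T id_functor = T"
  by (simp add: delta_comp_def)

lemma delta_comp_assoc: "delta_comp (delta_comp T G) F = delta_comp T (functor_comp G F)"
  by (simp add: delta_comp_def functor_comp_def)

lemma delta_functor_deg:
  "is_delta_functor B A T \<Longrightarrow> is_additive_functor B A (deg T n)"
  "is_delta_functor B A T \<Longrightarrow> is_functor B A (deg T n)"
  by (auto simp: is_delta_functor_def is_additive_functor_def)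

lemma delta_functor_conn:
  "is_delta_functor B A T \<Longrightarrow> short_exact B f g
    \<Longrightarrow> conn T n f g \<in> Hom A (FOb (deg T (Suc n)) (Cod B g)) (FOb (deg T n) (Dom B f))"
  by (auto simp: is_delta_functor_def)

lemma delta_functor_conn_natural:
  "is_delta_functor B A T \<Longrightarrow> short_exact B f g \<Longrightarrow> short_exact B f' g' \<Longrightarrow>
    u \<in> Hom B (Dom B f) (Dom B f') \<Longrightarrow> v \<in> Hom B (Cod B f) (Cod B f') \<Longrightarrow>
    w \<in> Hom B (Cod B g) (Cod B g') \<Longrightarrow> v \<cdot>\<^bsub>B\<^esub> f = f' \<cdot>\<^bsub>B\<^esub> u \<Longrightarrow> w \<cdot>\<^bsub>B\<^esub> g = g' \<cdot>\<^bsub>B\<^esub> v \<Longrightarrow>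
    conn T n f' g' \<cdot>\<^bsub>A\<^esub> FAr (deg T (Suc n)) w = FAr (deg T n) u \<cdot>\<^bsub>A\<^esub> conn T n f g"
  unfolding is_delta_functor_def by blast

text \<open>Each clause for the composite at a short exact pair is the clause for \<open>T\<close>
  at the image pair. That pair is again short exact, which is what gives
  \<open>conn T n (FAr F f) (FAr F g)\<close> a meaning.\<close>

lemma is_delta_functor_comp:
  assumes T: "is_delta_functor C A T" and F: "is_exact_functor B C F"
  shows "is_delta_functor B A (delta_comp T F)"
proof -
  note Ff = exact_functorD(1)[OF F]
  have FH: "FAr F u \<in> Arr C \<and> Dom C (FAr F u) = FOb F (Dom B u) \<and> Cod C (FAr F u) = FOb F (Cod B u)"
    if "u \<in> Arr B" for u
    using functor_Hom[OF Ff, of u] that by (auto simp: Hom_iff)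
  have se: "f \<in> Arr B" "g \<in> Arr B" "Dom B g = Cod B f" if "short_exact B f g" for f g
    using short_exact_arrows[OF that] by (auto simp: Hom_iff)
  show ?thesis
    unfolding is_delta_functor_def
  proof (intro conjI allI impI; (elim conjE)?)
    fix n show "is_additive_functor B A (deg (delta_comp T F) n)"
      using is_additive_functor_comp[OF exact_functorD(2)[OF F] delta_functor_deg(1)[OF T]] by simp
  next
    fix n f g assume fg: "short_exact B f g"
    show "conn (delta_comp T F) n f g
      \<in> Hom A (FOb (deg (delta_comp T F) (Suc n)) (Cod B g)) (FOb (deg (delta_comp T F) n) (Dom B f))"
      using delta_functor_conn[OF T exact_functorD(3)[OF F fg], of n] se[OF fg] FH by simp
  next
    fix n f g f' g' u v w
    assume fg: "short_exact B f g" and fg': "short_exact B f' g'"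
      and u: "u \<in> Hom B (Dom B f) (Dom B f')" and v: "v \<in> Hom B (Cod B f) (Cod B f')"
      and w: "w \<in> Hom B (Cod B g) (Cod B g')"
      and sq: "v \<cdot>\<^bsub>B\<^esub> f = f' \<cdot>\<^bsub>B\<^esub> u" "w \<cdot>\<^bsub>B\<^esub> g = g' \<cdot>\<^bsub>B\<^esub> v"
    note a = short_exact_arrows[OF fg] and a' = short_exact_arrows[OF fg']
    have "FAr F v \<cdot>\<^bsub>C\<^esub> FAr F f = FAr F f' \<cdot>\<^bsub>C\<^esub> FAr F u"
      using functor_Comp[OF Ff a(1) v] functor_Comp[OF Ff u a'(1)] sq by simp
    moreover have "FAr F w \<cdot>\<^bsub>C\<^esub> FAr F g = FAr F g' \<cdot>\<^bsub>C\<^esub> FAr F v"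
      using functor_Comp[OF Ff a(2) w] functor_Comp[OF Ff v a'(2)] sq by simp
    ultimately show "conn (delta_comp T F) n f' g' \<cdot>\<^bsub>A\<^esub> FAr (deg (delta_comp T F) (Suc n)) w
      = FAr (deg (delta_comp T F) n) u \<cdot>\<^bsub>A\<^esub> conn (delta_comp T F) n f g"
      using delta_functor_conn_natural[OF T exact_functorD(3)[OF F fg] exact_functorD(3)[OF F fg']]
        functor_Hom[OF Ff u] functor_Hom[OF Ff v] functor_Hom[OF Ff w] se[OF fg] se[OF fg'] FH
      by simp
  next
    fix f g assume "short_exact B f g"
    then have fg: "short_exact C (FAr F f) (FAr F g)" by (rule exact_functorD(3)[OF F])
    then show "is_epi A (FAr (deg (delta_comp T F) 0) g)"
      using T unfolding is_delta_functor_def by simp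
    fix n
    show "exact A (FAr (deg (delta_comp T F) n) f) (FAr (deg (delta_comp T F) n) g)"
      "exact A (FAr (deg (delta_comp T F) (Suc n)) g) (conn (delta_comp T F) n f g)"
      "exact A (conn (delta_comp T F) n f g) (FAr (deg (delta_comp T F) n) f)"
      using T fg unfolding is_delta_functor_def by simp_all
  qed
qed

section \<open>Morphisms of delta-functors\<close>

lemma delta_morphism_nat_trans:
  "is_delta_morphism B A S T \<phi> \<Longrightarrow> is_nat_trans B A (deg S n) (deg T n) (\<phi> n)"
  by (simp add: is_delta_morphism_def)

lemma delta_morphism_conn:
  "is_delta_morphism B A S T \<phi> \<Longrightarrow> short_exact B f g
    \<Longrightarrow> \<phi> n (Dom B f) \<cdot>\<^bsub>A\<^esub> conn S n f g = conn T n f g \<cdot>\<^bsub>A\<^esub> \<phi> (Suc n) (Cod B g)"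
  by (simp add: is_delta_morphism_def)

lemma is_delta_morphism_comp:
  assumes \<phi>: "is_delta_morphism C A S T \<phi>" and F: "is_exact_functor B C F"
  shows "is_delta_morphism B A (delta_comp S F) (delta_comp T F) (\<lambda>n b. \<phi> n (FOb F b))"
  unfolding is_delta_morphism_def
proof (intro conjI allI impI)
  fix n show "is_nat_trans B A (deg (delta_comp S F) n) (deg (delta_comp T F) n) (\<lambda>b. \<phi> n (FOb F b))"
    using is_nat_trans_whisker_right[OF exact_functorD(1)[OF F] delta_morphism_nat_trans[OF \<phi>]]
    by simp
next
  fix n f g assume fg: "short_exact B f g"
  have "f \<in> Hom B (Dom B f) (Cod B f)" "g \<in> Hom B (Cod B f) (Cod B g)"
    using short_exact_arrows[OF fg] .
  then show "\<phi> n (FOb F (Dom B f)) \<cdot>\<^bsub>A\<^esub> conn (delta_comp S F) n f g =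
           conn (delta_comp T F) n f g \<cdot>\<^bsub>A\<^esub> \<phi> (Suc n) (FOb F (Cod B g))"
    using delta_morphism_conn[OF \<phi> exact_functorD(3)[OF F fg], of n]
      functor_Hom[OF exact_functorD(1)[OF F]] by (fastforce simp: Hom_iff)
qed

text \<open>At a short exact sequence the components of \<open>\<alpha>\<close> form a morphism from
  its image under \<open>F\<close> to its image under \<open>G\<close>, so compatibility with the
  connecting arrows is the naturality of \<open>conn\<close> for \<open>T\<close>.\<close>

lemma is_delta_morphism_whisker:
  assumes B: "category B" and T: "is_delta_functor C A T"
    and F: "is_exact_functor B C F" and G: "is_exact_functor B C G"
    and \<alpha>: "is_nat_trans B C F G \<alpha>"
  shows "is_delta_morphism B A (delta_comp T F) (delta_comp T G) (\<lambda>n b. FAr (deg T n) (\<alpha> b))"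
  unfolding is_delta_morphism_def
proof (intro conjI allI impI)
  fix n
  show "is_nat_trans B A (deg (delta_comp T F) n) (deg (delta_comp T G) n) (\<lambda>b. FAr (deg T n) (\<alpha> b))"
    using is_nat_trans_whisker_left[OF \<alpha> exact_functorD(1)[OF F] exact_functorD(1)[OF G]
        delta_functor_deg(2)[OF T] B] by simp
next
  fix n f g assume fg: "short_exact B f g"
  note a = short_exact_arrows[OF fg]
  have obs: "Dom B f \<in> Ob B" "Cod B f \<in> Ob B" "Cod B g \<in> Ob B"
    using a B by (auto simp: Hom_iff category_def)
  note Fa = a[THEN functor_Hom[OF exact_functorD(1)[OF F]]]
  note Ga = a[THEN functor_Hom[OF exact_functorD(1)[OF G]]]
  have *: "Dom C (FAr F f) = FOb F (Dom B f)" "Cod C (FAr F f) = FOb F (Cod B f)"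
    "Cod C (FAr F g) = FOb F (Cod B g)" "Dom C (FAr G f) = FOb G (Dom B f)"
    "Cod C (FAr G f) = FOb G (Cod B f)" "Cod C (FAr G g) = FOb G (Cod B g)"
    using Fa Ga by (simp_all add: Hom_iff)
  show "FAr (deg T n) (\<alpha> (Dom B f)) \<cdot>\<^bsub>A\<^esub> conn (delta_comp T F) n f g =
           conn (delta_comp T G) n f g \<cdot>\<^bsub>A\<^esub> FAr (deg T (Suc n)) (\<alpha> (Cod B g))"
    using delta_functor_conn_natural[OF T exact_functorD(3)[OF F fg] exact_functorD(3)[OF G fg],
        of "\<alpha> (Dom B f)" "\<alpha> (Cod B f)" "\<alpha> (Cod B g)" n]
      obs[THEN nat_trans_Hom[OF \<alpha>]] a[THEN nat_trans_square[OF \<alpha>]] *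
    by simp
qed

lemma is_delta_morphism_compose:
  assumes A: "category A" and B: "category B"
    and dS: "is_delta_functor B A S" and dT: "is_delta_functor B A T" and dU: "is_delta_functor B A U"
    and \<phi>: "is_delta_morphism B A S T \<phi>" and \<psi>: "is_delta_morphism B A T U \<psi>"
  shows "is_delta_morphism B A S U (\<lambda>n b. \<psi> n b \<cdot>\<^bsub>A\<^esub> \<phi> n b)"
  unfolding is_delta_morphism_def
proof (intro conjI allI impI)
  fix n show "is_nat_trans B A (deg S n) (deg U n) (\<lambda>b. \<psi> n b \<cdot>\<^bsub>A\<^esub> \<phi> n b)"
    using is_nat_trans_compose[OF A B] delta_functor_deg(2) dS dT dU
      delta_morphism_nat_trans[OF \<phi>] delta_morphism_nat_trans[OF \<psi>] by blast
next
  fix n f g assume fg: "short_exact B f g"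
  have a: "Dom B f \<in> Ob B" "Cod B g \<in> Ob B"
    using short_exact_arrows[OF fg] B by (auto simp: Hom_iff category_def)
  note p = a[THEN nat_trans_Hom[OF delta_morphism_nat_trans[OF \<phi>]]]
  note q = a[THEN nat_trans_Hom[OF delta_morphism_nat_trans[OF \<psi>]]]
  note c = dS[THEN delta_functor_conn, OF fg] dT[THEN delta_functor_conn, OF fg]
    dU[THEN delta_functor_conn, OF fg]
  show "\<psi> n (Dom B f) \<cdot>\<^bsub>A\<^esub> \<phi> n (Dom B f) \<cdot>\<^bsub>A\<^esub> conn S n f g =
           conn U n f g \<cdot>\<^bsub>A\<^esub> (\<psi> (Suc n) (Cod B g) \<cdot>\<^bsub>A\<^esub> \<phi> (Suc n) (Cod B g))"
    using category.Comp_assoc[OF A c(1) p(1) q(1)] category.Comp_assoc[OF A p(2) c(2) q(1)]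
      category.Comp_assoc[OF A p(2) q(2) c(3)]
      delta_morphism_conn[OF \<phi> fg] delta_morphism_conn[OF \<psi> fg]
    by metis
qed

lemma is_delta_morphism_id:
  assumes A: "category A" and B: "category B" and T: "is_delta_functor B A T"
  shows "is_delta_morphism B A T T (\<lambda>n b. Ide A (FOb (deg T n) b))"
proof -
  have "is_nat_trans B B id_functor id_functor (Ide B)"
    using B unfolding is_nat_trans_def category_def by (simp add: Hom_iff)
  \<comment> \<open>Whiskering the identity transformation gives the family
    \<open>FAr (deg T n) (Ide B b)\<close>, which equals the family of identities at objects of
    \<open>B\<close>. The facts below confirm that the conditions evaluate the family at objects
    only.\<close>
  from is_delta_morphism_whisker[OF B T is_exact_functor_id[OF B] is_exact_functor_id[OF B] this]
  have "is_delta_morphism B A T T (\<lambda>n b. FAr (deg T n) (Ide B b))" by simp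
  moreover have "FAr (deg T n) (Ide B b) = Ide A (FOb (deg T n) b)" if "b \<in> Ob B" for n b
    using functor_Ide[OF delta_functor_deg(2)[OF T] that] .
  moreover have "Dom B f \<in> Ob B" "Cod B f \<in> Ob B" if "f \<in> Arr B" for f
    using that B by (auto simp: category_def)
  moreover have "Dom B f \<in> Ob B" "Cod B g \<in> Ob B" if "short_exact B f g" for f g
    using that B by (auto simp: category_def short_exact_def is_kernel_def is_cokernel_def)
  ultimately show ?thesis
    unfolding is_delta_morphism_def is_nat_trans_def by simp
qed

text \<open>The last clause frees uniqueness from the prescribed degree-zero part: that part is
  taken from one of the two morphisms, whose degree 0 is a natural transformation anyway.\<close>

lemma universal_delta_functorD:
  assumes "is_universal_delta_functor B A T"
  shows "is_delta_functor B A T"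
    and "is_delta_functor B A S \<Longrightarrow> is_nat_trans B A (deg S 0) (deg T 0) \<psi>
      \<Longrightarrow> \<exists>\<phi>. is_delta_morphism B A S T \<phi> \<and> (\<forall>b\<in>Ob B. \<phi> 0 b = \<psi> b)"
    and "is_delta_functor B A S \<Longrightarrow> is_delta_morphism B A S T \<phi> \<Longrightarrow> is_delta_morphism B A S T \<phi>'
      \<Longrightarrow> (\<And>b. b \<in> Ob B \<Longrightarrow> \<phi> 0 b = \<phi>' 0 b) \<Longrightarrow> b \<in> Ob B \<Longrightarrow> \<phi> n b = \<phi>' n b"
proof -
  show "is_delta_functor B A T" using assms by (simp add: is_universal_delta_functor_def)
  show "is_delta_functor B A S \<Longrightarrow> is_nat_trans B A (deg S 0) (deg T 0) \<psi>
      \<Longrightarrow> \<exists>\<phi>. is_delta_morphism B A S T \<phi> \<and> (\<forall>b\<in>Ob B. \<phi> 0 b = \<psi> b)"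
    using assms unfolding is_universal_delta_functor_def by blast
  assume S: "is_delta_functor B A S" and \<phi>: "is_delta_morphism B A S T \<phi>"
    and \<phi>': "is_delta_morphism B A S T \<phi>'"
    and eq: "\<And>b. b \<in> Ob B \<Longrightarrow> \<phi> 0 b = \<phi>' 0 b" and b: "b \<in> Ob B"
  have "\<forall>\<psi> \<phi> \<phi>'. is_nat_trans B A (deg S 0) (deg T 0) \<psi> \<longrightarrow>
         is_delta_morphism B A S T \<phi> \<and> (\<forall>b\<in>Ob B. \<phi> 0 b = \<psi> b) \<and>
         is_delta_morphism B A S T \<phi>' \<and> (\<forall>b\<in>Ob B. \<phi>' 0 b = \<psi> b) \<longrightarrow>
         (\<forall>n. \<forall>b\<in>Ob B. \<phi> n b = \<phi>' n b)"
    using assms S unfolding is_universal_delta_functor_def by blast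
  from this[rule_format, OF delta_morphism_nat_trans[OF \<phi>'], of \<phi> \<phi>'] \<phi> \<phi>' eq b
  show "\<phi> n b = \<phi>' n b" by blast
qed

text \<open>\<open>is_iso\<close> yields an inverse at one object at a time. Any choice of them is
  natural: insert \<open>\<theta> a \<cdot> \<theta>' a\<close> at the source, apply the square of
  \<open>\<theta>\<close>, and cancel at the target.\<close>

lemma nat_iso_inverse:
  assumes A: "category A" and B: "category B"
    and F: "is_functor B A F" and G: "is_functor B A G" and \<theta>: "is_nat_iso B A F G \<theta>"
  obtains \<theta>' where "is_nat_trans B A G F \<theta>'"
    and "\<And>b. b \<in> Ob B \<Longrightarrow> \<theta>' b \<cdot>\<^bsub>A\<^esub> \<theta> b = Ide A (FOb F b)"
    and "\<And>b. b \<in> Ob B \<Longrightarrow> \<theta> b \<cdot>\<^bsub>A\<^esub> \<theta>' b = Ide A (FOb G b)"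
proof -
  have nt: "is_nat_trans B A F G \<theta>" using \<theta> by (simp add: is_nat_iso_def)
  have "\<exists>g. g \<in> Hom A (FOb G b) (FOb F b) \<and> g \<cdot>\<^bsub>A\<^esub> \<theta> b = Ide A (FOb F b) \<and>
            \<theta> b \<cdot>\<^bsub>A\<^esub> g = Ide A (FOb G b)" if b: "b \<in> Ob B" for b
  proof -
    have "is_iso A (\<theta> b)" using \<theta> b by (simp add: is_nat_iso_def)
    then show ?thesis using nat_trans_Hom[OF nt b] unfolding is_iso_def by (auto simp: Hom_iff)
  qed
  then obtain \<theta>' where H: "\<And>b. b \<in> Ob B \<Longrightarrow> \<theta>' b \<in> Hom A (FOb G b) (FOb F b)"
    and l: "\<And>b. b \<in> Ob B \<Longrightarrow> \<theta>' b \<cdot>\<^bsub>A\<^esub> \<theta> b = Ide A (FOb F b)"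
    and r: "\<And>b. b \<in> Ob B \<Longrightarrow> \<theta> b \<cdot>\<^bsub>A\<^esub> \<theta>' b = Ide A (FOb G b)"
    by metis
  have "is_nat_trans B A G F \<theta>'"
    unfolding is_nat_trans_def
  proof (intro conjI ballI H)
    fix u assume u: "u \<in> Arr B"
    let ?a = "Dom B u" and ?b = "Cod B u"
    have a: "?a \<in> Ob B" and b: "?b \<in> Ob B" and uH: "u \<in> Hom B ?a ?b"
      using u B by (auto simp: category_def Hom_iff)
    note Fu = functor_Hom[OF F uH] and Gu = functor_Hom[OF G uH]
      and ta = nat_trans_Hom[OF nt a] and tb = nat_trans_Hom[OF nt b]
    note comp = category.Comp_in_Hom[OF A] and assoc = category.Comp_assoc[OF A]
    have "\<theta>' ?b \<cdot>\<^bsub>A\<^esub> FAr G u = \<theta>' ?b \<cdot>\<^bsub>A\<^esub> (FAr G u \<cdot>\<^bsub>A\<^esub> (\<theta> ?a \<cdot>\<^bsub>A\<^esub> \<theta>' ?a))"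
      using r[OF a] category.Comp_Ide_right[OF A Gu] by simp
    also have "\<dots> = \<theta>' ?b \<cdot>\<^bsub>A\<^esub> (\<theta> ?b \<cdot>\<^bsub>A\<^esub> FAr F u \<cdot>\<^bsub>A\<^esub> \<theta>' ?a)"
      using assoc[OF H[OF a] ta Gu] nat_trans_square[OF nt uH] by simp
    also have "\<dots> = \<theta>' ?b \<cdot>\<^bsub>A\<^esub> \<theta> ?b \<cdot>\<^bsub>A\<^esub> FAr F u \<cdot>\<^bsub>A\<^esub> \<theta>' ?a"
      using assoc[OF H[OF a] comp[OF Fu tb] H[OF b]] assoc[OF Fu tb H[OF b]] by simp
    also have "\<dots> = FAr F u \<cdot>\<^bsub>A\<^esub> \<theta>' ?a"
      using l[OF b] category.Comp_Ide_left[OF A Fu] by simp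
    finally show "\<theta>' ?b \<cdot>\<^bsub>A\<^esub> FAr G u = FAr F u \<cdot>\<^bsub>A\<^esub> \<theta>' ?a" .
  qed
  then show thesis using l r that by blast
qed

lemma nat_isoI:
  assumes "is_nat_trans B A F G \<phi>" and "is_nat_trans B A G F \<psi>"
    and "\<And>b. b \<in> Ob B \<Longrightarrow> \<psi> b \<cdot>\<^bsub>A\<^esub> \<phi> b = Ide A (FOb F b)"
    and "\<And>b. b \<in> Ob B \<Longrightarrow> \<phi> b \<cdot>\<^bsub>A\<^esub> \<psi> b = Ide A (FOb G b)"
  shows "is_nat_iso B A F G \<phi>"
  unfolding is_nat_iso_def is_iso_def
proof (intro conjI ballI assms(1))
  fix b assume b: "b \<in> Ob B"
  note H = nat_trans_Hom[OF assms(1) b] nat_trans_Hom[OF assms(2) b]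
  show "\<phi> b \<in> Arr A" using H by (simp add: Hom_iff)
  show "\<exists>g\<in>Hom A (Cod A (\<phi> b)) (Dom A (\<phi> b)). g \<cdot>\<^bsub>A\<^esub> \<phi> b = Ide A (Dom A (\<phi> b)) \<and>
          \<phi> b \<cdot>\<^bsub>A\<^esub> g = Ide A (Cod A (\<phi> b))"
    using H assms(3,4)[OF b] by (intro bexI[of _ "\<psi> b"]) (auto simp: Hom_iff)
qed

text \<open>Formulated for an arbitrary pair of exact functors with unit and counit, since
  \<open>T\<close> and \<open>S\<close> enter only through their universality. The components of the
  witness form a morphism of delta-functors; the conclusion records its part in one degree.\<close>

theorem universal_delta_functor_exact_adjunction:
  assumes A: "category A" and B: "category B" and C: "category C"
    and T: "is_universal_delta_functor B A T" and S: "is_universal_delta_functor C A S"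
    and F: "is_exact_functor B C F" and R: "is_exact_functor C B R"
    and \<eta>: "is_nat_trans B B id_functor (functor_comp R F) \<eta>"
    and \<epsilon>: "is_nat_trans C C (functor_comp F R) id_functor \<epsilon>"
    and tri: "\<And>b. b \<in> Ob B \<Longrightarrow> \<epsilon> (FOb F b) \<cdot>\<^bsub>C\<^esub> FAr F (\<eta> b) = Ide C (FOb F b)"
    and \<theta>: "is_nat_iso B A (deg T 0) (functor_comp (deg S 0) F) \<theta>"
  shows "\<exists>\<phi>. is_nat_iso B A (deg T n) (functor_comp (deg S n) F) \<phi>"
proof -
  note comp = category.Comp_in_Hom[OF A] and assoc = category.Comp_assoc[OF A]
  note dT = universal_delta_functorD(1)[OF T] and dS = universal_delta_functorD(1)[OF S]
  note fT = delta_functor_deg(2)[OF dT] and fS = delta_functor_deg(2)[OF dS]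
  note fF = exact_functorD(1)[OF F] and fR = exact_functorD(1)[OF R]
  note RF = is_exact_functor_comp[OF F R] and FR = is_exact_functor_comp[OF R F]
  note dSF = is_delta_functor_comp[OF dS F] and dTR = is_delta_functor_comp[OF dT R]
  note fSF = is_functor_functor_comp[OF fF fS]
  note Fob = functor_Ob[OF fF] and Rob = functor_Ob[OF fR]
  have nt: "is_nat_trans B A (deg T 0) (functor_comp (deg S 0) F) \<theta>"
    using \<theta> by (simp add: is_nat_iso_def)
  obtain \<theta>' where nt': "is_nat_trans B A (functor_comp (deg S 0) F) (deg T 0) \<theta>'"
    and l: "\<And>b. b \<in> Ob B \<Longrightarrow> \<theta>' b \<cdot>\<^bsub>A\<^esub> \<theta> b = Ide A (FOb (deg T 0) b)"
    and r: "\<And>b. b \<in> Ob B \<Longrightarrow> \<theta> b \<cdot>\<^bsub>A\<^esub> \<theta>' b = Ide A (FOb (functor_comp (deg S 0) F) b)"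
    using nat_iso_inverse[OF A B fT fSF \<theta>] by blast
  obtain \<phi> where \<phi>: "is_delta_morphism B A (delta_comp S F) T \<phi>" and \<phi>0: "\<And>b. b \<in> Ob B \<Longrightarrow> \<phi> 0 b = \<theta>' b"
    using universal_delta_functorD(2)[OF T dSF, of \<theta>'] nt' by auto
  have S\<epsilon>: "is_delta_morphism C A (delta_comp S (functor_comp F R)) S (\<lambda>n c. FAr (deg S n) (\<epsilon> c))"
    using is_delta_morphism_whisker[OF C dS FR is_exact_functor_id[OF C] \<epsilon>] by simp
  have T\<eta>: "is_delta_morphism B A T (delta_comp T (functor_comp R F)) (\<lambda>n b. FAr (deg T n) (\<eta> b))"
    using is_delta_morphism_whisker[OF B dT is_exact_functor_id[OF B] RF \<eta>] by simp
  \<comment> \<open>The transpose of \<open>\<theta>\<close>: at \<open>R c\<close> it lands in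
    \<open>S\<^sub>0 F R c\<close>, and the counit leads on to \<open>S\<^sub>0 c\<close>.\<close>
  have "is_nat_trans C A (functor_comp (deg T 0) R) (deg S 0)
          (\<lambda>c. FAr (deg S 0) (\<epsilon> c) \<cdot>\<^bsub>A\<^esub> \<theta> (FOb R c))"
    using is_nat_trans_compose[OF A C is_functor_functor_comp[OF fR fT]
        is_functor_functor_comp[OF exact_functorD(1)[OF FR] fS] fS
        is_nat_trans_whisker_right[OF fR nt, unfolded functor_comp_assoc]
        delta_morphism_nat_trans[OF S\<epsilon>, of 0, simplified]] .
  from universal_delta_functorD(2)[OF S dTR, of "\<lambda>c. FAr (deg S 0) (\<epsilon> c) \<cdot>\<^bsub>A\<^esub> \<theta> (FOb R c)"] this
  obtain \<chi> where \<chi>: "is_delta_morphism C A (delta_comp T R) S \<chi>"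
    and \<chi>0: "\<And>c. c \<in> Ob C \<Longrightarrow> \<chi> 0 c = FAr (deg S 0) (\<epsilon> c) \<cdot>\<^bsub>A\<^esub> \<theta> (FOb R c)"
    by auto
  define \<psi> where "\<psi> n b = \<chi> n (FOb F b) \<cdot>\<^bsub>A\<^esub> FAr (deg T n) (\<eta> b)" for n b
  have \<chi>F: "is_delta_morphism B A (delta_comp T (functor_comp R F)) (delta_comp S F) (\<lambda>n b. \<chi> n (FOb F b))"
    using is_delta_morphism_comp[OF \<chi> F] by (simp add: delta_comp_assoc)
  have \<psi>: "is_delta_morphism B A T (delta_comp S F) \<psi>"
    using is_delta_morphism_compose[OF A B dT is_delta_functor_comp[OF dT RF] dSF T\<eta> \<chi>F]
    unfolding \<psi>_def .
  have Stri: "FAr (deg S n) (\<epsilon> (FOb F b)) \<cdot>\<^bsub>A\<^esub> FAr (deg S n) (FAr F (\<eta> b)) = Ide A (FOb (deg S n) (FOb F b))"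
    if b: "b \<in> Ob B" for n b
  proof -
    have "FAr F (\<eta> b) \<in> Hom C (FOb F b) (FOb F (FOb R (FOb F b)))"
      using functor_Hom[OF fF nat_trans_Hom[OF \<eta> b]] by simp
    moreover have "\<epsilon> (FOb F b) \<in> Hom C (FOb F (FOb R (FOb F b))) (FOb F b)"
      using nat_trans_Hom[OF \<epsilon> Fob[OF b]] by simp
    ultimately show ?thesis
      using functor_Comp[OF fS] functor_Ide[OF fS Fob[OF b]] tri[OF b] by metis
  qed
  have \<eta>H: "\<eta> b \<in> Hom B b (FOb R (FOb F b))" if "b \<in> Ob B" for b
    using nat_trans_Hom[OF \<eta> that] by simp
  have \<phi>H: "\<phi> n b \<in> Hom A (FOb (deg S n) (FOb F b)) (FOb (deg T n) b)" if "b \<in> Ob B" for n b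
    using nat_trans_Hom[OF delta_morphism_nat_trans[OF \<phi>] that, of n] by simp
  have \<chi>H: "\<chi> n c \<in> Hom A (FOb (deg T n) (FOb R c)) (FOb (deg S n) c)" if "c \<in> Ob C" for n c
    using nat_trans_Hom[OF delta_morphism_nat_trans[OF \<chi>] that, of n] by simp
  have \<theta>H: "\<theta> b \<in> Hom A (FOb (deg T 0) b) (FOb (deg S 0) (FOb F b))" if "b \<in> Ob B" for b
    using nat_trans_Hom[OF nt that] by simp
  have \<theta>'H: "\<theta>' b \<in> Hom A (FOb (deg S 0) (FOb F b)) (FOb (deg T 0) b)" if "b \<in> Ob B" for b
    using nat_trans_Hom[OF nt' that] by simp
  have S\<epsilon>H: "FAr (deg S n) (\<epsilon> c) \<in> Hom A (FOb (deg S n) (FOb F (FOb R c))) (FOb (deg S n) c)"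
    if "c \<in> Ob C" for n c
    using functor_Hom[OF fS nat_trans_Hom[OF \<epsilon> that]] by simp
  have \<psi>0: "\<psi> 0 b = \<theta> b" if b: "b \<in> Ob B" for b
  proof -
    note e = \<eta>H[OF b] and Fb = Fob[OF b]
    note SFe = functor_Hom[OF fSF e, simplified]
    have "\<psi> 0 b = FAr (deg S 0) (\<epsilon> (FOb F b)) \<cdot>\<^bsub>A\<^esub> (\<theta> (FOb R (FOb F b)) \<cdot>\<^bsub>A\<^esub> FAr (deg T 0) (\<eta> b))"
      unfolding \<psi>_def \<chi>0[OF Fb]
      using assoc[OF functor_Hom[OF fT e] \<theta>H[OF Rob[OF Fb]] S\<epsilon>H[OF Fb]] by simp
    \<comment> \<open>Naturality of \<open>\<theta>\<close> at \<open>\<eta> b\<close> moves the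
      unit to the other side of \<open>\<theta>\<close>, next to the counit, where the triangle
      identity absorbs both.\<close>
    also have "\<dots> = FAr (deg S 0) (\<epsilon> (FOb F b)) \<cdot>\<^bsub>A\<^esub> (FAr (deg S 0) (FAr F (\<eta> b)) \<cdot>\<^bsub>A\<^esub> \<theta> b)"
      using nat_trans_square[OF nt e] by simp
    also have "\<dots> = \<theta> b"
      using assoc[OF \<theta>H[OF b] SFe S\<epsilon>H[OF Fb]] Stri[OF b, of 0]
        category.Comp_Ide_left[OF A \<theta>H[OF b]] by simp
    finally show ?thesis .
  qed
  have left: "\<phi> n b \<cdot>\<^bsub>A\<^esub> \<psi> n b = Ide A (FOb (deg T n) b)" if b: "b \<in> Ob B" for n b
    using universal_delta_functorD(3)[OF T dT is_delta_morphism_compose[OF A B dT dSF dT \<psi> \<phi>]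
        is_delta_morphism_id[OF A B dT] _ b] l \<phi>0 \<psi>0 by simp
  have \<phi>R: "is_delta_morphism C A (delta_comp S (functor_comp F R)) (delta_comp T R) (\<lambda>n c. \<phi> n (FOb R c))"
    using is_delta_morphism_comp[OF \<phi> R] by (simp add: delta_comp_assoc)
  \<comment> \<open>Both sides are morphisms of delta-functors from \<open>S F R\<close> to the
    universal \<open>S\<close>. In degree 0, \<open>\<phi>\<close> is the inverse
    \<open>\<theta>'\<close> and cancels the factor \<open>\<theta>\<close> of
    \<open>\<chi>\<close>.\<close>
  have \<chi>\<phi>: "\<chi> n c \<cdot>\<^bsub>A\<^esub> \<phi> n (FOb R c) = FAr (deg S n) (\<epsilon> c)" if c: "c \<in> Ob C" for n c
  proof (rule universal_delta_functorD(3)[OF S is_delta_functor_comp[OF dS FR]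
        is_delta_morphism_compose[OF A C is_delta_functor_comp[OF dS FR] dTR dS \<phi>R \<chi>] S\<epsilon> _ c])
    fix c assume c: "c \<in> Ob C"
    note Rc = Rob[OF c]
    show "\<chi> 0 c \<cdot>\<^bsub>A\<^esub> \<phi> 0 (FOb R c) = FAr (deg S 0) (\<epsilon> c)"
      unfolding \<chi>0[OF c] \<phi>0[OF Rc]
      using assoc[OF \<theta>'H[OF Rc] \<theta>H[OF Rc] S\<epsilon>H[OF c]] r[OF Rc]
        category.Comp_Ide_right[OF A S\<epsilon>H[OF c]] by simp
  qed
  have right: "\<psi> n b \<cdot>\<^bsub>A\<^esub> \<phi> n b = Ide A (FOb (functor_comp (deg S n) F) b)" if b: "b \<in> Ob B" for n b
  proof -
    note e = \<eta>H[OF b] and Fb = Fob[OF b]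
    note SFe = functor_Hom[OF fSF e, simplified]
    have "\<psi> n b \<cdot>\<^bsub>A\<^esub> \<phi> n b = \<chi> n (FOb F b) \<cdot>\<^bsub>A\<^esub> (FAr (deg T n) (\<eta> b) \<cdot>\<^bsub>A\<^esub> \<phi> n b)"
      unfolding \<psi>_def
      using assoc[OF \<phi>H[OF b] functor_Hom[OF fT e] \<chi>H[OF Fb]] by simp
    \<comment> \<open>Naturality of \<open>\<phi> n\<close> at \<open>\<eta> b\<close> exchanges
      \<open>\<phi>\<close> with the unit. What then meets \<open>\<chi>\<close> is
      \<open>\<phi>\<close> at an object in the image of \<open>R\<close>, where
      \<open>\<chi>\<phi>\<close> applies.\<close>
    also have "\<dots> = \<chi> n (FOb F b) \<cdot>\<^bsub>A\<^esub> (\<phi> n (FOb R (FOb F b)) \<cdot>\<^bsub>A\<^esub> FAr (deg S n) (FAr F (\<eta> b)))"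
      using nat_trans_square[OF delta_morphism_nat_trans[OF \<phi>] e, of n] by simp
    also have "\<dots> = FAr (deg S n) (\<epsilon> (FOb F b)) \<cdot>\<^bsub>A\<^esub> FAr (deg S n) (FAr F (\<eta> b))"
      using assoc[OF SFe \<phi>H[OF Rob[OF Fb]] \<chi>H[OF Fb]] \<chi>\<phi>[OF Fb] by simp
    finally show ?thesis using Stri[OF b] by simp
  qed
  have "is_nat_iso B A (deg T n) (functor_comp (deg S n) F) (\<psi> n)"
    using nat_isoI[of B A "deg T n" "functor_comp (deg S n) F" "\<psi> n" "\<phi> n"] left right
      delta_morphism_nat_trans[OF \<psi>, of n] delta_morphism_nat_trans[OF \<phi>, of n] by simp
  then show ?thesis by blast
qed

section \<open>Exactness in functor categories is pointwise\<close>

context category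
begin

lemma ArrD: "f \<in> Arr C \<Longrightarrow> f \<in> Hom C (Dom C f) (Cod C f)"
  by (simp add: Hom_iff)

lemma Hom_Ob: "f \<in> Hom C a b \<Longrightarrow> a \<in> Ob C" "f \<in> Hom C a b \<Longrightarrow> b \<in> Ob C"
  using Dom_in_Ob Cod_in_Ob by (auto simp: Hom_iff)

end

section \<open>Kernels and cokernels in terms of Hom-sets\<close>

lemma is_kernel_Hom:
  "is_kernel A k f \<Longrightarrow> k \<in> Hom A (Dom A k) (Dom A f)"
  "is_kernel A k f \<Longrightarrow> f \<in> Hom A (Dom A f) (Cod A f)"
  by (simp_all add: is_kernel_def Hom_iff)

lemma is_kernel_zero: "is_kernel A k f \<Longrightarrow> f \<cdot>\<^bsub>A\<^esub> k = Zero A (Dom A k) (Cod A f)"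
  by (simp add: is_kernel_def)

lemma is_kernel_univ:
  assumes "is_kernel A k f" and "h \<in> Hom A x (Dom A f)" and "f \<cdot>\<^bsub>A\<^esub> h = Zero A x (Cod A f)"
  shows "\<exists>!u. u \<in> Hom A x (Dom A k) \<and> k \<cdot>\<^bsub>A\<^esub> u = h"
proof -
  have h: "h \<in> Arr A" "Cod A h = Dom A f" "Dom A h = x" using assms(2) by (simp_all add: Hom_iff)
  have "f \<cdot>\<^bsub>A\<^esub> h = Zero A (Dom A h) (Cod A f) \<Longrightarrow> \<exists>!u. u \<in> Hom A (Dom A h) (Dom A k) \<and> k \<cdot>\<^bsub>A\<^esub> u = h"
    using assms(1) h(1,2) unfolding is_kernel_def by blast
  then show ?thesis using assms(3) unfolding h(3) .
qed

lemma is_kernel_lift: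
  assumes "is_kernel A k f" and "h \<in> Hom A x (Dom A f)" and "f \<cdot>\<^bsub>A\<^esub> h = Zero A x (Cod A f)"
  obtains u where "u \<in> Hom A x (Dom A k)" and "k \<cdot>\<^bsub>A\<^esub> u = h"
  using is_kernel_univ[OF assms] by blast

text \<open>The universal property is split into existence and cancellation, because in a functor
  category the two are established by different means: the first needs a naturality proof, the
  second is checked at each object.\<close>

lemma is_kernelI:
  assumes "f \<in> Hom A b c" and "k \<in> Hom A a b" and "f \<cdot>\<^bsub>A\<^esub> k = Zero A a c"
    and "\<And>x h. h \<in> Hom A x b \<Longrightarrow> f \<cdot>\<^bsub>A\<^esub> h = Zero A x c \<Longrightarrow> \<exists>u. u \<in> Hom A x a \<and> k \<cdot>\<^bsub>A\<^esub> u = h"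
    and "\<And>x u v. u \<in> Hom A x a \<Longrightarrow> v \<in> Hom A x a \<Longrightarrow> k \<cdot>\<^bsub>A\<^esub> u = k \<cdot>\<^bsub>A\<^esub> v \<Longrightarrow> u = v"
  shows "is_kernel A k f"
  unfolding is_kernel_def
proof (intro conjI ballI impI)
  fix h assume h: "h \<in> Arr A" "Cod A h = Dom A f \<and> f \<cdot>\<^bsub>A\<^esub> h = Zero A (Dom A h) (Cod A f)"
  then have "h \<in> Hom A (Dom A h) b" "f \<cdot>\<^bsub>A\<^esub> h = Zero A (Dom A h) c"
    using assms(1) by (auto simp: Hom_iff)
  then obtain u where "u \<in> Hom A (Dom A h) a" "k \<cdot>\<^bsub>A\<^esub> u = h" using assms(4) by blast
  moreover have "Dom A k = a" using assms(2) by (simp add: Hom_iff)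
  ultimately show "\<exists>!u. u \<in> Hom A (Dom A h) (Dom A k) \<and> k \<cdot>\<^bsub>A\<^esub> u = h" using assms(5) by metis
qed (use assms(1-3) in \<open>auto simp: Hom_iff\<close>)

lemma is_cokernel_Hom:
  "is_cokernel A q f \<Longrightarrow> q \<in> Hom A (Cod A f) (Cod A q)"
  "is_cokernel A q f \<Longrightarrow> f \<in> Hom A (Dom A f) (Cod A f)"
  by (simp_all add: is_cokernel_def Hom_iff)

lemma is_cokernel_zero: "is_cokernel A q f \<Longrightarrow> q \<cdot>\<^bsub>A\<^esub> f = Zero A (Dom A f) (Cod A q)"
  by (simp add: is_cokernel_def)

lemma is_cokernel_univ:
  assumes "is_cokernel A q f" and "h \<in> Hom A (Cod A f) x" and "h \<cdot>\<^bsub>A\<^esub> f = Zero A (Dom A f) x"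
  shows "\<exists>!u. u \<in> Hom A (Cod A q) x \<and> u \<cdot>\<^bsub>A\<^esub> q = h"
proof -
  have h: "h \<in> Arr A" "Dom A h = Cod A f" "Cod A h = x" using assms(2) by (simp_all add: Hom_iff)
  have "h \<cdot>\<^bsub>A\<^esub> f = Zero A (Dom A f) (Cod A h) \<Longrightarrow> \<exists>!u. u \<in> Hom A (Cod A q) (Cod A h) \<and> u \<cdot>\<^bsub>A\<^esub> q = h"
    using assms(1) h(1,2) unfolding is_cokernel_def by blast
  then show ?thesis using assms(3) unfolding h(3) .
qed

lemma is_cokernel_desc:
  assumes "is_cokernel A q f" and "h \<in> Hom A (Cod A f) x" and "h \<cdot>\<^bsub>A\<^esub> f = Zero A (Dom A f) x"
  obtains u where "u \<in> Hom A (Cod A q) x" and "u \<cdot>\<^bsub>A\<^esub> q = h"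
  using is_cokernel_univ[OF assms] by blast

lemma is_cokernelI:
  assumes "f \<in> Hom A a b" and "q \<in> Hom A b c" and "q \<cdot>\<^bsub>A\<^esub> f = Zero A a c"
    and "\<And>x h. h \<in> Hom A b x \<Longrightarrow> h \<cdot>\<^bsub>A\<^esub> f = Zero A a x \<Longrightarrow> \<exists>u. u \<in> Hom A c x \<and> u \<cdot>\<^bsub>A\<^esub> q = h"
    and "\<And>x u v. u \<in> Hom A c x \<Longrightarrow> v \<in> Hom A c x \<Longrightarrow> u \<cdot>\<^bsub>A\<^esub> q = v \<cdot>\<^bsub>A\<^esub> q \<Longrightarrow> u = v"
  shows "is_cokernel A q f"
  unfolding is_cokernel_def
proof (intro conjI ballI impI)
  fix h assume h: "h \<in> Arr A" "Dom A h = Cod A f \<and> h \<cdot>\<^bsub>A\<^esub> f = Zero A (Dom A f) (Cod A h)"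
  then have "h \<in> Hom A b (Cod A h)" "h \<cdot>\<^bsub>A\<^esub> f = Zero A a (Cod A h)"
    using assms(1) by (auto simp: Hom_iff)
  then obtain u where "u \<in> Hom A c (Cod A h)" "u \<cdot>\<^bsub>A\<^esub> q = h" using assms(4) by blast
  moreover have "Cod A q = c" using assms(2) by (simp add: Hom_iff)
  ultimately show "\<exists>!u. u \<in> Hom A (Cod A q) (Cod A h) \<and> u \<cdot>\<^bsub>A\<^esub> q = h" using assms(5) by metis
qed (use assms(1-3) in \<open>auto simp: Hom_iff\<close>)

context preadditive_category
begin

lemma Zero_Hom: "a \<in> Ob A \<Longrightarrow> b \<in> Ob A \<Longrightarrow> Zero A a b \<in> Hom A a b"
  using comm_group.axioms(2)[OF Hom_comm_group, THEN group.is_monoid, THEN monoid.one_closed]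
  by (simp add: Hom_group_def)

lemma Add_Hom: "f \<in> Hom A a b \<Longrightarrow> g \<in> Hom A a b \<Longrightarrow> Add A f g \<in> Hom A a b"
  using comm_group.axioms(2)[OF Hom_comm_group, THEN group.is_monoid, THEN monoid.m_closed, of a b f g]
    Hom_Ob[of f a b]
  by (simp add: Hom_group_def)

text \<open>A group has no idempotent besides its identity. By bilinearity a composite with a zero
  arrow is such an idempotent, and this is how zero arrows are seen to absorb composition.\<close>

lemma Add_idem_imp_Zero:
  assumes f: "f \<in> Hom A a b" and eq: "Add A f f = f"
  shows "f = Zero A a b"
  using group.r_cancel_one[OF comm_group.axioms(2)[OF Hom_comm_group], of a b f f] Hom_Ob[OF f] assms
  by (simp add: Hom_group_def)

lemma Add_Zero: "a \<in> Ob A \<Longrightarrow> b \<in> Ob A \<Longrightarrow> Add A (Zero A a b) (Zero A a b) = Zero A a b"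
  using monoid.l_one[OF group.is_monoid[OF comm_group.axioms(2)[OF Hom_comm_group]], of a b "Zero A a b"]
    Zero_Hom
  by (simp add: Hom_group_def)

lemma Zero_Comp:
  assumes f: "f \<in> Hom A a b" and c: "c \<in> Ob A"
  shows "Zero A b c \<cdot> f = Zero A a c"
proof (rule Add_idem_imp_Zero)
  have z: "Zero A b c \<in> Hom A b c" using f c Zero_Hom Hom_Ob by blast
  show "Zero A b c \<cdot> f \<in> Hom A a c" using Comp_in_Hom[OF f z] .
  show "Add A (Zero A b c \<cdot> f) (Zero A b c \<cdot> f) = Zero A b c \<cdot> f"
    using Comp_Add_left[OF f z z] Add_Zero Hom_Ob[OF z] by simp
qed

lemma Comp_Zero:
  assumes f: "f \<in> Hom A b c" and a: "a \<in> Ob A"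
  shows "f \<cdot> Zero A a b = Zero A a c"
proof (rule Add_idem_imp_Zero)
  have z: "Zero A a b \<in> Hom A a b" using f a Zero_Hom Hom_Ob by blast
  show "f \<cdot> Zero A a b \<in> Hom A a c" using Comp_in_Hom[OF z f] .
  show "Add A (f \<cdot> Zero A a b) (f \<cdot> Zero A a b) = f \<cdot> Zero A a b"
    using Comp_Add_right[OF z z f] Add_Zero Hom_Ob[OF z] by simp
qed

text \<open>The arrow \<open>k \<cdot> u\<close> is killed by \<open>f\<close>, so it factors
  uniquely through \<open>k\<close>; both \<open>u\<close> and \<open>v\<close> are such
  factorisations. This makes \<open>k\<close> monic.\<close>

lemma is_kernel_cancel:
  assumes k: "is_kernel A k f" and u: "u \<in> Hom A x (Dom A k)" and v: "v \<in> Hom A x (Dom A k)"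
    and eq: "k \<cdot> u = k \<cdot> v"
  shows "u = v"
proof -
  note kH = is_kernel_Hom[OF k]
  have h: "k \<cdot> u \<in> Hom A x (Dom A f)" using Comp_in_Hom[OF u kH(1)] .
  have "f \<cdot> (k \<cdot> u) = Zero A x (Cod A f)"
    using Comp_assoc[OF u kH] is_kernel_zero[OF k] Zero_Comp[OF u] Hom_Ob[OF kH(2)] by simp
  then have "\<exists>!w. w \<in> Hom A x (Dom A k) \<and> k \<cdot> w = k \<cdot> u"
    by (rule is_kernel_univ[OF k h])
  then show ?thesis using u v eq by metis
qed

lemma is_cokernel_cancel:
  assumes k: "is_cokernel A q f" and u: "u \<in> Hom A (Cod A q) x" and v: "v \<in> Hom A (Cod A q) x"
    and eq: "u \<cdot> q = v \<cdot> q"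
  shows "u = v"
proof -
  note kH = is_cokernel_Hom[OF k]
  have h: "u \<cdot> q \<in> Hom A (Cod A f) x" using Comp_in_Hom[OF kH(1) u] .
  have "u \<cdot> q \<cdot> f = Zero A (Dom A f) x"
    using Comp_assoc[OF kH(2,1) u] is_cokernel_zero[OF k] Comp_Zero[OF u] Hom_Ob[OF kH(2)] by simp
  then have "\<exists>!w. w \<in> Hom A (Cod A q) x \<and> w \<cdot> q = u \<cdot> q"
    by (rule is_cokernel_univ[OF k h])
  then show ?thesis using u v eq by metis
qed

end

section \<open>The functor category: arrows, composition, zero arrows\<close>

lemma Ob_fun_cat:
  "F \<in> Ob (fun_cat C A) \<longleftrightarrow>
     is_functor C A F \<and> FOb F \<in> extensional (Ob C) \<and> FAr F \<in> extensional (Arr C)"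
  by (simp add: fun_cat_def Let_def)

lemma Arr_fun_cat:
  "s \<in> Arr (fun_cat C A) \<longleftrightarrow>
     src s \<in> Ob (fun_cat C A) \<and> tgt s \<in> Ob (fun_cat C A) \<and>
     is_nat_trans C A (src s) (tgt s) (body s) \<and> body s \<in> extensional (Ob C)"
  by (cases s) (auto simp: fun_cat_def Let_def)

lemma fun_cat_simps [simp]:
  "Dom (fun_cat C A) = src" "Cod (fun_cat C A) = tgt"
  "Ide (fun_cat C A) F = Mor F (\<lambda>a\<in>Ob C. Ide A (FOb F a)) F"
  "s \<cdot>\<^bsub>fun_cat C A\<^esub> t = Mor (src t) (\<lambda>a\<in>Ob C. body s a \<cdot>\<^bsub>A\<^esub> body t a) (tgt s)"
  "Zero (fun_cat C A) F G = Mor F (\<lambda>a\<in>Ob C. Zero A (FOb F a) (FOb G a)) G"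
  "Add (fun_cat C A) s t = Mor (src s) (\<lambda>a\<in>Ob C. Add A (body s a) (body t a)) (tgt s)"
  by (simp_all add: fun_cat_def Let_def)

lemma Hom_fun_cat:
  "s \<in> Hom (fun_cat C A) F G \<longleftrightarrow> src s = F \<and> tgt s = G \<and>
     F \<in> Ob (fun_cat C A) \<and> G \<in> Ob (fun_cat C A) \<and>
     is_nat_trans C A F G (body s) \<and> body s \<in> extensional (Ob C)"
  by (auto simp: Hom_iff Arr_fun_cat)

lemma fun_cat_functor: "F \<in> Ob (fun_cat C A) \<Longrightarrow> is_functor C A F"
  by (simp add: Ob_fun_cat)

lemma fun_cat_body:
  assumes "s \<in> Hom (fun_cat C A) F G"
  shows "a \<in> Ob C \<Longrightarrow> body s a \<in> Hom A (FOb F a) (FOb G a)"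
    and "u \<in> Hom C a b \<Longrightarrow> body s b \<cdot>\<^bsub>A\<^esub> FAr F u = FAr G u \<cdot>\<^bsub>A\<^esub> body s a"
  using assms nat_trans_Hom[of C A F G "body s"] nat_trans_square[of C A F G "body s"]
  by (simp_all add: Hom_fun_cat)

lemma fun_cat_arr_eqI:
  assumes "s \<in> Hom (fun_cat C A) F G" and "t \<in> Hom (fun_cat C A) F G"
    and "\<And>a. a \<in> Ob C \<Longrightarrow> body s a = body t a"
  shows "s = t"
  using assms extensionalityI[of "body s" "Ob C" "body t"]
  by (cases s; cases t) (simp add: Hom_fun_cat)

text \<open>Objects of \<open>fun_cat\<close> are extensional, so a functor built from chosen values
  has to be cut down to \<open>C\<close> before it counts as one of them.\<close>

definition restrict_functor ::
  "('o, 'm, 'z) category_scheme \<Rightarrow> ('o, 'm, 'p, 'n) functor_data \<Rightarrow> ('o, 'm, 'p, 'n) functor_data" where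
  "restrict_functor C F = \<lparr>FOb = restrict (FOb F) (Ob C), FAr = restrict (FAr F) (Arr C)\<rparr>"

lemma restrict_functor_simps [simp]:
  "a \<in> Ob C \<Longrightarrow> FOb (restrict_functor C F) a = FOb F a"
  "u \<in> Arr C \<Longrightarrow> FAr (restrict_functor C F) u = FAr F u"
  by (simp_all add: restrict_functor_def)

lemma restrict_functor_Ob:
  assumes "category C" and "is_functor C A F"
  shows "restrict_functor C F \<in> Ob (fun_cat C A)"
proof -
  interpret C: category C by fact
  have "v \<cdot>\<^bsub>C\<^esub> u \<in> Arr C" if "u \<in> Arr C" "v \<in> Arr C" "Dom C v = Cod C u" for u v
    using C.Comp_in_Hom[of u "Dom C u" "Cod C u" v "Cod C v"] that by (simp add: Hom_iff)
  moreover have "Ide C a \<in> Arr C" if "a \<in> Ob C" for a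
    using C.Ide_in_Hom[OF that] by (simp add: Hom_iff)
  ultimately show ?thesis
    using assms(2) C.Dom_in_Ob C.Cod_in_Ob
    unfolding Ob_fun_cat is_functor_def by (simp add: restrict_functor_def)
qed

lemma fun_cat_Mor:
  assumes "category C" and "F \<in> Ob (fun_cat C A)" and "G \<in> Ob (fun_cat C A)"
    and "\<And>a. a \<in> Ob C \<Longrightarrow> \<eta> a \<in> Hom A (FOb F a) (FOb G a)"
    and "\<And>u a b. u \<in> Hom C a b \<Longrightarrow> \<eta> b \<cdot>\<^bsub>A\<^esub> FAr F u = FAr G u \<cdot>\<^bsub>A\<^esub> \<eta> a"
  shows "Mor F (restrict \<eta> (Ob C)) G \<in> Hom (fun_cat C A) F G"
  using assms category.Dom_in_Ob[OF assms(1)] category.Cod_in_Ob[OF assms(1)]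
  unfolding Hom_fun_cat is_nat_trans_def by (auto simp: Hom_iff)

lemma fun_cat_comp_Hom:
  assumes C: "category C" and A: "category A"
    and s: "s \<in> Hom (fun_cat C A) F G" and t: "t \<in> Hom (fun_cat C A) G H"
  shows "t \<cdot>\<^bsub>fun_cat C A\<^esub> s \<in> Hom (fun_cat C A) F H"
proof -
  have FGH: "is_functor C A F" "is_functor C A G" "is_functor C A H"
    and nt: "is_nat_trans C A F G (body s)" "is_nat_trans C A G H (body t)"
    using s t by (auto simp: Hom_fun_cat Ob_fun_cat)
  note c = is_nat_trans_compose[OF A C FGH nt]
  have "Mor F (\<lambda>a\<in>Ob C. body t a \<cdot>\<^bsub>A\<^esub> body s a) H \<in> Hom (fun_cat C A) F H"
    using fun_cat_Mor[OF C, of F A H, OF _ _ nat_trans_Hom[OF c] nat_trans_square[OF c]] s t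
    by (simp add: Hom_fun_cat)
  then show ?thesis using s t by (simp add: Hom_fun_cat)
qed

lemma category_fun_cat:
  assumes C: "category C" and A: "category A"
  shows "category (fun_cat C A)"
proof
  note comp = fun_cat_comp_Hom[OF C A]
  show ide: "Ide (fun_cat C A) F \<in> Hom (fun_cat C A) F F" if F: "F \<in> Ob (fun_cat C A)" for F
    unfolding fun_cat_simps
  proof (rule fun_cat_Mor[OF C F F])
    note fF = fun_cat_functor[OF F]
    show "Ide A (FOb F a) \<in> Hom A (FOb F a) (FOb F a)" if "a \<in> Ob C" for a
      using category.Ide_in_Hom[OF A functor_Ob[OF fF that]] .
    show "Ide A (FOb F b) \<cdot>\<^bsub>A\<^esub> FAr F u = FAr F u \<cdot>\<^bsub>A\<^esub> Ide A (FOb F a)" if "u \<in> Hom C a b" for u a b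
      using category.Comp_Ide_left[OF A functor_Hom[OF fF that]]
        category.Comp_Ide_right[OF A functor_Hom[OF fF that]] by simp
  qed
  fix f g h F G H K
  show "f \<in> Arr (fun_cat C A) \<Longrightarrow> Dom (fun_cat C A) f \<in> Ob (fun_cat C A)"
    "f \<in> Arr (fun_cat C A) \<Longrightarrow> Cod (fun_cat C A) f \<in> Ob (fun_cat C A)"
    by (simp_all add: Arr_fun_cat)
  assume f: "f \<in> Hom (fun_cat C A) F G"
  have FG: "F \<in> Ob (fun_cat C A)" "G \<in> Ob (fun_cat C A)" using f by (simp_all add: Hom_fun_cat)
  show "f \<cdot>\<^bsub>fun_cat C A\<^esub> Ide (fun_cat C A) F = f"
    by (rule fun_cat_arr_eqI[OF comp[OF ide[OF FG(1)] f] f])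
      (use category.Comp_Ide_right[OF A fun_cat_body(1)[OF f]] in simp)
  show "Ide (fun_cat C A) G \<cdot>\<^bsub>fun_cat C A\<^esub> f = f"
    by (rule fun_cat_arr_eqI[OF comp[OF f ide[OF FG(2)]] f])
      (use category.Comp_Ide_left[OF A fun_cat_body(1)[OF f]] in simp)
  assume g: "g \<in> Hom (fun_cat C A) G H"
  show "g \<cdot>\<^bsub>fun_cat C A\<^esub> f \<in> Hom (fun_cat C A) F H" by (rule comp[OF f g])
  assume h: "h \<in> Hom (fun_cat C A) H K"
  show "h \<cdot>\<^bsub>fun_cat C A\<^esub> (g \<cdot>\<^bsub>fun_cat C A\<^esub> f) = h \<cdot>\<^bsub>fun_cat C A\<^esub> g \<cdot>\<^bsub>fun_cat C A\<^esub> f"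
    by (rule fun_cat_arr_eqI[OF comp[OF comp[OF f g] h] comp[OF f comp[OF g h]]])
      (use category.Comp_assoc[OF A fun_cat_body(1)[OF f] fun_cat_body(1)[OF g] fun_cat_body(1)[OF h]]
        in simp)
qed

lemma preadditive_fun_cat_zero:
  assumes C: "category C" and A: "preadditive_category A"
    and F: "F \<in> Ob (fun_cat C A)" and G: "G \<in> Ob (fun_cat C A)"
  shows "Zero (fun_cat C A) F G \<in> Hom (fun_cat C A) F G"
proof -
  interpret A: preadditive_category A by fact
  note f = fun_cat_functor[OF F] fun_cat_functor[OF G]
  have ob: "FOb F a \<in> Ob A" "FOb G a \<in> Ob A" if "a \<in> Ob C" for a
    using functor_Ob[OF f(1) that] functor_Ob[OF f(2) that] by simp_all
  show ?thesis
    unfolding fun_cat_simps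
  proof (rule fun_cat_Mor[OF C F G])
    show "Zero A (FOb F a) (FOb G a) \<in> Hom A (FOb F a) (FOb G a)" if "a \<in> Ob C" for a
      using A.Zero_Hom ob that by simp
    show "Zero A (FOb F b) (FOb G b) \<cdot>\<^bsub>A\<^esub> FAr F u = FAr G u \<cdot>\<^bsub>A\<^esub> Zero A (FOb F a) (FOb G a)"
      if u: "u \<in> Hom C a b" for u a b
      using A.Zero_Comp[OF functor_Hom[OF f(1) u]] A.Comp_Zero[OF functor_Hom[OF f(2) u]] ob
        category.Hom_Ob[OF C u] by simp
  qed
qed

section \<open>Kernels in a functor category are computed pointwise\<close>

locale functor_category = C: category C + A: abelian_category A
  for C :: "('o, 'm, 'y) category_scheme" and A :: "('p, 'n, 'z) preadditive_scheme"
begin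

abbreviation "AC \<equiv> fun_cat C A"

lemmas comp_AC = fun_cat_comp_Hom[OF C.category_axioms A.category_axioms]
  and zero_AC = preadditive_fun_cat_zero[OF C.category_axioms A.preadditive_category_axioms]

lemma AC_zero_iff:
  assumes s: "s \<in> Hom AC F G" and t: "t \<in> Hom AC G H"
  shows "t \<cdot>\<^bsub>AC\<^esub> s = Zero AC F H \<longleftrightarrow> (\<forall>a\<in>Ob C. body t a \<cdot>\<^bsub>A\<^esub> body s a = Zero A (FOb F a) (FOb H a))"
proof -
  have FH: "F \<in> Ob AC" "H \<in> Ob AC" using s t by (simp_all add: Hom_fun_cat)
  show ?thesis
  proof
    assume "t \<cdot>\<^bsub>AC\<^esub> s = Zero AC F H"
    then have eq: "body (t \<cdot>\<^bsub>AC\<^esub> s) = body (Zero AC F H)" by simp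
    show "\<forall>a\<in>Ob C. body t a \<cdot>\<^bsub>A\<^esub> body s a = Zero A (FOb F a) (FOb H a)"
      using fun_cong[OF eq] by (auto dest: bspec simp: restrict_def split: if_splits) metis
  next
    assume "\<forall>a\<in>Ob C. body t a \<cdot>\<^bsub>A\<^esub> body s a = Zero A (FOb F a) (FOb H a)"
    then show "t \<cdot>\<^bsub>AC\<^esub> s = Zero AC F H"
      by (intro fun_cat_arr_eqI[OF comp_AC[OF s t] zero_AC[OF FH]]) simp
  qed
qed

lemma AC_comp_eqD: "t \<cdot>\<^bsub>AC\<^esub> s = r \<Longrightarrow> a \<in> Ob C \<Longrightarrow> body t a \<cdot>\<^bsub>A\<^esub> body s a = body r a"
  by auto

text \<open>Lifts are chosen object by object. They fit together to a natural transformation because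
  \<open>body s b\<close> is monic and the two sides of the naturality square agree after
  composition with it.\<close>

lemma pointwise_kernel_imp_kernel:
  assumes s: "s \<in> Hom AC F G" and t: "t \<in> Hom AC G H"
    and ker: "\<And>a. a \<in> Ob C \<Longrightarrow> is_kernel A (body s a) (body t a)"
  shows "is_kernel AC s t"
proof -
  note sb = fun_cat_body[OF s] and tb = fun_cat_body[OF t]
  have DC: "Dom A (body s a) = FOb F a" "Dom A (body t a) = FOb G a" "Cod A (body t a) = FOb H a"
    if "a \<in> Ob C" for a using sb(1)[OF that] tb(1)[OF that] by (auto simp: Hom_iff)
  have F: "F \<in> Ob AC" "is_functor C A F" using s by (auto simp: Hom_fun_cat Ob_fun_cat)
  have G: "G \<in> Ob AC" "is_functor C A G" using s by (auto simp: Hom_fun_cat Ob_fun_cat)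
  have cancel: "u = v" if "a \<in> Ob C" "u \<in> Hom A x (FOb F a)" "v \<in> Hom A x (FOb F a)"
    "body s a \<cdot>\<^bsub>A\<^esub> u = body s a \<cdot>\<^bsub>A\<^esub> v" for a u v x
    using A.is_kernel_cancel[OF ker[OF that(1)]] that DC by simp
  have zero: "t \<cdot>\<^bsub>AC\<^esub> s = Zero AC F H"
    unfolding AC_zero_iff[OF s t] using is_kernel_zero[OF ker] DC by simp
  have lift: "\<exists>w. w \<in> Hom AC E F \<and> s \<cdot>\<^bsub>AC\<^esub> w = h"
    if h: "h \<in> Hom AC E G" and th: "t \<cdot>\<^bsub>AC\<^esub> h = Zero AC E H" for E h
  proof -
    note hb = fun_cat_body[OF h]
    have E: "E \<in> Ob AC" "is_functor C A E" using h by (auto simp: Hom_fun_cat Ob_fun_cat)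
    have "\<exists>w. w \<in> Hom A (FOb E a) (FOb F a) \<and> body s a \<cdot>\<^bsub>A\<^esub> w = body h a" if a: "a \<in> Ob C" for a
      using is_kernel_lift[OF ker[OF a], of "body h a" "FOb E a"] hb(1)[OF a] th[unfolded AC_zero_iff[OF h t]]
        DC[OF a] a by auto
    then obtain w where w: "\<And>a. a \<in> Ob C \<Longrightarrow> w a \<in> Hom A (FOb E a) (FOb F a)"
      and sw: "\<And>a. a \<in> Ob C \<Longrightarrow> body s a \<cdot>\<^bsub>A\<^esub> w a = body h a" by metis
    have wH: "Mor E (restrict w (Ob C)) F \<in> Hom AC E F"
    proof (rule fun_cat_Mor[OF C.category_axioms E(1) F(1) w])
      fix u a b assume u: "u \<in> Hom C a b"
      have a: "a \<in> Ob C" and b: "b \<in> Ob C" using C.Hom_Ob[OF u] .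
      note Eu = functor_Hom[OF E(2) u] and Fu = functor_Hom[OF F(2) u] and Gu = functor_Hom[OF G(2) u]
      show "w b \<cdot>\<^bsub>A\<^esub> FAr E u = FAr F u \<cdot>\<^bsub>A\<^esub> w a"
      proof (rule cancel[OF b])
        show "w b \<cdot>\<^bsub>A\<^esub> FAr E u \<in> Hom A (FOb E a) (FOb F b)" using A.Comp_in_Hom[OF Eu w[OF b]] .
        show "FAr F u \<cdot>\<^bsub>A\<^esub> w a \<in> Hom A (FOb E a) (FOb F b)" using A.Comp_in_Hom[OF w[OF a] Fu] .
        have "body s b \<cdot>\<^bsub>A\<^esub> (w b \<cdot>\<^bsub>A\<^esub> FAr E u) = FAr G u \<cdot>\<^bsub>A\<^esub> body h a"
          using A.Comp_assoc[OF Eu w[OF b] sb(1)[OF b]] sw[OF b] hb(2)[OF u] by simp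
        also have "\<dots> = body s b \<cdot>\<^bsub>A\<^esub> (FAr F u \<cdot>\<^bsub>A\<^esub> w a)"
          using A.Comp_assoc[OF w[OF a] sb(1)[OF a] Gu] A.Comp_assoc[OF w[OF a] Fu sb(1)[OF b]]
            sw[OF a] sb(2)[OF u] by simp
        finally show "body s b \<cdot>\<^bsub>A\<^esub> (w b \<cdot>\<^bsub>A\<^esub> FAr E u) = body s b \<cdot>\<^bsub>A\<^esub> (FAr F u \<cdot>\<^bsub>A\<^esub> w a)" .
      qed
    qed
    moreover have "s \<cdot>\<^bsub>AC\<^esub> Mor E (restrict w (Ob C)) F = h"
      by (rule fun_cat_arr_eqI[OF comp_AC[OF wH s] h]) (simp add: sw)
    ultimately show ?thesis by blast
  qed
  have uniq: "v = w" if v: "v \<in> Hom AC E F" and w: "w \<in> Hom AC E F"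
    and eq: "s \<cdot>\<^bsub>AC\<^esub> v = s \<cdot>\<^bsub>AC\<^esub> w" for v w E
  proof (rule fun_cat_arr_eqI[OF v w])
    fix a assume a: "a \<in> Ob C"
    show "body v a = body w a"
      using cancel[OF a fun_cat_body(1)[OF v a] fun_cat_body(1)[OF w a]] AC_comp_eqD[OF eq a] a by simp
  qed
  show ?thesis
    by (rule is_kernelI[OF t s zero lift uniq])
qed

text \<open>Kernels chosen independently at each object become a functor: the universal property
  supplies the arrows, and the functor laws hold because each \<open>k a\<close> is monic. This
  provides one kernel in \<open>AC\<close> that is known to be pointwise.\<close>

lemma pointwise_kernel_exists:
  assumes t: "t \<in> Hom AC G H"
  obtains K k where "k \<in> Hom AC K G" and "\<And>a. a \<in> Ob C \<Longrightarrow> is_kernel A (body k a) (body t a)"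
proof -
  note tb = fun_cat_body[OF t]
  have G: "G \<in> Ob AC" "is_functor C A G" using t by (auto simp: Hom_fun_cat Ob_fun_cat)
  have H: "is_functor C A H" using t by (auto simp: Hom_fun_cat Ob_fun_cat)
  have DC: "Dom A (body t a) = FOb G a" "Cod A (body t a) = FOb H a"
    if "a \<in> Ob C" for a using tb(1)[OF that] by (auto simp: Hom_iff)
  have "\<exists>k. is_kernel A k (body t a)" if "a \<in> Ob C" for a
    using A.has_kernel tb(1)[OF that] by (simp add: Hom_iff)
  then obtain k where ker: "\<And>a. a \<in> Ob C \<Longrightarrow> is_kernel A (k a) (body t a)" by metis
  have k: "k a \<in> Hom A (Dom A (k a)) (FOb G a)" if "a \<in> Ob C" for a
    using is_kernel_Hom(1)[OF ker[OF that]] DC[OF that] by simp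
  have "\<exists>v. v \<in> Hom A (Dom A (k (Dom C u))) (Dom A (k (Cod C u))) \<and>
            k (Cod C u) \<cdot>\<^bsub>A\<^esub> v = FAr G u \<cdot>\<^bsub>A\<^esub> k (Dom C u)" if "u \<in> Arr C" for u
  proof -
    define a b where "a = Dom C u" and "b = Cod C u"
    have u: "u \<in> Hom C a b" using that by (simp add: Hom_iff a_def b_def)
    have a: "a \<in> Ob C" and b: "b \<in> Ob C" using C.Hom_Ob[OF u] .
    note Gu = functor_Hom[OF G(2) u] and Hu = functor_Hom[OF H u]
    have Guk: "FAr G u \<cdot>\<^bsub>A\<^esub> k a \<in> Hom A (Dom A (k a)) (FOb G b)"
      using A.Comp_in_Hom[OF k[OF a] Gu] .
    have "body t b \<cdot>\<^bsub>A\<^esub> (FAr G u \<cdot>\<^bsub>A\<^esub> k a) = FAr H u \<cdot>\<^bsub>A\<^esub> (body t a \<cdot>\<^bsub>A\<^esub> k a)"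
      using A.Comp_assoc[OF k[OF a] Gu tb(1)[OF b]] A.Comp_assoc[OF k[OF a] tb(1)[OF a] Hu] tb(2)[OF u]
      by simp
    also have "\<dots> = Zero A (Dom A (k a)) (FOb H b)"
      using is_kernel_zero[OF ker[OF a]] DC[OF a] A.Comp_Zero[OF Hu] A.Hom_Ob[OF k[OF a]] by simp
    finally show ?thesis
      using is_kernel_lift[OF ker[OF b], of "FAr G u \<cdot>\<^bsub>A\<^esub> k a" "Dom A (k a)"] Guk DC[OF b]
      unfolding a_def[symmetric] b_def[symmetric] by auto
  qed
  then obtain r where r': "\<And>u. u \<in> Arr C \<Longrightarrow> r u \<in> Hom A (Dom A (k (Dom C u))) (Dom A (k (Cod C u))) \<and>
            k (Cod C u) \<cdot>\<^bsub>A\<^esub> r u = FAr G u \<cdot>\<^bsub>A\<^esub> k (Dom C u)" by metis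
  have r: "r u \<in> Hom A (Dom A (k a)) (Dom A (k b))" and kr: "k b \<cdot>\<^bsub>A\<^esub> r u = FAr G u \<cdot>\<^bsub>A\<^esub> k a"
    if "u \<in> Hom C a b" for u a b using r'[of u] that by (auto simp: Hom_iff)
  define R where "R = restrict_functor C \<lparr>FOb = \<lambda>a. Dom A (k a), FAr = r\<rparr>"
  have "is_functor C A \<lparr>FOb = \<lambda>a. Dom A (k a), FAr = r\<rparr>"
    unfolding is_functor_def
  proof (intro conjI ballI impI; simp only: functor_data.simps)
    show "Dom A (k a) \<in> Ob A" if "a \<in> Ob C" for a using A.Hom_Ob[OF k[OF that]] by simp
    show "r u \<in> Hom A (Dom A (k (Dom C u))) (Dom A (k (Cod C u)))" if "u \<in> Arr C" for u
      using r' that by simp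
    show "r (Ide C a) = Ide A (Dom A (k a))" if a: "a \<in> Ob C" for a
    proof (rule A.is_kernel_cancel[OF ker[OF a]])
      note i = C.Ide_in_Hom[OF a]
      show "r (Ide C a) \<in> Hom A (Dom A (k a)) (Dom A (k a))" using r[OF i] .
      show "Ide A (Dom A (k a)) \<in> Hom A (Dom A (k a)) (Dom A (k a))"
        using A.Ide_in_Hom A.Hom_Ob[OF k[OF a]] by simp
      show "k a \<cdot>\<^bsub>A\<^esub> r (Ide C a) = k a \<cdot>\<^bsub>A\<^esub> Ide A (Dom A (k a))"
        using kr[OF i] functor_Ide[OF G(2) a] A.Comp_Ide_left[OF k[OF a]] A.Comp_Ide_right[OF k[OF a]]
        by simp
    qed
    fix u v assume uv: "u \<in> Arr C" "v \<in> Arr C" "Dom C v = Cod C u"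
    define a b c where "a = Dom C u" and "b = Cod C u" and "c = Cod C v"
    have u: "u \<in> Hom C a b" and v: "v \<in> Hom C b c"
      using uv by (simp_all add: Hom_iff a_def b_def c_def)
    have ab: "a \<in> Ob C" "b \<in> Ob C" and c: "c \<in> Ob C" using C.Hom_Ob[OF u] C.Hom_Ob[OF v] by auto
    note vu = C.Comp_in_Hom[OF u v]
    note Gu = functor_Hom[OF G(2) u] and Gv = functor_Hom[OF G(2) v]
    show "r (v \<cdot>\<^bsub>C\<^esub> u) = r v \<cdot>\<^bsub>A\<^esub> r u"
    proof (rule A.is_kernel_cancel[OF ker[OF c]])
      show "r (v \<cdot>\<^bsub>C\<^esub> u) \<in> Hom A (Dom A (k a)) (Dom A (k c))" using r[OF vu] .
      show "r v \<cdot>\<^bsub>A\<^esub> r u \<in> Hom A (Dom A (k a)) (Dom A (k c))" using A.Comp_in_Hom[OF r[OF u] r[OF v]] .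
      have "k c \<cdot>\<^bsub>A\<^esub> (r v \<cdot>\<^bsub>A\<^esub> r u) = FAr G v \<cdot>\<^bsub>A\<^esub> (k b \<cdot>\<^bsub>A\<^esub> r u)"
        using A.Comp_assoc[OF r[OF u] r[OF v] k[OF c]] A.Comp_assoc[OF r[OF u] k[OF ab(2)] Gv] kr[OF v]
        by simp
      also have "\<dots> = k c \<cdot>\<^bsub>A\<^esub> r (v \<cdot>\<^bsub>C\<^esub> u)"
        using A.Comp_assoc[OF k[OF ab(1)] Gu Gv] kr[OF u] kr[OF vu] functor_Comp[OF G(2) u v] by simp
      finally show "k c \<cdot>\<^bsub>A\<^esub> r (v \<cdot>\<^bsub>C\<^esub> u) = k c \<cdot>\<^bsub>A\<^esub> (r v \<cdot>\<^bsub>A\<^esub> r u)" by simp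
    qed
  qed
  then have R: "R \<in> Ob AC" unfolding R_def by (rule restrict_functor_Ob[OF C.category_axioms])
  have "Mor R (restrict k (Ob C)) G \<in> Hom AC R G"
  proof (rule fun_cat_Mor[OF C.category_axioms R G(1)])
    show "k a \<in> Hom A (FOb R a) (FOb G a)" if "a \<in> Ob C" for a
      using k[OF that] that by (simp add: R_def)
    show "k b \<cdot>\<^bsub>A\<^esub> FAr R u = FAr G u \<cdot>\<^bsub>A\<^esub> k a" if u: "u \<in> Hom C a b" for u a b
      using kr[OF u] u by (simp add: R_def Hom_iff)
  qed
  then show thesis using ker by (intro that[of "Mor R (restrict k (Ob C)) G" R]) simp_all
qed

text \<open>Kernels are unique up to isomorphism. An arbitrary kernel \<open>s\<close> in
  \<open>AC\<close> is compared with the pointwise kernel \<open>k\<close> constructed above, by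
  arrows \<open>u\<close> and \<open>w\<close> through which each factors over the other.\<close>

lemma kernel_imp_pointwise_kernel:
  assumes st: "is_kernel AC s t" and a: "a \<in> Ob C"
  shows "is_kernel A (body s a) (body t a)"
proof -
  define F G H where "F = src s" and "G = src t" and "H = tgt t"
  have s: "s \<in> Hom AC F G" and t: "t \<in> Hom AC G H"
    using is_kernel_Hom[OF st] unfolding F_def G_def H_def by simp_all
  have ts: "t \<cdot>\<^bsub>AC\<^esub> s = Zero AC F H"
    using is_kernel_zero[OF st] by (simp add: F_def H_def)
  have univ: "\<exists>!u. u \<in> Hom AC E F \<and> s \<cdot>\<^bsub>AC\<^esub> u = h"
    if "h \<in> Hom AC E G" "t \<cdot>\<^bsub>AC\<^esub> h = Zero AC E H" for E h
    using is_kernel_univ[OF st, of h E, unfolded fun_cat_simps(1,2), folded F_def G_def H_def] that by blast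
  note sb = fun_cat_body[OF s] and tb = fun_cat_body[OF t]
  obtain K k where k: "k \<in> Hom AC K G" and ker: "\<And>a. a \<in> Ob C \<Longrightarrow> is_kernel A (body k a) (body t a)"
    using pointwise_kernel_exists[OF t] by blast
  have DC: "Dom A (body t a) = FOb G a" "Cod A (body t a) = FOb H a" "Dom A (body k a) = FOb K a"
    if "a \<in> Ob C" for a using tb(1)[OF that] fun_cat_body(1)[OF k that] by (auto simp: Hom_iff)
  have KAC: "is_kernel AC k t" by (rule pointwise_kernel_imp_kernel[OF k t ker])
  have "t \<cdot>\<^bsub>AC\<^esub> k = Zero AC K H"
    unfolding AC_zero_iff[OF k t] using is_kernel_zero[OF ker] DC by simp
  then obtain u where u: "u \<in> Hom AC K F" and su: "s \<cdot>\<^bsub>AC\<^esub> u = k" using univ[OF k] by blast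
  have KG: "src k = K" "src t = G" "tgt t = H" using k t by (simp_all add: Hom_fun_cat)
  obtain w where w: "w \<in> Hom AC F K" and kw: "k \<cdot>\<^bsub>AC\<^esub> w = s"
    using is_kernel_lift[OF KAC, of s F, unfolded fun_cat_simps(1,2) KG] s ts by blast
  interpret AC: category AC by (rule category_fun_cat[OF C.category_axioms A.category_axioms])
  have F: "F \<in> Ob AC" using s by (simp add: Hom_fun_cat)
  \<comment> \<open>Both \<open>u \<cdot> w\<close> and the identity factor \<open>s\<close> through
    itself. At the object \<open>a\<close>, \<open>u\<close> then turns lifts through
    \<open>k\<close> into lifts through \<open>s\<close>, and the equation for
    \<open>u \<cdot> w\<close> turns cancellation for \<open>k\<close> into cancellation for
    \<open>s\<close>.\<close>
  have "s \<cdot>\<^bsub>AC\<^esub> (u \<cdot>\<^bsub>AC\<^esub> w) = s" using AC.Comp_assoc[OF w u s] unfolding su kw .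
  moreover have "s \<cdot>\<^bsub>AC\<^esub> Ide AC F = s" by (rule AC.Comp_Ide_right[OF s])
  ultimately have uw: "u \<cdot>\<^bsub>AC\<^esub> w = Ide AC F"
    using univ[OF s ts] AC.Comp_in_Hom[OF w u] AC.Ide_in_Hom[OF F] by metis
  note sa = fun_cat_body(1)[OF s a] and ta = fun_cat_body(1)[OF t a] and ka = fun_cat_body(1)[OF k a]
    and ua = fun_cat_body(1)[OF u a] and wa = fun_cat_body(1)[OF w a]
  have suA: "body s a \<cdot>\<^bsub>A\<^esub> body u a = body k a" by (rule AC_comp_eqD[OF su a])
  have kwA: "body k a \<cdot>\<^bsub>A\<^esub> body w a = body s a" by (rule AC_comp_eqD[OF kw a])
  have uwA: "body u a \<cdot>\<^bsub>A\<^esub> body w a = Ide A (FOb F a)" using AC_comp_eqD[OF uw a] a by simp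
  show ?thesis
  proof (rule is_kernelI[OF ta sa])
    show "body t a \<cdot>\<^bsub>A\<^esub> body s a = Zero A (FOb F a) (FOb H a)"
      using ts a unfolding AC_zero_iff[OF s t] by blast
  next
    fix x h assume h: "h \<in> Hom A x (FOb G a)" and th: "body t a \<cdot>\<^bsub>A\<^esub> h = Zero A x (FOb H a)"
    obtain v where v: "v \<in> Hom A x (FOb K a)" "body k a \<cdot>\<^bsub>A\<^esub> v = h"
      using is_kernel_lift[OF ker[OF a], of h x] h th DC[OF a] by auto
    have "body s a \<cdot>\<^bsub>A\<^esub> (body u a \<cdot>\<^bsub>A\<^esub> v) = h" using A.Comp_assoc[OF v(1) ua sa] suA v(2) by simp
    then show "\<exists>u. u \<in> Hom A x (FOb F a) \<and> body s a \<cdot>\<^bsub>A\<^esub> u = h"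
      using A.Comp_in_Hom[OF v(1) ua] by blast
  next
    fix x p q assume p: "p \<in> Hom A x (FOb F a)" and q: "q \<in> Hom A x (FOb F a)"
      and eq: "body s a \<cdot>\<^bsub>A\<^esub> p = body s a \<cdot>\<^bsub>A\<^esub> q"
    have "body w a \<cdot>\<^bsub>A\<^esub> p = body w a \<cdot>\<^bsub>A\<^esub> q"
      using A.is_kernel_cancel[OF ker[OF a], of "body w a \<cdot>\<^bsub>A\<^esub> p" x "body w a \<cdot>\<^bsub>A\<^esub> q"] DC[OF a]
        A.Comp_in_Hom[OF p wa] A.Comp_in_Hom[OF q wa]
        A.Comp_assoc[OF p wa ka] A.Comp_assoc[OF q wa ka] kwA eq by simp
    then show "p = q"
      using A.Comp_assoc[OF p wa ua] A.Comp_assoc[OF q wa ua] uwA A.Comp_Ide_left[OF p]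
        A.Comp_Ide_left[OF q] by metis
  qed
qed

section \<open>Cokernels in a functor category are computed pointwise\<close>

lemma pointwise_cokernel_imp_cokernel:
  assumes t: "t \<in> Hom AC H G" and s: "s \<in> Hom AC G F"
    and coker: "\<And>a. a \<in> Ob C \<Longrightarrow> is_cokernel A (body s a) (body t a)"
  shows "is_cokernel AC s t"
proof -
  note sb = fun_cat_body[OF s] and tb = fun_cat_body[OF t]
  have DC: "Cod A (body s a) = FOb F a" "Cod A (body t a) = FOb G a" "Dom A (body t a) = FOb H a"
    if "a \<in> Ob C" for a using sb(1)[OF that] tb(1)[OF that] by (auto simp: Hom_iff)
  have F: "F \<in> Ob AC" "is_functor C A F" using s by (auto simp: Hom_fun_cat Ob_fun_cat)
  have G: "G \<in> Ob AC" "is_functor C A G" using s by (auto simp: Hom_fun_cat Ob_fun_cat)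
  have cancel: "u = v" if "a \<in> Ob C" "u \<in> Hom A (FOb F a) x" "v \<in> Hom A (FOb F a) x"
    "u \<cdot>\<^bsub>A\<^esub> body s a = v \<cdot>\<^bsub>A\<^esub> body s a" for a u v x
    using A.is_cokernel_cancel[OF coker[OF that(1)]] that DC by simp
  have zero: "s \<cdot>\<^bsub>AC\<^esub> t = Zero AC H F"
    unfolding AC_zero_iff[OF t s] using is_cokernel_zero[OF coker] DC by simp
  have desc: "\<exists>w. w \<in> Hom AC F E \<and> w \<cdot>\<^bsub>AC\<^esub> s = h"
    if h: "h \<in> Hom AC G E" and th: "h \<cdot>\<^bsub>AC\<^esub> t = Zero AC H E" for E h
  proof -
    note hb = fun_cat_body[OF h]
    have E: "E \<in> Ob AC" "is_functor C A E" using h by (auto simp: Hom_fun_cat Ob_fun_cat)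
    have "\<exists>w. w \<in> Hom A (FOb F a) (FOb E a) \<and> w \<cdot>\<^bsub>A\<^esub> body s a = body h a" if a: "a \<in> Ob C" for a
      using is_cokernel_desc[OF coker[OF a], of "body h a" "FOb E a"] hb(1)[OF a] th[unfolded AC_zero_iff[OF t h]]
        DC[OF a] a by auto
    then obtain w where w: "\<And>a. a \<in> Ob C \<Longrightarrow> w a \<in> Hom A (FOb F a) (FOb E a)"
      and sw: "\<And>a. a \<in> Ob C \<Longrightarrow> w a \<cdot>\<^bsub>A\<^esub> body s a = body h a" by metis
    have wH: "Mor F (restrict w (Ob C)) E \<in> Hom AC F E"
    proof (rule fun_cat_Mor[OF C.category_axioms F(1) E(1) w])
      fix u a b assume u: "u \<in> Hom C a b"
      have a: "a \<in> Ob C" and b: "b \<in> Ob C" using C.Hom_Ob[OF u] .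
      note Eu = functor_Hom[OF E(2) u] and Fu = functor_Hom[OF F(2) u] and Gu = functor_Hom[OF G(2) u]
      show "w b \<cdot>\<^bsub>A\<^esub> FAr F u = FAr E u \<cdot>\<^bsub>A\<^esub> w a"
      \<comment> \<open>Here the epimorphism at the source \<open>a\<close> of \<open>u\<close> is
        cancelled, where the argument for kernels cancels the monomorphism at the target.\<close>
      proof (rule cancel[OF a])
        show "w b \<cdot>\<^bsub>A\<^esub> FAr F u \<in> Hom A (FOb F a) (FOb E b)" using A.Comp_in_Hom[OF Fu w[OF b]] .
        show "FAr E u \<cdot>\<^bsub>A\<^esub> w a \<in> Hom A (FOb F a) (FOb E b)" using A.Comp_in_Hom[OF w[OF a] Eu] .
        have "FAr E u \<cdot>\<^bsub>A\<^esub> w a \<cdot>\<^bsub>A\<^esub> body s a = body h b \<cdot>\<^bsub>A\<^esub> FAr G u"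
          using A.Comp_assoc[OF sb(1)[OF a] w[OF a] Eu] sw[OF a] hb(2)[OF u] by simp
        also have "\<dots> = w b \<cdot>\<^bsub>A\<^esub> FAr F u \<cdot>\<^bsub>A\<^esub> body s a"
          using A.Comp_assoc[OF Gu sb(1)[OF b] w[OF b]] A.Comp_assoc[OF sb(1)[OF a] Fu w[OF b]]
            sw[OF b] sb(2)[OF u] by simp
        finally show "w b \<cdot>\<^bsub>A\<^esub> FAr F u \<cdot>\<^bsub>A\<^esub> body s a = FAr E u \<cdot>\<^bsub>A\<^esub> w a \<cdot>\<^bsub>A\<^esub> body s a" by simp
      qed
    qed
    moreover have "Mor F (restrict w (Ob C)) E \<cdot>\<^bsub>AC\<^esub> s = h"
      by (rule fun_cat_arr_eqI[OF comp_AC[OF s wH] h]) (simp add: sw)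
    ultimately show ?thesis by blast
  qed
  have uniq: "v = w" if v: "v \<in> Hom AC F E" and w: "w \<in> Hom AC F E"
    and eq: "v \<cdot>\<^bsub>AC\<^esub> s = w \<cdot>\<^bsub>AC\<^esub> s" for v w E
  proof (rule fun_cat_arr_eqI[OF v w])
    fix a assume a: "a \<in> Ob C"
    show "body v a = body w a"
      using cancel[OF a fun_cat_body(1)[OF v a] fun_cat_body(1)[OF w a]] AC_comp_eqD[OF eq a] a by simp
  qed
  show ?thesis
    by (rule is_cokernelI[OF t s zero desc uniq])
qed

text \<open>As for kernels, with each \<open>q a\<close> epic: the induced arrows are determined by
  their composites with \<open>q a\<close>, which forces identities and composites to be
  respected.\<close>

lemma pointwise_cokernel_exists:
  assumes t: "t \<in> Hom AC H G"
  obtains Q q where "q \<in> Hom AC G Q" and "\<And>a. a \<in> Ob C \<Longrightarrow> is_cokernel A (body q a) (body t a)"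
proof -
  note tb = fun_cat_body[OF t]
  have G: "G \<in> Ob AC" "is_functor C A G" using t by (auto simp: Hom_fun_cat Ob_fun_cat)
  have H: "is_functor C A H" using t by (auto simp: Hom_fun_cat Ob_fun_cat)
  have DC: "Cod A (body t a) = FOb G a" "Dom A (body t a) = FOb H a"
    if "a \<in> Ob C" for a using tb(1)[OF that] by (auto simp: Hom_iff)
  have "\<exists>q. is_cokernel A q (body t a)" if "a \<in> Ob C" for a
    using A.has_cokernel tb(1)[OF that] by (simp add: Hom_iff)
  then obtain q where coker: "\<And>a. a \<in> Ob C \<Longrightarrow> is_cokernel A (q a) (body t a)" by metis
  have q: "q a \<in> Hom A (FOb G a) (Cod A (q a))" if "a \<in> Ob C" for a
    using is_cokernel_Hom(1)[OF coker[OF that]] DC[OF that] by simp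
  have "\<exists>v. v \<in> Hom A (Cod A (q (Dom C u))) (Cod A (q (Cod C u))) \<and>
            v \<cdot>\<^bsub>A\<^esub> q (Dom C u) = q (Cod C u) \<cdot>\<^bsub>A\<^esub> FAr G u" if "u \<in> Arr C" for u
  proof -
    define a b where "a = Dom C u" and "b = Cod C u"
    have u: "u \<in> Hom C a b" using that by (simp add: Hom_iff a_def b_def)
    have a: "a \<in> Ob C" and b: "b \<in> Ob C" using C.Hom_Ob[OF u] .
    note Gu = functor_Hom[OF G(2) u] and Hu = functor_Hom[OF H u]
    have qGu: "q b \<cdot>\<^bsub>A\<^esub> FAr G u \<in> Hom A (FOb G a) (Cod A (q b))"
      using A.Comp_in_Hom[OF Gu q[OF b]] .
    have "q b \<cdot>\<^bsub>A\<^esub> FAr G u \<cdot>\<^bsub>A\<^esub> body t a = q b \<cdot>\<^bsub>A\<^esub> body t b \<cdot>\<^bsub>A\<^esub> FAr H u"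
      using A.Comp_assoc[OF tb(1)[OF a] Gu q[OF b]] A.Comp_assoc[OF Hu tb(1)[OF b] q[OF b]] tb(2)[OF u]
      by simp
    also have "\<dots> = Zero A (FOb H a) (Cod A (q b))"
      using is_cokernel_zero[OF coker[OF b]] DC[OF b] A.Zero_Comp[OF Hu] A.Hom_Ob[OF q[OF b]] by simp
    finally show ?thesis
      using is_cokernel_desc[OF coker[OF a], of "q b \<cdot>\<^bsub>A\<^esub> FAr G u" "Cod A (q b)"] qGu DC[OF a]
      unfolding a_def[symmetric] b_def[symmetric] by auto
  qed
  then obtain r where r': "\<And>u. u \<in> Arr C \<Longrightarrow> r u \<in> Hom A (Cod A (q (Dom C u))) (Cod A (q (Cod C u))) \<and>
            r u \<cdot>\<^bsub>A\<^esub> q (Dom C u) = q (Cod C u) \<cdot>\<^bsub>A\<^esub> FAr G u" by metis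
  have r: "r u \<in> Hom A (Cod A (q a)) (Cod A (q b))" and qr: "r u \<cdot>\<^bsub>A\<^esub> q a = q b \<cdot>\<^bsub>A\<^esub> FAr G u"
    if "u \<in> Hom C a b" for u a b using r'[of u] that by (auto simp: Hom_iff)
  define R where "R = restrict_functor C \<lparr>FOb = \<lambda>a. Cod A (q a), FAr = r\<rparr>"
  have "is_functor C A \<lparr>FOb = \<lambda>a. Cod A (q a), FAr = r\<rparr>"
    unfolding is_functor_def
  proof (intro conjI ballI impI; simp only: functor_data.simps)
    show "Cod A (q a) \<in> Ob A" if "a \<in> Ob C" for a using A.Hom_Ob[OF q[OF that]] by simp
    show "r u \<in> Hom A (Cod A (q (Dom C u))) (Cod A (q (Cod C u)))" if "u \<in> Arr C" for u
      using r' that by simp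
    show "r (Ide C a) = Ide A (Cod A (q a))" if a: "a \<in> Ob C" for a
    proof (rule A.is_cokernel_cancel[OF coker[OF a]])
      note i = C.Ide_in_Hom[OF a]
      show "r (Ide C a) \<in> Hom A (Cod A (q a)) (Cod A (q a))" using r[OF i] .
      show "Ide A (Cod A (q a)) \<in> Hom A (Cod A (q a)) (Cod A (q a))"
        using A.Ide_in_Hom A.Hom_Ob[OF q[OF a]] by simp
      show "r (Ide C a) \<cdot>\<^bsub>A\<^esub> q a = Ide A (Cod A (q a)) \<cdot>\<^bsub>A\<^esub> q a"
        using qr[OF i] functor_Ide[OF G(2) a] A.Comp_Ide_left[OF q[OF a]] A.Comp_Ide_right[OF q[OF a]]
        by simp
    qed
    fix u v assume uv: "u \<in> Arr C" "v \<in> Arr C" "Dom C v = Cod C u"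
    define a b c where "a = Dom C u" and "b = Cod C u" and "c = Cod C v"
    have u: "u \<in> Hom C a b" and v: "v \<in> Hom C b c"
      using uv by (simp_all add: Hom_iff a_def b_def c_def)
    have ab: "a \<in> Ob C" "b \<in> Ob C" and c: "c \<in> Ob C" using C.Hom_Ob[OF u] C.Hom_Ob[OF v] by auto
    note vu = C.Comp_in_Hom[OF u v]
    note Gu = functor_Hom[OF G(2) u] and Gv = functor_Hom[OF G(2) v]
    show "r (v \<cdot>\<^bsub>C\<^esub> u) = r v \<cdot>\<^bsub>A\<^esub> r u"
    proof (rule A.is_cokernel_cancel[OF coker[OF ab(1)]])
      show "r (v \<cdot>\<^bsub>C\<^esub> u) \<in> Hom A (Cod A (q a)) (Cod A (q c))" using r[OF vu] .
      show "r v \<cdot>\<^bsub>A\<^esub> r u \<in> Hom A (Cod A (q a)) (Cod A (q c))" using A.Comp_in_Hom[OF r[OF u] r[OF v]] .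
      have "r v \<cdot>\<^bsub>A\<^esub> r u \<cdot>\<^bsub>A\<^esub> q a = r v \<cdot>\<^bsub>A\<^esub> q b \<cdot>\<^bsub>A\<^esub> FAr G u"
        using A.Comp_assoc[OF q[OF ab(1)] r[OF u] r[OF v]] A.Comp_assoc[OF Gu q[OF ab(2)] r[OF v]] qr[OF u]
        by simp
      also have "\<dots> = r (v \<cdot>\<^bsub>C\<^esub> u) \<cdot>\<^bsub>A\<^esub> q a"
        using A.Comp_assoc[OF Gu Gv q[OF c]] qr[OF v] qr[OF vu] functor_Comp[OF G(2) u v] by simp
      finally show "r (v \<cdot>\<^bsub>C\<^esub> u) \<cdot>\<^bsub>A\<^esub> q a = r v \<cdot>\<^bsub>A\<^esub> r u \<cdot>\<^bsub>A\<^esub> q a" by simp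
    qed
  qed
  then have R: "R \<in> Ob AC" unfolding R_def by (rule restrict_functor_Ob[OF C.category_axioms])
  have "Mor G (restrict q (Ob C)) R \<in> Hom AC G R"
  proof (rule fun_cat_Mor[OF C.category_axioms G(1) R])
    show "q a \<in> Hom A (FOb G a) (FOb R a)" if "a \<in> Ob C" for a
      using q[OF that] that by (simp add: R_def)
    show "q b \<cdot>\<^bsub>A\<^esub> FAr G u = FAr R u \<cdot>\<^bsub>A\<^esub> q a" if u: "u \<in> Hom C a b" for u a b
      using qr[OF u] u by (simp add: R_def Hom_iff)
  qed
  then show thesis using coker by (intro that[of "Mor G (restrict q (Ob C)) R" R]) simp_all
qed

text \<open>An arbitrary cokernel in \<open>AC\<close> factors over the pointwise one and
  conversely; the equation for \<open>w \<cdot> u\<close> transports cancellation, and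
  \<open>u\<close> transports factorisations.\<close>

lemma cokernel_imp_pointwise_cokernel:
  assumes st: "is_cokernel AC s t" and a: "a \<in> Ob C"
  shows "is_cokernel A (body s a) (body t a)"
proof -
  define F G H where "F = tgt s" and "G = tgt t" and "H = src t"
  have s: "s \<in> Hom AC G F" and t: "t \<in> Hom AC H G"
    using is_cokernel_Hom[OF st] unfolding F_def G_def H_def by simp_all
  have ts: "s \<cdot>\<^bsub>AC\<^esub> t = Zero AC H F"
    using is_cokernel_zero[OF st] by (simp add: F_def H_def)
  have univ: "\<exists>!u. u \<in> Hom AC F E \<and> u \<cdot>\<^bsub>AC\<^esub> s = h"
    if "h \<in> Hom AC G E" "h \<cdot>\<^bsub>AC\<^esub> t = Zero AC H E" for E h
    using is_cokernel_univ[OF st, of h E, unfolded fun_cat_simps(1,2), folded F_def G_def H_def] that by blast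
  note sb = fun_cat_body[OF s] and tb = fun_cat_body[OF t]
  obtain Q q where q: "q \<in> Hom AC G Q" and coker: "\<And>a. a \<in> Ob C \<Longrightarrow> is_cokernel A (body q a) (body t a)"
    using pointwise_cokernel_exists[OF t] by blast
  have DC: "Cod A (body t a) = FOb G a" "Dom A (body t a) = FOb H a" "Cod A (body q a) = FOb Q a"
    if "a \<in> Ob C" for a using tb(1)[OF that] fun_cat_body(1)[OF q that] by (auto simp: Hom_iff)
  have QAC: "is_cokernel AC q t" by (rule pointwise_cokernel_imp_cokernel[OF t q coker])
  have "q \<cdot>\<^bsub>AC\<^esub> t = Zero AC H Q"
    unfolding AC_zero_iff[OF t q] using is_cokernel_zero[OF coker] DC by simp
  then obtain u where u: "u \<in> Hom AC F Q" and su: "u \<cdot>\<^bsub>AC\<^esub> s = q" using univ[OF q] by blast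
  have QG: "tgt q = Q" "tgt t = G" "src t = H" using q t by (simp_all add: Hom_fun_cat)
  obtain w where w: "w \<in> Hom AC Q F" and qw: "w \<cdot>\<^bsub>AC\<^esub> q = s"
    using is_cokernel_desc[OF QAC, of s F, unfolded fun_cat_simps(1,2) QG] s ts by blast
  interpret AC: category AC by (rule category_fun_cat[OF C.category_axioms A.category_axioms])
  have F: "F \<in> Ob AC" using s by (simp add: Hom_fun_cat)
  have "w \<cdot>\<^bsub>AC\<^esub> u \<cdot>\<^bsub>AC\<^esub> s = s" using AC.Comp_assoc[OF s u w, symmetric] unfolding su qw .
  moreover have "Ide AC F \<cdot>\<^bsub>AC\<^esub> s = s" by (rule AC.Comp_Ide_left[OF s])
  ultimately have uw: "w \<cdot>\<^bsub>AC\<^esub> u = Ide AC F"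
    using univ[OF s ts] AC.Comp_in_Hom[OF u w] AC.Ide_in_Hom[OF F] by metis
  note sa = fun_cat_body(1)[OF s a] and ta = fun_cat_body(1)[OF t a] and qa = fun_cat_body(1)[OF q a]
    and ua = fun_cat_body(1)[OF u a] and wa = fun_cat_body(1)[OF w a]
  have suA: "body u a \<cdot>\<^bsub>A\<^esub> body s a = body q a" by (rule AC_comp_eqD[OF su a])
  have qwA: "body w a \<cdot>\<^bsub>A\<^esub> body q a = body s a" by (rule AC_comp_eqD[OF qw a])
  have uwA: "body w a \<cdot>\<^bsub>A\<^esub> body u a = Ide A (FOb F a)" using AC_comp_eqD[OF uw a] a by simp
  show ?thesis
  proof (rule is_cokernelI[OF ta sa])
    show "body s a \<cdot>\<^bsub>A\<^esub> body t a = Zero A (FOb H a) (FOb F a)"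
      using ts a unfolding AC_zero_iff[OF t s] by blast
  next
    fix x h assume h: "h \<in> Hom A (FOb G a) x" and th: "h \<cdot>\<^bsub>A\<^esub> body t a = Zero A (FOb H a) x"
    obtain v where v: "v \<in> Hom A (FOb Q a) x" "v \<cdot>\<^bsub>A\<^esub> body q a = h"
      using is_cokernel_desc[OF coker[OF a], of h x] h th DC[OF a] by auto
    have "v \<cdot>\<^bsub>A\<^esub> body u a \<cdot>\<^bsub>A\<^esub> body s a = h" using A.Comp_assoc[OF sa ua v(1)] suA v(2) by simp
    then show "\<exists>u. u \<in> Hom A (FOb F a) x \<and> u \<cdot>\<^bsub>A\<^esub> body s a = h"
      using A.Comp_in_Hom[OF ua v(1)] by blast
  next
    fix x p r assume p: "p \<in> Hom A (FOb F a) x" and r: "r \<in> Hom A (FOb F a) x"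
      and eq: "p \<cdot>\<^bsub>A\<^esub> body s a = r \<cdot>\<^bsub>A\<^esub> body s a"
    have "p \<cdot>\<^bsub>A\<^esub> body w a = r \<cdot>\<^bsub>A\<^esub> body w a"
      using A.is_cokernel_cancel[OF coker[OF a], of "p \<cdot>\<^bsub>A\<^esub> body w a" x "r \<cdot>\<^bsub>A\<^esub> body w a"] DC[OF a]
        A.Comp_in_Hom[OF wa p] A.Comp_in_Hom[OF wa r]
        A.Comp_assoc[OF qa wa p] A.Comp_assoc[OF qa wa r] qwA eq by simp
    then show "p = r"
      using A.Comp_assoc[OF ua wa p] A.Comp_assoc[OF ua wa r] uwA A.Comp_Ide_right[OF p]
        A.Comp_Ide_right[OF r] by metis
  qed
qed

text \<open>A delta-functor sees exactness in its source category only through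
  \<open>short_exact\<close>. This equivalence reduces the exactness of restriction and of direct
  image to a single object, which for the direct image is where AB4 can be applied.\<close>

lemma short_exact_fun_cat_iff:
  assumes s: "s \<in> Hom AC F G" and t: "t \<in> Hom AC G H"
  shows "short_exact AC s t \<longleftrightarrow> (\<forall>a\<in>Ob C. short_exact A (body s a) (body t a))"
  using pointwise_kernel_imp_kernel[OF s t] pointwise_cokernel_imp_cokernel[OF s t]
    kernel_imp_pointwise_kernel cokernel_imp_pointwise_cokernel
  unfolding short_exact_def by blast

end

section \<open>Precomposition and colimit functors\<close>

lemma op_simps [simp]:
  "Ob (op C) = Ob C" "Arr (op C) = Arr C" "Dom (op C) = Cod C" "Cod (op C) = Dom C"
  "Ide (op C) = Ide C" "g \<cdot>\<^bsub>op C\<^esub> f = f \<cdot>\<^bsub>C\<^esub> g"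
  by (simp_all add: op_def)

lemma Hom_op [simp]: "Hom (op C) a b = Hom C b a"
  by (auto simp: Hom_def)

lemma category_op:
  assumes "category C"
  shows "category (op C)"
proof -
  interpret C: category C by fact
  show ?thesis
    by unfold_locales
      (auto intro: C.Dom_in_Ob C.Cod_in_Ob C.Ide_in_Hom C.Comp_in_Hom C.Comp_Ide_left C.Comp_Ide_right
        simp: C.Comp_assoc[symmetric])
qed

text \<open>Restriction along \<open>J\<close>; for the functor between categories of elements it is
  the \<open>f\<^sup>*\<close> of the overview. The composites are cut down to \<open>C\<close> in
  order to be objects of the functor category.\<close>

definition precomp ::
  "('o, 'm, 'y) category_scheme \<Rightarrow> ('o, 'm, 'p, 'n) functor_data
    \<Rightarrow> (('p, 'n, 'q, 'k) functor_data, (('p, 'n, 'q, 'k) functor_data, 'p \<Rightarrow> 'k) mor,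
        ('o, 'm, 'q, 'k) functor_data, (('o, 'm, 'q, 'k) functor_data, 'o \<Rightarrow> 'k) mor) functor_data" where
  "precomp C J = \<lparr>FOb = (\<lambda>G. restrict_functor C (functor_comp G J)),
                  FAr = (\<lambda>s. Mor (restrict_functor C (functor_comp (src s) J))
                                 (\<lambda>a\<in>Ob C. body s (FOb J a))
                                 (restrict_functor C (functor_comp (tgt s) J)))\<rparr>"

lemma precomp_simps [simp]:
  "a \<in> Ob C \<Longrightarrow> FOb (FOb (precomp C J) G) a = FOb G (FOb J a)"
  "u \<in> Arr C \<Longrightarrow> FAr (FOb (precomp C J) G) u = FAr G (FAr J u)"
  "src (FAr (precomp C J) s) = FOb (precomp C J) (src s)"
  "tgt (FAr (precomp C J) s) = FOb (precomp C J) (tgt s)"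
  "a \<in> Ob C \<Longrightarrow> body (FAr (precomp C J) s) a = body s (FOb J a)"
  by (simp_all add: precomp_def)

text \<open>The component at \<open>a\<close> of a restricted transformation is the old component at
  \<open>FOb J a\<close>. As short exactness and addition are pointwise, they survive restriction
  along any functor \<open>J\<close>.\<close>

lemma is_exact_functor_precomp:
  assumes C: "category C" and C': "category C'" and A: "abelian_category A" and J: "is_functor C C' J"
  shows "is_exact_functor (fun_cat C' A) (fun_cat C A) (precomp C J)"
proof -
  interpret C: functor_category C A using C A by (simp add: functor_category_def)
  interpret C': functor_category C' A using C' A by (simp add: functor_category_def)
  note Ob = functor_Ob[OF J] and Hm = functor_Hom[OF J]
  have ob: "FOb (precomp C J) G \<in> Ob (fun_cat C A)" if "G \<in> Ob (fun_cat C' A)" for G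
    using restrict_functor_Ob[OF C is_functor_functor_comp[OF J fun_cat_functor[OF that]]]
    by (simp add: precomp_def)
  have hom: "FAr (precomp C J) s \<in> Hom (fun_cat C A) (FOb (precomp C J) F) (FOb (precomp C J) G)"
    if s: "s \<in> Hom (fun_cat C' A) F G" for s F G
  proof -
    have FG: "F \<in> Ob (fun_cat C' A)" "G \<in> Ob (fun_cat C' A)" "src s = F" "tgt s = G"
      using s by (simp_all add: Hom_fun_cat)
    have "Mor (FOb (precomp C J) F) (\<lambda>a\<in>Ob C. body s (FOb J a)) (FOb (precomp C J) G)
      \<in> Hom (fun_cat C A) (FOb (precomp C J) F) (FOb (precomp C J) G)"
    proof (rule fun_cat_Mor[OF C ob[OF FG(1)] ob[OF FG(2)]])
      show "body s (FOb J a) \<in> Hom A (FOb (FOb (precomp C J) F) a) (FOb (FOb (precomp C J) G) a)"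
        if "a \<in> Ob C" for a
        using fun_cat_body(1)[OF s Ob[OF that]] that by simp
      show "body s (FOb J b) \<cdot>\<^bsub>A\<^esub> FAr (FOb (precomp C J) F) u
          = FAr (FOb (precomp C J) G) u \<cdot>\<^bsub>A\<^esub> body s (FOb J a)" if u: "u \<in> Hom C a b" for u a b
        using fun_cat_body(2)[OF s Hm[OF u]] u by (simp add: Hom_iff)
    qed
    then show ?thesis using FG by (simp add: precomp_def)
  qed
  interpret AC: category "fun_cat C A" by (rule category_fun_cat[OF C C.A.category_axioms])
  interpret AC': category "fun_cat C' A" by (rule category_fun_cat[OF C' C.A.category_axioms])
  have "is_functor (fun_cat C' A) (fun_cat C A) (precomp C J)"
    unfolding is_functor_def
  proof (intro conjI ballI impI ob hom)
    fix G assume G: "G \<in> Ob (fun_cat C' A)"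
    show "FAr (precomp C J) (Ide (fun_cat C' A) G) = Ide (fun_cat C A) (FOb (precomp C J) G)"
      by (rule fun_cat_arr_eqI[OF hom[OF AC'.Ide_in_Hom[OF G]] AC.Ide_in_Hom[OF ob[OF G]]])
        (simp add: Ob)
  next
    fix u v assume uv: "u \<in> Arr (fun_cat C' A)" "v \<in> Arr (fun_cat C' A)"
      "Dom (fun_cat C' A) v = Cod (fun_cat C' A) u"
    define F G H where "F = src u" and "G = tgt u" and "H = tgt v"
    have u: "u \<in> Hom (fun_cat C' A) F G" and v: "v \<in> Hom (fun_cat C' A) G H"
      using uv by (simp_all add: Hom_iff F_def G_def H_def)
    show "FAr (precomp C J) (v \<cdot>\<^bsub>fun_cat C' A\<^esub> u) = FAr (precomp C J) v \<cdot>\<^bsub>fun_cat C A\<^esub> FAr (precomp C J) u"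
      by (rule fun_cat_arr_eqI[OF hom[OF AC'.Comp_in_Hom[OF u v]] AC.Comp_in_Hom[OF hom[OF u] hom[OF v]]])
        (simp add: Ob)
  qed (simp_all add: Hom_iff)
  moreover have "FAr (precomp C J) (Add (fun_cat C' A) s t)
      = Add (fun_cat C A) (FAr (precomp C J) s) (FAr (precomp C J) t)" for s t
    by (auto simp: precomp_def Ob intro!: restrict_ext)
  moreover have "short_exact (fun_cat C A) (FAr (precomp C J) s) (FAr (precomp C J) t)"
    if st: "short_exact (fun_cat C' A) s t" for s t
  proof -
    have s: "s \<in> Hom (fun_cat C' A) (src s) (tgt s)" and t: "t \<in> Hom (fun_cat C' A) (tgt s) (tgt t)"
      using short_exact_arrows[OF st] by simp_all
    show ?thesis
      using st unfolding C.short_exact_fun_cat_iff[OF hom[OF s] hom[OF t]]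
        C'.short_exact_fun_cat_iff[OF s t] by (simp add: Ob)
  qed
  ultimately show ?thesis unfolding is_exact_functor_def is_additive_functor_def by blast
qed

section \<open>Colimits and the uniqueness of the colimit functor\<close>

lemma is_colimit_Hom:
  "is_colimit C A F c \<iota> \<Longrightarrow> i \<in> Ob C \<Longrightarrow> \<iota> i \<in> Hom A (FOb F i) c"
  by (simp add: is_colimit_def)

lemma is_colimit_Ob: "is_colimit C A F c \<iota> \<Longrightarrow> c \<in> Ob A"
  by (simp add: is_colimit_def)

lemma is_colimit_cocone:
  "is_colimit C A F c \<iota> \<Longrightarrow> u \<in> Hom C i j \<Longrightarrow> \<iota> j \<cdot>\<^bsub>A\<^esub> FAr F u = \<iota> i"
  by (auto simp: is_colimit_def Hom_iff)

lemma is_colimit_univ: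
  assumes "is_colimit C A F c \<iota>" and "x \<in> Ob A"
    and "\<And>i. i \<in> Ob C \<Longrightarrow> \<kappa> i \<in> Hom A (FOb F i) x"
    and "\<And>u i j. u \<in> Hom C i j \<Longrightarrow> \<kappa> j \<cdot>\<^bsub>A\<^esub> FAr F u = \<kappa> i"
  shows "\<exists>!h. h \<in> Hom A c x \<and> (\<forall>i\<in>Ob C. h \<cdot>\<^bsub>A\<^esub> \<iota> i = \<kappa> i)"
proof -
  have "\<forall>u\<in>Arr C. \<kappa> (Cod C u) \<cdot>\<^bsub>A\<^esub> FAr F u = \<kappa> (Dom C u)" using assms(4) by (simp add: Hom_iff)
  then show ?thesis using assms(1-3) unfolding is_colimit_def by blast
qed

text \<open>The legs of a colimit are jointly epic: the family \<open>h \<cdot> \<iota> i\<close> is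
  itself a cocone, and both arrows factor it.\<close>

lemma is_colimit_cancel:
  assumes A: "category A" and C: "category C" and F: "is_functor C A F" and c: "is_colimit C A F c \<iota>"
    and h: "h \<in> Hom A c x" and k: "k \<in> Hom A c x"
    and eq: "\<And>i. i \<in> Ob C \<Longrightarrow> h \<cdot>\<^bsub>A\<^esub> \<iota> i = k \<cdot>\<^bsub>A\<^esub> \<iota> i"
  shows "h = k"
proof -
  interpret A: category A by fact
  have "\<exists>!l. l \<in> Hom A c x \<and> (\<forall>i\<in>Ob C. l \<cdot>\<^bsub>A\<^esub> \<iota> i = h \<cdot>\<^bsub>A\<^esub> \<iota> i)"
  proof (rule is_colimit_univ[OF c])
    show "x \<in> Ob A" using A.Hom_Ob[OF h] by simp
    show "h \<cdot>\<^bsub>A\<^esub> \<iota> i \<in> Hom A (FOb F i) x" if "i \<in> Ob C" for i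
      using A.Comp_in_Hom[OF is_colimit_Hom[OF c that] h] .
    show "h \<cdot>\<^bsub>A\<^esub> \<iota> j \<cdot>\<^bsub>A\<^esub> FAr F u = h \<cdot>\<^bsub>A\<^esub> \<iota> i" if u: "u \<in> Hom C i j" for u i j
      using A.Comp_assoc[OF functor_Hom[OF F u] is_colimit_Hom[OF c category.Hom_Ob(2)[OF C u]] h]
        is_colimit_cocone[OF c u] by simp
  qed
  then show ?thesis using h k eq by metis
qed

text \<open>The comparison between two choices of colimits. The second clause fixes it on the legs,
  which is what later identifies the two opposite comparisons as inverse to each other.\<close>

lemma colimit_functor_nat_trans:
  assumes A: "category A" and C: "category C"
    and L: "is_functor (fun_cat C A) A L" and L': "is_functor (fun_cat C A) A L'"
    and \<iota>: "\<And>F. F \<in> Ob (fun_cat C A) \<Longrightarrow> is_colimit C A F (FOb L F) (\<iota> F)"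
    and \<iota>s: "\<And>s F G i. s \<in> Hom (fun_cat C A) F G \<Longrightarrow> i \<in> Ob C
        \<Longrightarrow> FAr L s \<cdot>\<^bsub>A\<^esub> \<iota> F i = \<iota> G i \<cdot>\<^bsub>A\<^esub> body s i"
    and \<iota>': "\<And>F. F \<in> Ob (fun_cat C A) \<Longrightarrow> is_colimit C A F (FOb L' F) (\<iota>' F)"
    and \<iota>s': "\<And>s F G i. s \<in> Hom (fun_cat C A) F G \<Longrightarrow> i \<in> Ob C
        \<Longrightarrow> FAr L' s \<cdot>\<^bsub>A\<^esub> \<iota>' F i = \<iota>' G i \<cdot>\<^bsub>A\<^esub> body s i"
  obtains \<eta> where "is_nat_trans (fun_cat C A) A L L' \<eta>"
    and "\<And>F i. F \<in> Ob (fun_cat C A) \<Longrightarrow> i \<in> Ob C \<Longrightarrow> \<eta> F \<cdot>\<^bsub>A\<^esub> \<iota> F i = \<iota>' F i"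
proof -
  interpret A: category A by fact
  have "\<exists>h. h \<in> Hom A (FOb L F) (FOb L' F) \<and> (\<forall>i\<in>Ob C. h \<cdot>\<^bsub>A\<^esub> \<iota> F i = \<iota>' F i)"
    if F: "F \<in> Ob (fun_cat C A)" for F
    using is_colimit_univ[OF \<iota>[OF F] is_colimit_Ob[OF \<iota>'[OF F]] is_colimit_Hom[OF \<iota>'[OF F]]
        is_colimit_cocone[OF \<iota>'[OF F]]] by blast
  then obtain \<eta> where \<eta>: "\<And>F. F \<in> Ob (fun_cat C A) \<Longrightarrow> \<eta> F \<in> Hom A (FOb L F) (FOb L' F)"
    and \<eta>\<iota>: "\<And>F i. F \<in> Ob (fun_cat C A) \<Longrightarrow> i \<in> Ob C \<Longrightarrow> \<eta> F \<cdot>\<^bsub>A\<^esub> \<iota> F i = \<iota>' F i"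
    by metis
  have "is_nat_trans (fun_cat C A) A L L' \<eta>"
    unfolding is_nat_trans_def
  proof (intro conjI ballI \<eta>)
    fix s assume "s \<in> Arr (fun_cat C A)"
    then have s: "s \<in> Hom (fun_cat C A) (src s) (tgt s)" and F: "src s \<in> Ob (fun_cat C A)"
      and G: "tgt s \<in> Ob (fun_cat C A)" by (simp_all add: Hom_iff Arr_fun_cat)
    note Ls = functor_Hom[OF L s] and Ls' = functor_Hom[OF L' s]
    have "\<eta> (tgt s) \<cdot>\<^bsub>A\<^esub> FAr L s = FAr L' s \<cdot>\<^bsub>A\<^esub> \<eta> (src s)"
    proof (rule is_colimit_cancel[OF A C fun_cat_functor[OF F] \<iota>[OF F]])
      show "\<eta> (tgt s) \<cdot>\<^bsub>A\<^esub> FAr L s \<in> Hom A (FOb L (src s)) (FOb L' (tgt s))"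
        using A.Comp_in_Hom[OF Ls \<eta>[OF G]] .
      show "FAr L' s \<cdot>\<^bsub>A\<^esub> \<eta> (src s) \<in> Hom A (FOb L (src s)) (FOb L' (tgt s))"
        using A.Comp_in_Hom[OF \<eta>[OF F] Ls'] .
      fix i assume i: "i \<in> Ob C"
      show "\<eta> (tgt s) \<cdot>\<^bsub>A\<^esub> FAr L s \<cdot>\<^bsub>A\<^esub> \<iota> (src s) i = FAr L' s \<cdot>\<^bsub>A\<^esub> \<eta> (src s) \<cdot>\<^bsub>A\<^esub> \<iota> (src s) i"
        using A.Comp_assoc[OF is_colimit_Hom[OF \<iota>[OF F] i] Ls \<eta>[OF G]]
          A.Comp_assoc[OF is_colimit_Hom[OF \<iota>[OF F] i] \<eta>[OF F] Ls']
          A.Comp_assoc[OF fun_cat_body(1)[OF s i] is_colimit_Hom[OF \<iota>[OF G] i] \<eta>[OF G]]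
          \<iota>s[OF s i] \<iota>s'[OF s i] \<eta>\<iota>[OF F i] \<eta>\<iota>[OF G i] by metis
    qed
    then show "\<eta> (Cod (fun_cat C A) s) \<cdot>\<^bsub>A\<^esub> FAr L s = FAr L' s \<cdot>\<^bsub>A\<^esub> \<eta> (Dom (fun_cat C A) s)" by simp
  qed
  then show thesis using \<eta>\<iota> that by blast
qed

text \<open>\<open>is_colimit_functor\<close> leaves the choice of colimits open. The colimit
  functor underlying \<open>T\<close> and the one produced from \<open>S\<close> by the direct image
  therefore agree only up to the isomorphism found here.\<close>

lemma colimit_functor_unique:
  assumes A: "category A" and C: "category C"
    and L: "is_colimit_functor C A L" and L': "is_colimit_functor C A L'"
  shows "\<exists>\<eta>. is_nat_iso (fun_cat C A) A L L' \<eta>"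
proof -
  interpret A: category A by fact
  have fL: "is_functor (fun_cat C A) A L" and fL': "is_functor (fun_cat C A) A L'"
    using L L' by (simp_all add: is_colimit_functor_def)
  obtain \<iota> where \<iota>: "\<And>F. F \<in> Ob (fun_cat C A) \<Longrightarrow> is_colimit C A F (FOb L F) (\<iota> F)"
    and "\<forall>s\<in>Arr (fun_cat C A). \<forall>i\<in>Ob C. FAr L s \<cdot>\<^bsub>A\<^esub> \<iota> (src s) i = \<iota> (tgt s) i \<cdot>\<^bsub>A\<^esub> body s i"
    using L unfolding is_colimit_functor_def by blast
  then have \<iota>s: "\<And>s F G i. s \<in> Hom (fun_cat C A) F G \<Longrightarrow> i \<in> Ob C
        \<Longrightarrow> FAr L s \<cdot>\<^bsub>A\<^esub> \<iota> F i = \<iota> G i \<cdot>\<^bsub>A\<^esub> body s i" by (auto simp: Hom_iff)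
  obtain \<iota>' where \<iota>': "\<And>F. F \<in> Ob (fun_cat C A) \<Longrightarrow> is_colimit C A F (FOb L' F) (\<iota>' F)"
    and "\<forall>s\<in>Arr (fun_cat C A). \<forall>i\<in>Ob C. FAr L' s \<cdot>\<^bsub>A\<^esub> \<iota>' (src s) i = \<iota>' (tgt s) i \<cdot>\<^bsub>A\<^esub> body s i"
    using L' unfolding is_colimit_functor_def by blast
  then have \<iota>s': "\<And>s F G i. s \<in> Hom (fun_cat C A) F G \<Longrightarrow> i \<in> Ob C
        \<Longrightarrow> FAr L' s \<cdot>\<^bsub>A\<^esub> \<iota>' F i = \<iota>' G i \<cdot>\<^bsub>A\<^esub> body s i" by (auto simp: Hom_iff)
  obtain \<eta> where \<eta>: "is_nat_trans (fun_cat C A) A L L' \<eta>"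
    and \<eta>\<iota>: "\<And>F i. F \<in> Ob (fun_cat C A) \<Longrightarrow> i \<in> Ob C \<Longrightarrow> \<eta> F \<cdot>\<^bsub>A\<^esub> \<iota> F i = \<iota>' F i"
    using colimit_functor_nat_trans[OF A C fL fL' \<iota> \<iota>s \<iota>' \<iota>s'] by blast
  obtain \<zeta> where \<zeta>: "is_nat_trans (fun_cat C A) A L' L \<zeta>"
    and \<zeta>\<iota>: "\<And>F i. F \<in> Ob (fun_cat C A) \<Longrightarrow> i \<in> Ob C \<Longrightarrow> \<zeta> F \<cdot>\<^bsub>A\<^esub> \<iota>' F i = \<iota> F i"
    using colimit_functor_nat_trans[OF A C fL' fL \<iota>' \<iota>s' \<iota> \<iota>s] by blast
  \<comment> \<open>Stated for arbitrary \<open>K\<close> and \<open>K'\<close>, because the two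
    composites to be identified are instances with \<open>L\<close> and \<open>L'\<close>
    interchanged; on the legs each composite acts as the identity.\<close>
  have inv: "q F \<cdot>\<^bsub>A\<^esub> p F = Ide A (FOb K F)"
    if K: "\<And>F. F \<in> Ob (fun_cat C A) \<Longrightarrow> is_colimit C A F (FOb K F) (\<kappa> F)"
      and p: "is_nat_trans (fun_cat C A) A K K' p" and q: "is_nat_trans (fun_cat C A) A K' K q"
      and p\<kappa>: "\<And>F i. F \<in> Ob (fun_cat C A) \<Longrightarrow> i \<in> Ob C \<Longrightarrow> p F \<cdot>\<^bsub>A\<^esub> \<kappa> F i = \<kappa>' F i"
      and q\<kappa>: "\<And>F i. F \<in> Ob (fun_cat C A) \<Longrightarrow> i \<in> Ob C \<Longrightarrow> q F \<cdot>\<^bsub>A\<^esub> \<kappa>' F i = \<kappa> F i"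
      and F: "F \<in> Ob (fun_cat C A)" for K K' \<kappa> \<kappa>' p q F
  proof (rule is_colimit_cancel[OF A C fun_cat_functor[OF F] K[OF F]])
    note pF = nat_trans_Hom[OF p F] and qF = nat_trans_Hom[OF q F]
    show "q F \<cdot>\<^bsub>A\<^esub> p F \<in> Hom A (FOb K F) (FOb K F)" using A.Comp_in_Hom[OF pF qF] .
    show "Ide A (FOb K F) \<in> Hom A (FOb K F) (FOb K F)"
      using A.Ide_in_Hom[OF is_colimit_Ob[OF K[OF F]]] .
    fix i assume i: "i \<in> Ob C"
    note k = is_colimit_Hom[OF K[OF F] i]
    show "q F \<cdot>\<^bsub>A\<^esub> p F \<cdot>\<^bsub>A\<^esub> \<kappa> F i = Ide A (FOb K F) \<cdot>\<^bsub>A\<^esub> \<kappa> F i"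
      using A.Comp_assoc[OF k pF qF] A.Comp_Ide_left[OF k] p\<kappa>[OF F i] q\<kappa>[OF F i] by simp
  qed
  show ?thesis
    using nat_isoI[OF \<eta> \<zeta> inv[OF \<iota> \<eta> \<zeta> \<eta>\<iota> \<zeta>\<iota>] inv[OF \<iota>' \<zeta> \<eta> \<zeta>\<iota> \<eta>\<iota>]] by blast
qed

lemma nat_iso_sym:
  assumes A: "category A" and B: "category B"
    and F: "is_functor B A F" and G: "is_functor B A G" and \<theta>: "is_nat_iso B A F G \<theta>"
  shows "\<exists>\<theta>'. is_nat_iso B A G F \<theta>'"
proof -
  have nt: "is_nat_trans B A F G \<theta>" using \<theta> by (simp add: is_nat_iso_def)
  obtain \<theta>' where "is_nat_trans B A G F \<theta>'"
    and "\<And>b. b \<in> Ob B \<Longrightarrow> \<theta>' b \<cdot>\<^bsub>A\<^esub> \<theta> b = Ide A (FOb F b)"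
    and "\<And>b. b \<in> Ob B \<Longrightarrow> \<theta> b \<cdot>\<^bsub>A\<^esub> \<theta>' b = Ide A (FOb G b)"
    using nat_iso_inverse[OF A B F G \<theta>] by blast
  then show ?thesis using nat_isoI[OF _ nt, of \<theta>'] by blast
qed

lemma nat_iso_trans:
  assumes A: "category A" and B: "category B"
    and F: "is_functor B A F" and G: "is_functor B A G" and H: "is_functor B A H"
    and \<theta>: "is_nat_iso B A F G \<theta>" and \<zeta>: "is_nat_iso B A G H \<zeta>"
  shows "\<exists>\<xi>. is_nat_iso B A F H \<xi>"
proof -
  interpret A: category A by fact
  have nt: "is_nat_trans B A F G \<theta>" "is_nat_trans B A G H \<zeta>" using \<theta> \<zeta> by (simp_all add: is_nat_iso_def)
  obtain \<theta>' where t: "is_nat_trans B A G F \<theta>'"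
    and tl: "\<And>b. b \<in> Ob B \<Longrightarrow> \<theta>' b \<cdot>\<^bsub>A\<^esub> \<theta> b = Ide A (FOb F b)"
    and tr: "\<And>b. b \<in> Ob B \<Longrightarrow> \<theta> b \<cdot>\<^bsub>A\<^esub> \<theta>' b = Ide A (FOb G b)"
    using nat_iso_inverse[OF A B F G \<theta>] by blast
  obtain \<zeta>' where z: "is_nat_trans B A H G \<zeta>'"
    and zl: "\<And>b. b \<in> Ob B \<Longrightarrow> \<zeta>' b \<cdot>\<^bsub>A\<^esub> \<zeta> b = Ide A (FOb G b)"
    and zr: "\<And>b. b \<in> Ob B \<Longrightarrow> \<zeta> b \<cdot>\<^bsub>A\<^esub> \<zeta>' b = Ide A (FOb H b)"
    using nat_iso_inverse[OF A B G H \<zeta>] by blast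
  have "is_nat_iso B A F H (\<lambda>b. \<zeta> b \<cdot>\<^bsub>A\<^esub> \<theta> b)"
  proof (rule nat_isoI)
    show "is_nat_trans B A F H (\<lambda>b. \<zeta> b \<cdot>\<^bsub>A\<^esub> \<theta> b)" by (rule is_nat_trans_compose[OF A B F G H nt])
    show "is_nat_trans B A H F (\<lambda>b. \<theta>' b \<cdot>\<^bsub>A\<^esub> \<zeta>' b)" by (rule is_nat_trans_compose[OF A B H G F z t])
    fix b assume b: "b \<in> Ob B"
    note th = nat_trans_Hom[OF nt(1) b] and ze = nat_trans_Hom[OF nt(2) b]
      and th' = nat_trans_Hom[OF t b] and ze' = nat_trans_Hom[OF z b]
    have "\<theta>' b \<cdot>\<^bsub>A\<^esub> \<zeta>' b \<cdot>\<^bsub>A\<^esub> (\<zeta> b \<cdot>\<^bsub>A\<^esub> \<theta> b) = \<theta>' b \<cdot>\<^bsub>A\<^esub> (\<zeta>' b \<cdot>\<^bsub>A\<^esub> \<zeta> b \<cdot>\<^bsub>A\<^esub> \<theta> b)"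
      using A.Comp_assoc[OF A.Comp_in_Hom[OF th ze] ze' th'] A.Comp_assoc[OF th ze ze'] by simp
    then show "\<theta>' b \<cdot>\<^bsub>A\<^esub> \<zeta>' b \<cdot>\<^bsub>A\<^esub> (\<zeta> b \<cdot>\<^bsub>A\<^esub> \<theta> b) = Ide A (FOb F b)"
      using zl[OF b] tl[OF b] A.Comp_Ide_left[OF th] by simp
    have "\<zeta> b \<cdot>\<^bsub>A\<^esub> \<theta> b \<cdot>\<^bsub>A\<^esub> (\<theta>' b \<cdot>\<^bsub>A\<^esub> \<zeta>' b) = \<zeta> b \<cdot>\<^bsub>A\<^esub> (\<theta> b \<cdot>\<^bsub>A\<^esub> \<theta>' b \<cdot>\<^bsub>A\<^esub> \<zeta>' b)"
      using A.Comp_assoc[OF A.Comp_in_Hom[OF ze' th'] th ze] A.Comp_assoc[OF ze' th' th] by simp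
    then show "\<zeta> b \<cdot>\<^bsub>A\<^esub> \<theta> b \<cdot>\<^bsub>A\<^esub> (\<theta>' b \<cdot>\<^bsub>A\<^esub> \<zeta>' b) = Ide A (FOb H b)"
      using tr[OF b] zr[OF b] A.Comp_Ide_left[OF ze'] by simp
  qed
  then show ?thesis by blast
qed

lemma nat_iso_whisker_right:
  assumes "is_functor B C F" and "is_nat_iso C A G H \<eta>"
  shows "is_nat_iso B A (functor_comp G F) (functor_comp H F) (\<lambda>b. \<eta> (FOb F b))"
  using assms is_nat_trans_whisker_right[of B C F A G H \<eta>] functor_Ob[of B C F]
  unfolding is_nat_iso_def by blast

section \<open>The direct image\<close>

lemma is_coproduct_Ob: "is_coproduct A I F c inc \<Longrightarrow> c \<in> Ob A"
  by (simp add: is_coproduct_def)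

lemma is_coproduct_Hom: "is_coproduct A I F c inc \<Longrightarrow> i \<in> I \<Longrightarrow> inc i \<in> Hom A (F i) c"
  by (simp add: is_coproduct_def)

lemma is_coproduct_univ:
  assumes "is_coproduct A I F c inc" and "x \<in> Ob A" and "\<And>i. i \<in> I \<Longrightarrow> g i \<in> Hom A (F i) x"
  shows "\<exists>!h. h \<in> Hom A c x \<and> (\<forall>i\<in>I. h \<cdot>\<^bsub>A\<^esub> inc i = g i)"
  using assms unfolding is_coproduct_def by blast

text \<open>The injections are jointly epic. Equations between arrows out of a direct image are
  checked on one summand at a time by this rule.\<close>

lemma is_coproduct_cancel:
  assumes A: "category A" and c: "is_coproduct A I F c inc"
    and h: "h \<in> Hom A c x" and k: "k \<in> Hom A c x"
    and eq: "\<And>i. i \<in> I \<Longrightarrow> h \<cdot>\<^bsub>A\<^esub> inc i = k \<cdot>\<^bsub>A\<^esub> inc i"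
  shows "h = k"
proof -
  have "\<exists>!l. l \<in> Hom A c x \<and> (\<forall>i\<in>I. l \<cdot>\<^bsub>A\<^esub> inc i = h \<cdot>\<^bsub>A\<^esub> inc i)"
    by (rule is_coproduct_univ[OF c category.Hom_Ob(2)[OF A h]])
      (rule category.Comp_in_Hom[OF A is_coproduct_Hom[OF c] h])
  then show ?thesis using h k eq by metis
qed

text \<open>\<open>AB4\<close> speaks of families such as \<open>Dom A (f i)\<close>, the direct
  image of families \<open>FOb F (fst q, x)\<close>. They agree on the index set only, which is
  enough.\<close>

lemma is_coproduct_cong:
  assumes "is_coproduct A I F c inc" and "\<And>i. i \<in> I \<Longrightarrow> F i = G i"
  shows "is_coproduct A I G c inc"
  using assms unfolding is_coproduct_def by simp

text \<open>The index set is a subset of \<open>'u\<close>, the range in which \<open>AB3\<close>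
  guarantees coproducts; fibres of a presheaf morphism are such subsets, so the choice made by
  \<open>coprod\<close> is sound for them.\<close>

lemma is_coproduct_coprod:
  fixes I :: "'u set"
  assumes "AB3 TYPE('u) A" and "\<And>i. i \<in> I \<Longrightarrow> F i \<in> Ob A"
  shows "is_coproduct A I F (coprod_ob A I F) (coprod_in A I F)"
proof -
  obtain c inc where "is_coproduct A I F c inc" using assms unfolding AB3_def by blast
  then have "\<exists>p. is_coproduct A I F (fst p) (snd p)" by (intro exI[of _ "(c, inc)"]) simp
  then show ?thesis unfolding coprod_ob_def coprod_in_def coprod_def by (rule someI_ex)
qed

lemma coprod_desc:
  fixes I :: "'u set"
  assumes "AB3 TYPE('u) A" and "\<And>i. i \<in> I \<Longrightarrow> F i \<in> Ob A"
    and "x \<in> Ob A" and "\<And>i. i \<in> I \<Longrightarrow> g i \<in> Hom A (F i) x"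
  shows "coprod_desc A I F x g \<in> Hom A (coprod_ob A I F) x"
    and "i \<in> I \<Longrightarrow> coprod_desc A I F x g \<cdot>\<^bsub>A\<^esub> coprod_in A I F i = g i"
proof -
  have "coprod_desc A I F x g \<in> Hom A (coprod_ob A I F) x \<and>
      (\<forall>i\<in>I. coprod_desc A I F x g \<cdot>\<^bsub>A\<^esub> coprod_in A I F i = g i)"
    unfolding coprod_desc_def
    by (rule theI'[OF is_coproduct_univ[OF is_coproduct_coprod[OF assms(1,2)] assms(3,4)]])
  then show "coprod_desc A I F x g \<in> Hom A (coprod_ob A I F) x"
    and "i \<in> I \<Longrightarrow> coprod_desc A I F x g \<cdot>\<^bsub>A\<^esub> coprod_in A I F i = g i" by simp_all
qed

section \<open>Presheaves of sets and their categories of elements\<close>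

lemma Hom_set_cat:
  "g \<in> Hom set_cat S T \<longleftrightarrow> src g = S \<and> tgt g = T \<and> body g \<in> S \<rightarrow>\<^sub>E T"
  by (cases g) (auto simp: set_cat_def Hom_iff)

lemma body_Comp_set_cat: "x \<in> src g \<Longrightarrow> body (h \<cdot>\<^bsub>set_cat\<^esub> g) x = body h (body g x)"
  by (simp add: set_cat_def compose_def)

lemma presheaf_map:
  assumes "is_functor (op D) set_cat X" and "\<alpha> \<in> Hom D d e" and "x \<in> FOb X e"
  shows "body (FAr X \<alpha>) x \<in> FOb X d"
  using functor_Hom[OF assms(1), of \<alpha> e d] assms(2,3) by (auto simp: Hom_set_cat)

lemma presheaf_Ide:
  assumes "is_functor (op D) set_cat X" and "d \<in> Ob D" and "x \<in> FOb X d"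
  shows "body (FAr X (Ide D d)) x = x"
  using functor_Ide[OF assms(1), of d] assms(2,3) by (simp add: set_cat_def)

lemma presheaf_Comp:
  assumes "is_functor (op D) set_cat X" and "\<alpha> \<in> Hom D d e" and "\<beta> \<in> Hom D e g" and "x \<in> FOb X g"
  shows "body (FAr X (\<beta> \<cdot>\<^bsub>D\<^esub> \<alpha>)) x = body (FAr X \<alpha>) (body (FAr X \<beta>) x)"
  using functor_Comp[OF assms(1), of \<beta> g e \<alpha> d] functor_Hom[OF assms(1), of \<beta> g e] assms(2-4)
  by (simp add: Hom_set_cat body_Comp_set_cat)

lemma presheaf_morphism_map:
  assumes "is_nat_trans (op D) set_cat X Y f" and "d \<in> Ob D" and "x \<in> FOb X d"
  shows "body (f d) x \<in> FOb Y d"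
  using nat_trans_Hom[OF assms(1), of d] assms(2,3) by (auto simp: Hom_set_cat)

lemma presheaf_morphism_natural:
  assumes D: "category D" and X: "is_functor (op D) set_cat X"
    and f: "is_nat_trans (op D) set_cat X Y f" and \<alpha>: "\<alpha> \<in> Hom D d e" and x: "x \<in> FOb X e"
  shows "body (f d) (body (FAr X \<alpha>) x) = body (FAr Y \<alpha>) (body (f e) x)"
proof -
  have "src (FAr X \<alpha>) = FOb X e" using functor_Hom[OF X, of \<alpha> e d] \<alpha> by (simp add: Hom_set_cat)
  moreover have "src (f e) = FOb X e"
    using nat_trans_Hom[OF f, of e] category.Hom_Ob(2)[OF D \<alpha>] by (simp add: Hom_set_cat)
  moreover have "f d \<cdot>\<^bsub>set_cat\<^esub> FAr X \<alpha> = FAr Y \<alpha> \<cdot>\<^bsub>set_cat\<^esub> f e"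
    using nat_trans_square[OF f, of \<alpha> e d] \<alpha> by simp
  ultimately show ?thesis
    using body_Comp_set_cat[of x "FAr X \<alpha>" "f d"] body_Comp_set_cat[of x "f e" "FAr Y \<alpha>"] x by simp
qed

lemma Ob_elements: "p \<in> Ob (elements_cat D X) \<longleftrightarrow> fst p \<in> Ob D \<and> snd p \<in> FOb X (fst p)"
  by (cases p) (simp add: elements_cat_def)

lemma Hom_elements:
  "s \<in> Hom (elements_cat D X) p q \<longleftrightarrow>
     src s = p \<and> tgt s = q \<and> body s \<in> Hom D (fst p) (fst q) \<and>
     snd p \<in> FOb X (fst p) \<and> snd q \<in> FOb X (fst q) \<and> body (FAr X (body s)) (snd q) = snd p"
  by (cases s; cases p; cases q) (auto simp: Hom_iff elements_cat_def)

lemma elements_simps [simp]: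
  "Dom (elements_cat D X) = src" "Cod (elements_cat D X) = tgt"
  "Ide (elements_cat D X) p = Mor p (Ide D (fst p)) p"
  "t \<cdot>\<^bsub>elements_cat D X\<^esub> s = Mor (src s) (body t \<cdot>\<^bsub>D\<^esub> body s) (tgt t)"
  by (simp_all add: elements_cat_def)

lemma category_elements:
  assumes D: "category D" and X: "is_functor (op D) set_cat X"
  shows "category (elements_cat D X)"
proof -
  interpret D: category D by fact
  have Arr: "\<exists>p q. f \<in> Hom (elements_cat D X) p q" if "f \<in> Arr (elements_cat D X)" for f
    using that by (auto simp: Hom_iff)
  show ?thesis
  proof
    fix s assume "s \<in> Arr (elements_cat D X)"
    then have "s \<in> Hom (elements_cat D X) (src s) (tgt s)" by (simp add: Hom_iff)
    then show "Dom (elements_cat D X) s \<in> Ob (elements_cat D X)" "Cod (elements_cat D X) s \<in> Ob (elements_cat D X)"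
      using D.Hom_Ob unfolding Hom_elements Ob_elements elements_simps by blast+
  next
    fix p assume "p \<in> Ob (elements_cat D X)"
    then show "Ide (elements_cat D X) p \<in> Hom (elements_cat D X) p p"
      using D.Ide_in_Hom presheaf_Ide[OF X] by (simp add: Hom_elements Ob_elements)
  next
    fix s t p q r assume "s \<in> Hom (elements_cat D X) p q" "t \<in> Hom (elements_cat D X) q r"
    then show "t \<cdot>\<^bsub>elements_cat D X\<^esub> s \<in> Hom (elements_cat D X) p r"
      using D.Comp_in_Hom presheaf_Comp[OF X] by (auto simp: Hom_elements)
  next
    fix s p q assume "s \<in> Hom (elements_cat D X) p q"
    then show "s \<cdot>\<^bsub>elements_cat D X\<^esub> Ide (elements_cat D X) p = s"
      "Ide (elements_cat D X) q \<cdot>\<^bsub>elements_cat D X\<^esub> s = s"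
      using D.Comp_Ide_right[of "body s"] D.Comp_Ide_left[of "body s"]
      by (cases s; auto simp: Hom_elements)+
  next
    fix s t u p q r v
    assume "s \<in> Hom (elements_cat D X) p q" "t \<in> Hom (elements_cat D X) q r" "u \<in> Hom (elements_cat D X) r v"
    then show "u \<cdot>\<^bsub>elements_cat D X\<^esub> (t \<cdot>\<^bsub>elements_cat D X\<^esub> s) = u \<cdot>\<^bsub>elements_cat D X\<^esub> t \<cdot>\<^bsub>elements_cat D X\<^esub> s"
      using D.Comp_assoc by (auto simp: Hom_elements)
  qed
qed

text \<open>The functor induced by \<open>f\<close> between the categories of elements. Reversing
  arrows changes neither its object map nor its arrow map, so the same record is used between the
  opposite categories.\<close>

definition elements_map ::
  "('o \<Rightarrow> ('u set, 'u \<Rightarrow> 'u) mor)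
    \<Rightarrow> ('o \<times> 'u, ('o \<times> 'u, 'm) mor, 'o \<times> 'u, ('o \<times> 'u, 'm) mor) functor_data" where
  "elements_map f =
     (let g = (\<lambda>p. (fst p, body (f (fst p)) (snd p)))
      in \<lparr>FOb = g, FAr = (\<lambda>s. Mor (g (src s)) (body s) (g (tgt s)))\<rparr>)"

lemma elements_map_simps [simp]:
  "FOb (elements_map f) p = (fst p, body (f (fst p)) (snd p))"
  "FAr (elements_map f) s = Mor (fst (src s), body (f (fst (src s))) (snd (src s))) (body s)
                                (fst (tgt s), body (f (fst (tgt s))) (snd (tgt s)))"
  by (simp_all add: elements_map_def Let_def)

lemma is_functor_elements_map:
  assumes D: "category D" and X: "is_functor (op D) set_cat X"
    and f: "is_nat_trans (op D) set_cat X Y f"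
  shows "is_functor (op (elements_cat D X)) (op (elements_cat D Y)) (elements_map f)"
proof -
  have ob: "FOb (elements_map f) p \<in> Ob (elements_cat D Y)" if "p \<in> Ob (elements_cat D X)" for p
    using that presheaf_morphism_map[OF f] by (simp add: Ob_elements)
  have hom: "FAr (elements_map f) s \<in> Hom (elements_cat D Y) (FOb (elements_map f) p) (FOb (elements_map f) q)"
    if s: "s \<in> Hom (elements_cat D X) p q" for s p q
    using s presheaf_morphism_map[OF f, of "fst p" "snd p"] presheaf_morphism_map[OF f, of "fst q" "snd q"]
      category.Hom_Ob[OF D, of "body s" "fst p" "fst q"]
      presheaf_morphism_natural[OF D X f, of "body s" "fst p" "fst q" "snd q"]
    by (auto simp: Hom_elements)
  show ?thesis
    unfolding is_functor_def
  proof (intro conjI ballI impI)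
    show "FOb (elements_map f) p \<in> Ob (op (elements_cat D Y))" if "p \<in> Ob (op (elements_cat D X))" for p
      using ob that by simp
    show "FAr (elements_map f) s \<in> Hom (op (elements_cat D Y)) (FOb (elements_map f) (Dom (op (elements_cat D X)) s))
        (FOb (elements_map f) (Cod (op (elements_cat D X)) s))" if "s \<in> Arr (op (elements_cat D X))" for s
      using hom[of s "src s" "tgt s"] that by (simp add: Hom_iff)
  qed simp_all
qed

section \<open>The direct image functor and its exactness\<close>

locale direct_image_setup =
  fixes D :: "('o, 'm, 'y) category_scheme"
    and A :: "('a, 'b, 'z) preadditive_scheme"
    and X Y :: "('o, 'm, 'u set, ('u set, 'u \<Rightarrow> 'u) mor) functor_data"
    and f :: "'o \<Rightarrow> ('u set, 'u \<Rightarrow> 'u) mor"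
  assumes AB4_category: "AB4_category TYPE('u) A"
    and category_D: "category D"
    and presheaf_X: "is_functor (op D) set_cat X"
    and presheaf_Y: "is_functor (op D) set_cat Y"
    and morphism_f: "is_nat_trans (op D) set_cat X Y f"
begin

abbreviation "ElX \<equiv> op (elements_cat D X)"
abbreviation "ElY \<equiv> op (elements_cat D Y)"
abbreviation "CX \<equiv> fun_cat ElX A"
abbreviation "CY \<equiv> fun_cat ElY A"
text \<open>Neither does \<open>f\<close> determine the arrow type of \<open>D\<close>, nor
  \<open>J\<close> the target category of the functors to be restricted, so the types of
  \<open>J\<close> and \<open>II\<close> are fixed explicitly.\<close>

abbreviation J :: "('o \<times> 'u, ('o \<times> 'u, 'm) mor, 'o \<times> 'u, ('o \<times> 'u, 'm) mor) functor_data"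
  where "J \<equiv> elements_map f"
abbreviation "DI \<equiv> direct_image D A X Y f"
abbreviation II ::
  "(('o \<times> 'u, ('o \<times> 'u, 'm) mor, 'a, 'b) functor_data,
    (('o \<times> 'u, ('o \<times> 'u, 'm) mor, 'a, 'b) functor_data, 'o \<times> 'u \<Rightarrow> 'b) mor,
    ('o \<times> 'u, ('o \<times> 'u, 'm) mor, 'a, 'b) functor_data,
    (('o \<times> 'u, ('o \<times> 'u, 'm) mor, 'a, 'b) functor_data, 'o \<times> 'u \<Rightarrow> 'b) mor) functor_data"
  where "II \<equiv> precomp ElX J"
abbreviation "sum_ob F q \<equiv> coprod_ob A (fibre X f q) (\<lambda>x. FOb F (fst q, x))"
abbreviation "sum_in F q \<equiv> coprod_in A (fibre X f q) (\<lambda>x. FOb F (fst q, x))"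
abbreviation "sum_desc F q \<equiv> coprod_desc A (fibre X f q) (\<lambda>x. FOb F (fst q, x))"

sublocale D: category D by (rule category_D)
sublocale A: abelian_category A using AB4_category by (simp add: AB4_category_def)
sublocale ElX: functor_category ElX A
  by (simp add: functor_category_def A.abelian_category_axioms category_op category_elements
      category_D presheaf_X)
sublocale ElY: functor_category ElY A
  by (simp add: functor_category_def A.abelian_category_axioms category_op category_elements
      category_D presheaf_Y)
sublocale CX: category CX by (rule category_fun_cat[OF ElX.C.category_axioms A.category_axioms])
sublocale CY: category CY by (rule category_fun_cat[OF ElY.C.category_axioms A.category_axioms])

lemma functor_J: "is_functor ElX ElY J"
  by (rule is_functor_elements_map[OF category_D presheaf_X morphism_f])

lemma exact_II: "is_exact_functor CY CX II"
  by (rule is_exact_functor_precomp[OF ElX.C.category_axioms ElY.C.category_axioms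
        A.abelian_category_axioms functor_J])

lemma fibreD:
  assumes "q \<in> Ob ElY" and "x \<in> fibre X f q"
  shows "(fst q, x) \<in> Ob ElX" and "FOb J (fst q, x) = q"
  using assms by (auto simp: fibre_def Ob_elements)

lemma fibreI: "p \<in> Ob ElX \<Longrightarrow> snd p \<in> fibre X f (FOb J p)"
  by (auto simp: fibre_def Ob_elements)

text \<open>The functor from elements of \<open>X\<close> to elements of \<open>Y\<close> is a
  discrete fibration: an arrow with a point over its target, which is its source in
  \<open>ElY\<close>, lifts along \<open>X\<close>. This is why the left Kan extension along
  \<open>J\<close> is a plain coproduct over the fibre.\<close>

lemma fibre_arrow:
  assumes b: "b \<in> Hom ElY r q" and x: "x \<in> fibre X f r"
  shows "body (FAr X (body b)) x \<in> fibre X f q"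
    and "Mor (fst q, body (FAr X (body b)) x) (body b) (fst r, x)
      \<in> Hom ElX (fst r, x) (fst q, body (FAr X (body b)) x)"
  using b x presheaf_morphism_natural[OF category_D presheaf_X morphism_f, of "body b" "fst q" "fst r" x]
    presheaf_map[OF presheaf_X, of "body b" "fst q" "fst r" x]
  by (auto simp: fibre_def Hom_elements)

context
  fixes F
  assumes F: "F \<in> Ob CX"
begin

lemma functor_F: "is_functor ElX A F"
  by (rule fun_cat_functor[OF F])

lemma summand_Ob: "q \<in> Ob ElY \<Longrightarrow> x \<in> fibre X f q \<Longrightarrow> FOb F (fst q, x) \<in> Ob A"
  using functor_Ob[OF functor_F fibreD(1)] .

lemma AB3_A: "AB3 TYPE('u) A"
  using AB4_category by (simp add: AB4_category_def)

lemma coproduct_sum: "q \<in> Ob ElY \<Longrightarrow> is_coproduct A (fibre X f q) (\<lambda>x. FOb F (fst q, x)) (sum_ob F q) (sum_in F q)"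
  by (rule is_coproduct_coprod[OF AB3_A summand_Ob])

lemmas sum_in_Hom = is_coproduct_Hom[OF coproduct_sum]
  and sum_Ob = is_coproduct_Ob[OF coproduct_sum]
  and sum_cancel = is_coproduct_cancel[OF A.category_axioms coproduct_sum]
  and sum_desc_Hom = coprod_desc(1)[OF AB3_A summand_Ob]
  and sum_desc_in = coprod_desc(2)[OF AB3_A summand_Ob]

lemma DI_FOb: "q \<in> Ob ElY \<Longrightarrow> FOb (FOb DI F) q = sum_ob F q"
  by (simp add: direct_image_def direct_image_ob_def Let_def)

text \<open>From here on the value at \<open>b\<close> is known only by its effect on summands: the
  summand of \<open>x\<close> goes to the summand of the restricted element, by \<open>F\<close> of
  the lifted arrow.\<close>

lemma DI_FAr:
  assumes b: "b \<in> Hom ElY r q"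
  shows "FAr (FOb DI F) b \<in> Hom A (sum_ob F r) (sum_ob F q)"
    and "x \<in> fibre X f r \<Longrightarrow> FAr (FOb DI F) b \<cdot>\<^bsub>A\<^esub> sum_in F r x =
      sum_in F q (body (FAr X (body b)) x) \<cdot>\<^bsub>A\<^esub>
      FAr F (Mor (fst q, body (FAr X (body b)) x) (body b) (fst r, x))"
proof -
  have r: "r \<in> Ob ElY" and q: "q \<in> Ob ElY" using ElY.C.Hom_Ob[OF b] .
  have bq: "b \<in> Arr (elements_cat D Y)" "src b = q" "tgt b = r" using b by (auto simp: Hom_iff)
  let ?g = "\<lambda>x. sum_in F q (body (FAr X (body b)) x) \<cdot>\<^bsub>A\<^esub>
      FAr F (Mor (fst q, body (FAr X (body b)) x) (body b) (fst r, x))"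
  have eq: "FAr (FOb DI F) b = sum_desc F r (sum_ob F q) ?g"
    using bq by (simp add: direct_image_def direct_image_ob_def Let_def)
  have g: "?g x \<in> Hom A (FOb F (fst r, x)) (sum_ob F q)" if x: "x \<in> fibre X f r" for x
    using A.Comp_in_Hom[OF functor_Hom[OF functor_F fibre_arrow(2)[OF b x]]
        sum_in_Hom[OF q fibre_arrow(1)[OF b x]]] .
  show "FAr (FOb DI F) b \<in> Hom A (sum_ob F r) (sum_ob F q)"
    unfolding eq by (rule sum_desc_Hom[OF r _ sum_Ob[OF q] g])
  show "FAr (FOb DI F) b \<cdot>\<^bsub>A\<^esub> sum_in F r x = ?g x" if x: "x \<in> fibre X f r"
    unfolding eq by (rule sum_desc_in[OF r _ sum_Ob[OF q] g x])
qed

lemma DI_Ob: "FOb DI F \<in> Ob CY"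
proof -
  have "is_functor ElY A (FOb DI F)"
    unfolding is_functor_def
  proof (intro conjI ballI impI)
    show "FOb (FOb DI F) q \<in> Ob A" if "q \<in> Ob ElY" for q
      using sum_Ob[OF that] DI_FOb[OF that] by simp
    show "FAr (FOb DI F) b \<in> Hom A (FOb (FOb DI F) (Dom ElY b)) (FOb (FOb DI F) (Cod ElY b))"
      if b: "b \<in> Arr ElY" for b
      using DI_FAr(1)[OF ElY.C.ArrD[OF b]] DI_FOb[OF ElY.C.Dom_in_Ob[OF b]] DI_FOb[OF ElY.C.Cod_in_Ob[OF b]]
      by simp
  next
    fix q assume q: "q \<in> Ob ElY"
    note i = ElY.C.Ide_in_Hom[OF q]
    have "FAr (FOb DI F) (Ide ElY q) = Ide A (sum_ob F q)"
    proof (rule sum_cancel[OF q DI_FAr(1)[OF i] A.Ide_in_Hom[OF sum_Ob[OF q]]])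
      fix x assume x: "x \<in> fibre X f q"
      \<comment> \<open>An identity arrow keeps the summand, and its lift is the identity of
        \<open>(fst q, x)\<close>.\<close>
      have "body (FAr X (Ide D (fst q))) x = x"
        using presheaf_Ide[OF presheaf_X] q x by (simp add: fibre_def Ob_elements)
      then have "FAr (FOb DI F) (Ide ElY q) \<cdot>\<^bsub>A\<^esub> sum_in F q x
          = sum_in F q x \<cdot>\<^bsub>A\<^esub> FAr F (Ide ElX (fst q, x))"
        using DI_FAr(2)[OF i x] by simp
      then show "FAr (FOb DI F) (Ide ElY q) \<cdot>\<^bsub>A\<^esub> sum_in F q x = Ide A (sum_ob F q) \<cdot>\<^bsub>A\<^esub> sum_in F q x"
        using functor_Ide[OF functor_F fibreD(1)[OF q x]] A.Comp_Ide_right[OF sum_in_Hom[OF q x]]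
          A.Comp_Ide_left[OF sum_in_Hom[OF q x]] by (simp only:)
    qed
    then show "FAr (FOb DI F) (Ide ElY q) = Ide A (FOb (FOb DI F) q)" using DI_FOb[OF q] by simp
  next
    fix u v assume uv: "u \<in> Arr ElY" "v \<in> Arr ElY" "Dom ElY v = Cod ElY u"
    define p q r where "p = Dom ElY u" and "q = Cod ElY u" and "r = Cod ElY v"
    have u: "u \<in> Hom ElY p q" and v: "v \<in> Hom ElY q r"
      using ElY.C.ArrD[OF uv(1)] ElY.C.ArrD[OF uv(2)] uv(3) by (simp_all add: p_def q_def r_def)
    have p: "p \<in> Ob ElY" and q: "q \<in> Ob ElY" and r: "r \<in> Ob ElY"
      using ElY.C.Hom_Ob[OF u] ElY.C.Hom_Ob[OF v] by auto
    note vu = ElY.C.Comp_in_Hom[OF u v]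
    note Du = DI_FAr(1)[OF u] and Dv = DI_FAr(1)[OF v]
    show "FAr (FOb DI F) (v \<cdot>\<^bsub>ElY\<^esub> u) = FAr (FOb DI F) v \<cdot>\<^bsub>A\<^esub> FAr (FOb DI F) u"
    proof (rule sum_cancel[OF p DI_FAr(1)[OF vu] A.Comp_in_Hom[OF Du Dv]])
      fix x assume x: "x \<in> fibre X f p"
      \<comment> \<open>\<open>u\<close> carries the summand of \<open>x\<close> to that of
        \<open>x'\<close>, and \<open>v\<close> carries that one on to the summand of
        \<open>x''\<close>.\<close>
      define x' where "x' = body (FAr X (body u)) x"
      define x'' where "x'' = body (FAr X (body v)) x'"
      have x': "x' \<in> fibre X f q" unfolding x'_def by (rule fibre_arrow(1)[OF u x])
      have x'': "x'' \<in> fibre X f r" unfolding x''_def by (rule fibre_arrow(1)[OF v x'])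
      let ?u = "Mor (fst q, x') (body u) (fst p, x)" and ?v = "Mor (fst r, x'') (body v) (fst q, x')"
      have uX: "?u \<in> Hom ElX (fst p, x) (fst q, x')" unfolding x'_def by (rule fibre_arrow(2)[OF u x])
      have vX: "?v \<in> Hom ElX (fst q, x') (fst r, x'')" unfolding x''_def by (rule fibre_arrow(2)[OF v x'])
      note Fu = functor_Hom[OF functor_F uX] and Fv = functor_Hom[OF functor_F vX]
      \<comment> \<open>Composition in \<open>ElY\<close> is reversed composition in
        \<open>D\<close>, and \<open>X\<close> reverses it once more, so the composite arrow leads
        to the same summand \<open>x''\<close>.\<close>
      have x2: "body (FAr X (body u \<cdot>\<^bsub>D\<^esub> body v)) x = x''"
        unfolding x''_def x'_def
        using presheaf_Comp[OF presheaf_X, of "body v" "fst r" "fst q" "body u" "fst p" x] u v x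
        by (simp add: Hom_elements fibre_def)
      have "FAr (FOb DI F) v \<cdot>\<^bsub>A\<^esub> FAr (FOb DI F) u \<cdot>\<^bsub>A\<^esub> sum_in F p x
          = FAr (FOb DI F) v \<cdot>\<^bsub>A\<^esub> (sum_in F q x' \<cdot>\<^bsub>A\<^esub> FAr F ?u)"
        using A.Comp_assoc[OF sum_in_Hom[OF p x] Du Dv] DI_FAr(2)[OF u x] by (simp add: x'_def)
      also have "\<dots> = sum_in F r x'' \<cdot>\<^bsub>A\<^esub> FAr F ?v \<cdot>\<^bsub>A\<^esub> FAr F ?u"
        using A.Comp_assoc[OF Fu sum_in_Hom[OF q x'] Dv] DI_FAr(2)[OF v x'] by (simp add: x''_def)
      also have "\<dots> = sum_in F r x'' \<cdot>\<^bsub>A\<^esub> FAr F (?v \<cdot>\<^bsub>ElX\<^esub> ?u)"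
        using A.Comp_assoc[OF Fu Fv sum_in_Hom[OF r x'']] functor_Comp[OF functor_F uX vX] by simp
      also have "\<dots> = FAr (FOb DI F) (v \<cdot>\<^bsub>ElY\<^esub> u) \<cdot>\<^bsub>A\<^esub> sum_in F p x"
        using DI_FAr(2)[OF vu x] x2 by simp
      finally show "FAr (FOb DI F) (v \<cdot>\<^bsub>ElY\<^esub> u) \<cdot>\<^bsub>A\<^esub> sum_in F p x
          = FAr (FOb DI F) v \<cdot>\<^bsub>A\<^esub> FAr (FOb DI F) u \<cdot>\<^bsub>A\<^esub> sum_in F p x" by simp
    qed
  qed
  then show ?thesis
    by (simp add: Ob_fun_cat direct_image_def direct_image_ob_def Let_def)
qed

end

lemma DI_src_tgt [simp]: "src (FAr DI s) = FOb DI (src s)" "tgt (FAr DI s) = FOb DI (tgt s)"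
  by (simp_all add: direct_image_def)

lemma DI_body:
  assumes s: "s \<in> Hom CX F G" and q: "q \<in> Ob ElY"
  shows "body (FAr DI s) q \<in> Hom A (sum_ob F q) (sum_ob G q)"
    and "x \<in> fibre X f q
      \<Longrightarrow> body (FAr DI s) q \<cdot>\<^bsub>A\<^esub> sum_in F q x = sum_in G q x \<cdot>\<^bsub>A\<^esub> body s (fst q, x)"
proof -
  have F: "F \<in> Ob CX" and G: "G \<in> Ob CX" and st: "src s = F" "tgt s = G"
    using s by (simp_all add: Hom_fun_cat)
  let ?g = "\<lambda>x. sum_in G q x \<cdot>\<^bsub>A\<^esub> body s (fst q, x)"
  have eq: "body (FAr DI s) q = sum_desc F q (sum_ob G q) ?g"
    using q st by (simp add: direct_image_def Let_def)
  have g: "?g x \<in> Hom A (FOb F (fst q, x)) (sum_ob G q)" if x: "x \<in> fibre X f q" for x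
    using A.Comp_in_Hom[OF fun_cat_body(1)[OF s fibreD(1)[OF q x]] sum_in_Hom[OF G q x]] .
  show "body (FAr DI s) q \<in> Hom A (sum_ob F q) (sum_ob G q)"
    unfolding eq by (rule sum_desc_Hom[OF F q _ sum_Ob[OF G q] g])
  show "body (FAr DI s) q \<cdot>\<^bsub>A\<^esub> sum_in F q x = ?g x" if x: "x \<in> fibre X f q"
    unfolding eq by (rule sum_desc_in[OF F q _ sum_Ob[OF G q] g x])
qed

text \<open>On the summand of \<open>x\<close>, naturality of the direct image of \<open>s\<close>
  along \<open>b\<close> is naturality of \<open>s\<close> along the lift of \<open>b\<close> that
  starts at \<open>x\<close> in \<open>ElX\<close>.\<close>

lemma DI_Hom:
  assumes s: "s \<in> Hom CX F G"
  shows "FAr DI s \<in> Hom CY (FOb DI F) (FOb DI G)"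
proof -
  have F: "F \<in> Ob CX" and G: "G \<in> Ob CX" and st: "src s = F" "tgt s = G"
    using s by (simp_all add: Hom_fun_cat)
  note fF = functor_F[OF F] and fG = functor_F[OF G]
  have "Mor (FOb DI F) (\<lambda>q\<in>Ob ElY. body (FAr DI s) q) (FOb DI G) \<in> Hom CY (FOb DI F) (FOb DI G)"
  proof (rule fun_cat_Mor[OF ElY.C.category_axioms DI_Ob[OF F] DI_Ob[OF G]])
    show "body (FAr DI s) q \<in> Hom A (FOb (FOb DI F) q) (FOb (FOb DI G) q)" if q: "q \<in> Ob ElY" for q
      using DI_body(1)[OF s q] DI_FOb[OF F q] DI_FOb[OF G q] by simp
    fix b r q assume b: "b \<in> Hom ElY r q"
    have r: "r \<in> Ob ElY" and q: "q \<in> Ob ElY" using ElY.C.Hom_Ob[OF b] .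
    note Fb = DI_FAr(1)[OF F b] and Gb = DI_FAr(1)[OF G b]
      and sr = DI_body(1)[OF s r] and sq = DI_body(1)[OF s q]
    show "body (FAr DI s) q \<cdot>\<^bsub>A\<^esub> FAr (FOb DI F) b = FAr (FOb DI G) b \<cdot>\<^bsub>A\<^esub> body (FAr DI s) r"
    proof (rule sum_cancel[OF F r A.Comp_in_Hom[OF Fb sq] A.Comp_in_Hom[OF sr Gb]])
      fix x assume x: "x \<in> fibre X f r"
      define x' where "x' = body (FAr X (body b)) x"
      have x': "x' \<in> fibre X f q" unfolding x'_def by (rule fibre_arrow(1)[OF b x])
      let ?b = "Mor (fst q, x') (body b) (fst r, x)"
      have bX: "?b \<in> Hom ElX (fst r, x) (fst q, x')" unfolding x'_def by (rule fibre_arrow(2)[OF b x])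
      note sx = fun_cat_body(1)[OF s fibreD(1)[OF r x]] and sx' = fun_cat_body(1)[OF s fibreD(1)[OF q x']]
      note Fx = functor_Hom[OF fF bX] and Gx = functor_Hom[OF fG bX]
      have "body (FAr DI s) q \<cdot>\<^bsub>A\<^esub> FAr (FOb DI F) b \<cdot>\<^bsub>A\<^esub> sum_in F r x
          = body (FAr DI s) q \<cdot>\<^bsub>A\<^esub> (sum_in F q x' \<cdot>\<^bsub>A\<^esub> FAr F ?b)"
        using A.Comp_assoc[OF sum_in_Hom[OF F r x] Fb sq] DI_FAr(2)[OF F b x] by (simp add: x'_def)
      also have "\<dots> = sum_in G q x' \<cdot>\<^bsub>A\<^esub> (body s (fst q, x') \<cdot>\<^bsub>A\<^esub> FAr F ?b)"
        using A.Comp_assoc[OF Fx sum_in_Hom[OF F q x'] sq] DI_body(2)[OF s q x']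
          A.Comp_assoc[OF Fx sx' sum_in_Hom[OF G q x']] by simp
      also have "\<dots> = sum_in G q x' \<cdot>\<^bsub>A\<^esub> FAr G ?b \<cdot>\<^bsub>A\<^esub> body s (fst r, x)"
        using fun_cat_body(2)[OF s bX] A.Comp_assoc[OF sx Gx sum_in_Hom[OF G q x']] by simp
      also have "\<dots> = FAr (FOb DI G) b \<cdot>\<^bsub>A\<^esub> (sum_in G r x \<cdot>\<^bsub>A\<^esub> body s (fst r, x))"
        using A.Comp_assoc[OF sx sum_in_Hom[OF G r x] Gb] DI_FAr(2)[OF G b x] by (simp add: x'_def)
      also have "\<dots> = FAr (FOb DI G) b \<cdot>\<^bsub>A\<^esub> body (FAr DI s) r \<cdot>\<^bsub>A\<^esub> sum_in F r x"
        using A.Comp_assoc[OF sum_in_Hom[OF F r x] sr Gb] DI_body(2)[OF s r x] by simp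
      finally show "body (FAr DI s) q \<cdot>\<^bsub>A\<^esub> FAr (FOb DI F) b \<cdot>\<^bsub>A\<^esub> sum_in F r x
          = FAr (FOb DI G) b \<cdot>\<^bsub>A\<^esub> body (FAr DI s) r \<cdot>\<^bsub>A\<^esub> sum_in F r x" .
    qed
  qed
  moreover have "Mor (FOb DI F) (\<lambda>q\<in>Ob ElY. body (FAr DI s) q) (FOb DI G) = FAr DI s"
    using st by (auto simp: direct_image_def Let_def intro!: restrict_ext)
  ultimately show ?thesis by simp
qed

lemma functor_DI: "is_functor CX CY DI"
  unfolding is_functor_def
proof (intro conjI ballI impI DI_Ob)
  show "FAr DI s \<in> Hom CY (FOb DI (Dom CX s)) (FOb DI (Cod CX s))" if "s \<in> Arr CX" for s
    using DI_Hom[OF CX.ArrD[OF that]] .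
  fix F assume F: "F \<in> Ob CX"
  note i = CX.Ide_in_Hom[OF F]
  show "FAr DI (Ide CX F) = Ide CY (FOb DI F)"
  proof (rule fun_cat_arr_eqI[OF DI_Hom[OF i] CY.Ide_in_Hom[OF DI_Ob[OF F]]])
    fix q assume q: "q \<in> Ob ElY"
    have "body (FAr DI (Ide CX F)) q = Ide A (sum_ob F q)"
    proof (rule sum_cancel[OF F q DI_body(1)[OF i q] A.Ide_in_Hom[OF sum_Ob[OF F q]]])
      fix x assume x: "x \<in> fibre X f q"
      have "body (Ide CX F) (fst q, x) = Ide A (FOb F (fst q, x))" using fibreD(1)[OF q x] by simp
      then show "body (FAr DI (Ide CX F)) q \<cdot>\<^bsub>A\<^esub> sum_in F q x = Ide A (sum_ob F q) \<cdot>\<^bsub>A\<^esub> sum_in F q x"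
        using DI_body(2)[OF i q x] A.Comp_Ide_right[OF sum_in_Hom[OF F q x]]
          A.Comp_Ide_left[OF sum_in_Hom[OF F q x]] by simp
    qed
    then show "body (FAr DI (Ide CX F)) q = body (Ide CY (FOb DI F)) q"
      using q DI_FOb[OF F q] by simp
  qed
next
  fix s t assume st: "s \<in> Arr CX" "t \<in> Arr CX" "Dom CX t = Cod CX s"
  define F G H where "F = src s" and "G = tgt s" and "H = tgt t"
  have s: "s \<in> Hom CX F G" and t: "t \<in> Hom CX G H"
    using st by (simp_all add: Hom_iff F_def G_def H_def)
  have F: "F \<in> Ob CX" and G: "G \<in> Ob CX" and H: "H \<in> Ob CX"
    using CX.Hom_Ob[OF s] CX.Hom_Ob[OF t] by auto
  note ts = CX.Comp_in_Hom[OF s t]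
  show "FAr DI (t \<cdot>\<^bsub>CX\<^esub> s) = FAr DI t \<cdot>\<^bsub>CY\<^esub> FAr DI s"
  proof (rule fun_cat_arr_eqI[OF DI_Hom[OF ts] CY.Comp_in_Hom[OF DI_Hom[OF s] DI_Hom[OF t]]])
    fix q assume q: "q \<in> Ob ElY"
    note sq = DI_body(1)[OF s q] and tq = DI_body(1)[OF t q]
    have "body (FAr DI (t \<cdot>\<^bsub>CX\<^esub> s)) q = body (FAr DI t) q \<cdot>\<^bsub>A\<^esub> body (FAr DI s) q"
    proof (rule sum_cancel[OF F q DI_body(1)[OF ts q] A.Comp_in_Hom[OF sq tq]])
      fix x assume x: "x \<in> fibre X f q"
      have "body (t \<cdot>\<^bsub>CX\<^esub> s) (fst q, x) = body t (fst q, x) \<cdot>\<^bsub>A\<^esub> body s (fst q, x)"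
        using fibreD(1)[OF q x] by simp
      moreover note sx = fun_cat_body(1)[OF s fibreD(1)[OF q x]]
        and tx = fun_cat_body(1)[OF t fibreD(1)[OF q x]]
      ultimately show "body (FAr DI (t \<cdot>\<^bsub>CX\<^esub> s)) q \<cdot>\<^bsub>A\<^esub> sum_in F q x
          = body (FAr DI t) q \<cdot>\<^bsub>A\<^esub> body (FAr DI s) q \<cdot>\<^bsub>A\<^esub> sum_in F q x"
        using DI_body(2)[OF ts q x] DI_body(2)[OF s q x] DI_body(2)[OF t q x]
          A.Comp_assoc[OF sum_in_Hom[OF F q x] sq tq] A.Comp_assoc[OF sx sum_in_Hom[OF G q x] tq]
          A.Comp_assoc[OF sx tx sum_in_Hom[OF H q x]] by metis
    qed
    then show "body (FAr DI (t \<cdot>\<^bsub>CX\<^esub> s)) q = body (FAr DI t \<cdot>\<^bsub>CY\<^esub> FAr DI s) q" using q by simp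
  qed
qed

lemma DI_Add:
  assumes s: "s \<in> Hom CX F G" and t: "t \<in> Hom CX F G"
  shows "FAr DI (Add CX s t) = Add CY (FAr DI s) (FAr DI t)"
proof -
  have F: "F \<in> Ob CX" and G: "G \<in> Ob CX" and st: "src s = F" "tgt s = G" "src t = F" "tgt t = G"
    using s t by (simp_all add: Hom_fun_cat)
  have add: "Add A (body s p) (body t p) \<in> Hom A (FOb F p) (FOb G p)" if "p \<in> Ob ElX" for p
    using A.Add_Hom[OF fun_cat_body(1)[OF s that] fun_cat_body(1)[OF t that]] .
  \<comment> \<open>The pointwise sum is again natural, because composition in \<open>A\<close> is
    bilinear.\<close>
  have "Mor F (\<lambda>p\<in>Ob ElX. Add A (body s p) (body t p)) G \<in> Hom CX F G"
  proof (rule fun_cat_Mor[OF ElX.C.category_axioms F G add])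
    fix u a b assume u: "u \<in> Hom ElX a b"
    have a: "a \<in> Ob ElX" and b: "b \<in> Ob ElX" using ElX.C.Hom_Ob[OF u] .
    note Fu = functor_Hom[OF functor_F[OF F] u] and Gu = functor_Hom[OF functor_F[OF G] u]
    show "Add A (body s b) (body t b) \<cdot>\<^bsub>A\<^esub> FAr F u = FAr G u \<cdot>\<^bsub>A\<^esub> Add A (body s a) (body t a)"
      using A.Comp_Add_left[OF Fu fun_cat_body(1)[OF s b] fun_cat_body(1)[OF t b]]
        A.Comp_Add_right[OF fun_cat_body(1)[OF s a] fun_cat_body(1)[OF t a] Gu]
        fun_cat_body(2)[OF s u] fun_cat_body(2)[OF t u] by simp
  qed
  then have st_Hom: "Add CX s t \<in> Hom CX F G" by (simp add: st)
  have eq: "body (FAr DI (Add CX s t)) q = Add A (body (FAr DI s) q) (body (FAr DI t) q)"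
    if q: "q \<in> Ob ElY" for q
  proof (rule sum_cancel[OF F q DI_body(1)[OF st_Hom q] A.Add_Hom[OF DI_body(1)[OF s q] DI_body(1)[OF t q]]])
    fix x assume x: "x \<in> fibre X f q"
    note p = fibreD(1)[OF q x]
    have "body (Add CX s t) (fst q, x) = Add A (body s (fst q, x)) (body t (fst q, x))"
      using p by simp
    then show "body (FAr DI (Add CX s t)) q \<cdot>\<^bsub>A\<^esub> sum_in F q x
        = Add A (body (FAr DI s) q) (body (FAr DI t) q) \<cdot>\<^bsub>A\<^esub> sum_in F q x"
      using DI_body(2)[OF st_Hom q x] DI_body(2)[OF s q x] DI_body(2)[OF t q x]
        A.Comp_Add_left[OF sum_in_Hom[OF F q x] DI_body(1)[OF s q] DI_body(1)[OF t q]]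
        A.Comp_Add_right[OF fun_cat_body(1)[OF s p] fun_cat_body(1)[OF t p] sum_in_Hom[OF G q x]]
      by metis
  qed
  have DI_Hom': "src (FAr DI (Add CX s t)) = FOb DI F" "tgt (FAr DI (Add CX s t)) = FOb DI G"
    "body (FAr DI (Add CX s t)) \<in> extensional (Ob ElY)"
    using DI_Hom[OF st_Hom] by (simp_all only: Hom_fun_cat)
  \<comment> \<open>The right-hand side of the claim has not been placed in a Hom-set of
    \<open>CY\<close>. The left-hand side is therefore rebuilt from its extensional components, and
    these are rewritten by \<open>eq\<close>.\<close>
  have "FAr DI (Add CX s t) = Mor (FOb DI F) (\<lambda>q\<in>Ob ElY. body (FAr DI (Add CX s t)) q) (FOb DI G)"
    using DI_Hom' by (metis extensional_restrict mor.collapse)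
  also have "\<dots> = Mor (FOb DI F) (\<lambda>q\<in>Ob ElY. Add A (body (FAr DI s) q) (body (FAr DI t) q)) (FOb DI G)"
    using eq by (simp only: mor.inject) (auto intro!: restrict_ext)
  also have "\<dots> = Add CY (FAr DI s) (FAr DI t)" by (simp add: st)
  finally show ?thesis .
qed

text \<open>The place where exactness of coproducts is spent: over each \<open>q\<close> the direct
  image of the sequence is the coproduct, indexed by the fibre over \<open>q\<close>, of the short
  exact sequences at the points of that fibre.\<close>

lemma DI_short_exact:
  assumes st: "short_exact CX s t"
  shows "short_exact CY (FAr DI s) (FAr DI t)"
proof -
  define F G H where "F = src s" and "G = tgt s" and "H = tgt t"
  have s: "s \<in> Hom CX F G" and t: "t \<in> Hom CX G H"
    using short_exact_arrows[OF st] by (simp_all add: F_def G_def H_def)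
  have F: "F \<in> Ob CX" and G: "G \<in> Ob CX" and H: "H \<in> Ob CX"
    using CX.Hom_Ob[OF s] CX.Hom_Ob[OF t] by auto
  have AB4: "AB4 TYPE('u) A" using AB4_category by (simp add: AB4_category_def)
  have "short_exact A (body (FAr DI s) q) (body (FAr DI t) q)" if q: "q \<in> Ob ElY" for q
  proof -
    let ?s = "\<lambda>x. body s (fst q, x)" and ?t = "\<lambda>x. body t (fst q, x)"
    have DC: "Dom A (?s x) = FOb F (fst q, x)" "Dom A (?t x) = FOb G (fst q, x)"
      "Cod A (?t x) = FOb H (fst q, x)" if "x \<in> fibre X f q" for x
      using fun_cat_body(1)[OF s fibreD(1)[OF q that]] fun_cat_body(1)[OF t fibreD(1)[OF q that]]
      by (simp_all add: Hom_iff)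
    have "\<forall>x\<in>fibre X f q. short_exact A (?s x) (?t x)"
      using st fibreD(1)[OF q] unfolding ElX.short_exact_fun_cat_iff[OF s t] by blast
    moreover have "is_coproduct A (fibre X f q) (\<lambda>x. Dom A (?s x)) (sum_ob F q) (sum_in F q)"
      by (rule is_coproduct_cong[OF coproduct_sum[OF F q]]) (simp add: DC)
    moreover have "is_coproduct A (fibre X f q) (\<lambda>x. Dom A (?t x)) (sum_ob G q) (sum_in G q)"
      by (rule is_coproduct_cong[OF coproduct_sum[OF G q]]) (simp add: DC)
    moreover have "is_coproduct A (fibre X f q) (\<lambda>x. Cod A (?t x)) (sum_ob H q) (sum_in H q)"
      by (rule is_coproduct_cong[OF coproduct_sum[OF H q]]) (simp add: DC)
    moreover have "\<forall>x\<in>fibre X f q. body (FAr DI s) q \<cdot>\<^bsub>A\<^esub> sum_in F q x = sum_in G q x \<cdot>\<^bsub>A\<^esub> ?s x"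
      using DI_body(2)[OF s q] by blast
    moreover have "\<forall>x\<in>fibre X f q. body (FAr DI t) q \<cdot>\<^bsub>A\<^esub> sum_in G q x = sum_in H q x \<cdot>\<^bsub>A\<^esub> ?t x"
      using DI_body(2)[OF t q] by blast
    ultimately show ?thesis
      using AB4[unfolded AB4_def, rule_format, of "fibre X f q" ?s ?t "sum_ob F q" "sum_in F q"
          "sum_ob G q" "sum_in G q" "sum_ob H q" "sum_in H q" "body (FAr DI s) q" "body (FAr DI t) q"]
        DI_body(1)[OF s q] DI_body(1)[OF t q] by blast
  qed
  then show ?thesis
    unfolding ElY.short_exact_fun_cat_iff[OF DI_Hom[OF s] DI_Hom[OF t]] by blast
qed

lemma exact_DI: "is_exact_functor CX CY DI"
proof -
  have "FAr DI (Add CX s t) = Add CY (FAr DI s) (FAr DI t)"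
    if "s \<in> Arr CX" "t \<in> Arr CX" "Dom CX s = Dom CX t \<and> Cod CX s = Cod CX t" for s t
    using DI_Add[OF CX.ArrD[OF that(1)]] CX.ArrD[OF that(2)] that(3) by metis
  then show ?thesis
    unfolding is_exact_functor_def is_additive_functor_def
    using functor_DI DI_short_exact by blast
qed

end

section \<open>The adjunction between direct image and restriction, and colimits\<close>

context direct_image_setup
begin

text \<open>The universal arrow of the Kan extension: an element \<open>p\<close> of
  \<open>X\<close> indexes one of the summands over its own image \<open>FOb J p\<close>.\<close>

definition unit :: "('o \<times> 'u, ('o \<times> 'u, 'm) mor, 'a, 'b) functor_data
    \<Rightarrow> (('o \<times> 'u, ('o \<times> 'u, 'm) mor, 'a, 'b) functor_data, 'o \<times> 'u \<Rightarrow> 'b) mor" where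
  "unit F = Mor F (\<lambda>p\<in>Ob ElX. sum_in F (FOb J p) (snd p)) (FOb II (FOb DI F))"

text \<open>The codiagonal: after restriction along \<open>J\<close>, all summands over
  \<open>q\<close> are copies of \<open>FOb G q\<close>, and they are folded together by
  identities.\<close>

definition counit :: "('o \<times> 'u, ('o \<times> 'u, 'm) mor, 'a, 'b) functor_data
    \<Rightarrow> (('o \<times> 'u, ('o \<times> 'u, 'm) mor, 'a, 'b) functor_data, 'o \<times> 'u \<Rightarrow> 'b) mor" where
  "counit G = Mor (FOb DI (FOb II G))
     (\<lambda>q\<in>Ob ElY. sum_desc (FOb II G) q (FOb G q) (\<lambda>x. Ide A (FOb G q))) G"

lemma J_Ob: "p \<in> Ob ElX \<Longrightarrow> FOb J p \<in> Ob ElY"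
  by (rule functor_Ob[OF functor_J])

lemma II_Ob: "G \<in> Ob CY \<Longrightarrow> FOb II G \<in> Ob CX"
  by (rule functor_Ob[OF exact_functorD(1)[OF exact_II]])

lemma sum_in_J_Hom:
  assumes F: "F \<in> Ob CX" and p: "p \<in> Ob ElX"
  shows "sum_in F (FOb J p) (snd p) \<in> Hom A (FOb F p) (sum_ob F (FOb J p))"
  using sum_in_Hom[OF F J_Ob[OF p] fibreI[OF p]] by simp

text \<open>An arrow \<open>u\<close> is itself the lift of \<open>FAr J u\<close> at the point
  \<open>snd p\<close>. The identity serves twice, for the naturality of the unit and for the cocone
  condition in the comparison of colimits.\<close>

lemma sum_in_J_natural:
  assumes F: "F \<in> Ob CX" and u: "u \<in> Hom ElX p r"
  shows "FAr (FOb DI F) (FAr J u) \<cdot>\<^bsub>A\<^esub> sum_in F (FOb J p) (snd p)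
      = sum_in F (FOb J r) (snd r) \<cdot>\<^bsub>A\<^esub> FAr F u"
proof -
  have p: "p \<in> Ob ElX" using ElX.C.Hom_Ob[OF u] by simp
  have "body (FAr X (body u)) (snd p) = snd r" "Mor r (body u) p = u"
    using u by (auto simp: Hom_elements)
  then show ?thesis
    using DI_FAr(2)[OF F functor_Hom[OF functor_J u] fibreI[OF p]] by simp
qed

lemma unit_Hom:
  assumes F: "F \<in> Ob CX"
  shows "unit F \<in> Hom CX F (FOb II (FOb DI F))"
  unfolding unit_def
proof (rule fun_cat_Mor[OF ElX.C.category_axioms F II_Ob[OF DI_Ob[OF F]]])
  show "sum_in F (FOb J p) (snd p) \<in> Hom A (FOb F p) (FOb (FOb II (FOb DI F)) p)"
    if p: "p \<in> Ob ElX" for p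
    using sum_in_J_Hom[OF F p] precomp_simps(1)[of p ElX J "FOb DI F"] DI_FOb[OF F J_Ob[OF p]] p by metis
  show "sum_in F (FOb J r) (snd r) \<cdot>\<^bsub>A\<^esub> FAr F u
      = FAr (FOb II (FOb DI F)) u \<cdot>\<^bsub>A\<^esub> sum_in F (FOb J p) (snd p)" if u: "u \<in> Hom ElX p r" for u p r
    using sum_in_J_natural[OF F u] precomp_simps(2)[of u ElX J "FOb DI F"] u unfolding Hom_iff by metis
qed

lemma unit_body: "p \<in> Ob ElX \<Longrightarrow> body (unit F) p = sum_in F (FOb J p) (snd p)"
  by (simp add: unit_def)

lemma unit_natural: "is_nat_trans CX CX id_functor (functor_comp II DI) unit"
  unfolding is_nat_trans_def
proof (intro conjI ballI)
  show "unit F \<in> Hom CX (FOb id_functor F) (FOb (functor_comp II DI) F)" if "F \<in> Ob CX" for F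
    using unit_Hom[OF that] by simp
  fix s assume "s \<in> Arr CX"
  then have s: "s \<in> Hom CX (src s) (tgt s)" and F: "src s \<in> Ob CX" and G: "tgt s \<in> Ob CX"
    by (simp_all add: Hom_iff Arr_fun_cat)
  have "unit (tgt s) \<cdot>\<^bsub>CX\<^esub> s = FAr II (FAr DI s) \<cdot>\<^bsub>CX\<^esub> unit (src s)"
  proof (rule fun_cat_arr_eqI[OF CX.Comp_in_Hom[OF s unit_Hom[OF G]] CX.Comp_in_Hom[OF unit_Hom[OF F]
          functor_Hom[OF exact_functorD(1)[OF exact_II] DI_Hom[OF s]]]])
    fix p assume p: "p \<in> Ob ElX"
    have "body (FAr DI s) (FOb J p) \<cdot>\<^bsub>A\<^esub> sum_in (src s) (FOb J p) (snd p)
        = sum_in (tgt s) (FOb J p) (snd p) \<cdot>\<^bsub>A\<^esub> body s p"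
      using DI_body(2)[OF s J_Ob[OF p] fibreI[OF p]] by simp
    then show "body (unit (tgt s) \<cdot>\<^bsub>CX\<^esub> s) p = body (FAr II (FAr DI s) \<cdot>\<^bsub>CX\<^esub> unit (src s)) p"
      using p unit_body[OF p] precomp_simps(5)[OF p] by (simp del: elements_map_simps op_simps)
  qed
  then show "unit (Cod CX s) \<cdot>\<^bsub>CX\<^esub> FAr id_functor s = FAr (functor_comp II DI) s \<cdot>\<^bsub>CX\<^esub> unit (Dom CX s)"
    by (simp only: fun_cat_simps(1,2) id_functor_simps FAr_functor_comp)
qed

lemma II_FOb_fibre:
  assumes q: "q \<in> Ob ElY" and x: "x \<in> fibre X f q"
  shows "FOb (FOb II G) (fst q, x) = FOb G q"
  using precomp_simps(1)[OF fibreD(1)[OF q x], of J G] fibreD(2)[OF q x] by (simp only:)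

lemma counit_body:
  assumes G: "G \<in> Ob CY" and q: "q \<in> Ob ElY"
  shows "body (counit G) q \<in> Hom A (sum_ob (FOb II G) q) (FOb G q)"
    and "x \<in> fibre X f q \<Longrightarrow> body (counit G) q \<cdot>\<^bsub>A\<^esub> sum_in (FOb II G) q x = Ide A (FOb G q)"
proof -
  have Gq: "FOb G q \<in> Ob A" using functor_Ob[OF fun_cat_functor[OF G] q] .
  have g: "Ide A (FOb G q) \<in> Hom A (FOb (FOb II G) (fst q, x)) (FOb G q)" if x: "x \<in> fibre X f q" for x
    using A.Ide_in_Hom[OF Gq] II_FOb_fibre[OF q x] by simp
  have eq: "body (counit G) q = sum_desc (FOb II G) q (FOb G q) (\<lambda>x. Ide A (FOb G q))"
    using q by (simp add: counit_def)
  show "body (counit G) q \<in> Hom A (sum_ob (FOb II G) q) (FOb G q)"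
    unfolding eq by (rule sum_desc_Hom[OF II_Ob[OF G] q _ Gq g])
  show "body (counit G) q \<cdot>\<^bsub>A\<^esub> sum_in (FOb II G) q x = Ide A (FOb G q)" if "x \<in> fibre X f q"
    unfolding eq by (rule sum_desc_in[OF II_Ob[OF G] q _ Gq g that])
qed

lemma counit_Hom:
  assumes G: "G \<in> Ob CY"
  shows "counit G \<in> Hom CY (FOb DI (FOb II G)) G"
proof -
  note fG = fun_cat_functor[OF G] and IG = II_Ob[OF G]
  have "Mor (FOb DI (FOb II G)) (\<lambda>q\<in>Ob ElY. body (counit G) q) G \<in> Hom CY (FOb DI (FOb II G)) G"
  proof (rule fun_cat_Mor[OF ElY.C.category_axioms DI_Ob[OF IG] G])
    show "body (counit G) q \<in> Hom A (FOb (FOb DI (FOb II G)) q) (FOb G q)" if q: "q \<in> Ob ElY" for q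
      using counit_body(1)[OF G q] DI_FOb[OF IG q] by simp
    fix b r q assume b: "b \<in> Hom ElY r q"
    have r: "r \<in> Ob ElY" and q: "q \<in> Ob ElY" using ElY.C.Hom_Ob[OF b] .
    note Db = DI_FAr(1)[OF IG b] and Gb = functor_Hom[OF fG b]
      and cr = counit_body(1)[OF G r] and cq = counit_body(1)[OF G q]
    show "body (counit G) q \<cdot>\<^bsub>A\<^esub> FAr (FOb DI (FOb II G)) b = FAr G b \<cdot>\<^bsub>A\<^esub> body (counit G) r"
    proof (rule sum_cancel[OF IG r A.Comp_in_Hom[OF Db cq] A.Comp_in_Hom[OF cr Gb]])
      fix x assume x: "x \<in> fibre X f r"
      define x' where "x' = body (FAr X (body b)) x"
      have x': "x' \<in> fibre X f q" unfolding x'_def by (rule fibre_arrow(1)[OF b x])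
      let ?b = "Mor (fst q, x') (body b) (fst r, x)"
      have bX: "?b \<in> Hom ElX (fst r, x) (fst q, x')" unfolding x'_def by (rule fibre_arrow(2)[OF b x])
      \<comment> \<open>The lift lies over \<open>b\<close>, so the restricted functor acts on it as
        \<open>FAr G b\<close>, whatever the point \<open>x\<close> of the fibre is.\<close>
      have "FAr J ?b = Mor q (body b) r"
        using fibreD(2)[OF r x] fibreD(2)[OF q x'] by simp
      also have "\<dots> = b" using b by (auto simp: Hom_elements)
      finally have Jb: "FAr J ?b = b" .
      have Ib: "FAr (FOb II G) ?b = FAr G b"
        using precomp_simps(2)[of ?b ElX J G] bX Jb unfolding Hom_iff by metis
      have IbH: "FAr G b \<in> Hom A (FOb (FOb II G) (fst r, x)) (FOb (FOb II G) (fst q, x'))"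
        using functor_Hom[OF functor_F[OF IG] bX] Ib by simp
      have "body (counit G) q \<cdot>\<^bsub>A\<^esub> FAr (FOb DI (FOb II G)) b \<cdot>\<^bsub>A\<^esub> sum_in (FOb II G) r x
          = body (counit G) q \<cdot>\<^bsub>A\<^esub> (sum_in (FOb II G) q x' \<cdot>\<^bsub>A\<^esub> FAr G b)"
        using A.Comp_assoc[OF sum_in_Hom[OF IG r x] Db cq] DI_FAr(2)[OF IG b x] Ib by (simp add: x'_def)
      also have "\<dots> = Ide A (FOb G q) \<cdot>\<^bsub>A\<^esub> FAr G b"
        using A.Comp_assoc[OF IbH sum_in_Hom[OF IG q x'] cq] counit_body(2)[OF G q x'] by simp
      also have "\<dots> = FAr G b \<cdot>\<^bsub>A\<^esub> Ide A (FOb G r)"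
        using A.Comp_Ide_left[OF Gb] A.Comp_Ide_right[OF Gb] by simp
      also have "\<dots> = FAr G b \<cdot>\<^bsub>A\<^esub> body (counit G) r \<cdot>\<^bsub>A\<^esub> sum_in (FOb II G) r x"
        using A.Comp_assoc[OF sum_in_Hom[OF IG r x] cr Gb] counit_body(2)[OF G r x] by simp
      finally show "body (counit G) q \<cdot>\<^bsub>A\<^esub> FAr (FOb DI (FOb II G)) b \<cdot>\<^bsub>A\<^esub> sum_in (FOb II G) r x
          = FAr G b \<cdot>\<^bsub>A\<^esub> body (counit G) r \<cdot>\<^bsub>A\<^esub> sum_in (FOb II G) r x" .
    qed
  qed
  moreover have "Mor (FOb DI (FOb II G)) (\<lambda>q\<in>Ob ElY. body (counit G) q) G = counit G"
    by (auto simp: counit_def intro!: restrict_ext)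
  ultimately show ?thesis by simp
qed

lemma counit_natural: "is_nat_trans CY CY (functor_comp DI II) id_functor counit"
  unfolding is_nat_trans_def
proof (intro conjI ballI)
  show "counit G \<in> Hom CY (FOb (functor_comp DI II) G) (FOb id_functor G)" if "G \<in> Ob CY" for G
    using counit_Hom[OF that] by simp
  fix s assume "s \<in> Arr CY"
  then have s: "s \<in> Hom CY (src s) (tgt s)" and G: "src s \<in> Ob CY" and H: "tgt s \<in> Ob CY"
    by (simp_all add: Hom_iff Arr_fun_cat)
  note IG = II_Ob[OF G] and IH = II_Ob[OF H]
  note Is = functor_Hom[OF exact_functorD(1)[OF exact_II] s]
  note DIs = DI_Hom[OF Is]
  have "counit (tgt s) \<cdot>\<^bsub>CY\<^esub> FAr DI (FAr II s) = s \<cdot>\<^bsub>CY\<^esub> counit (src s)"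
  proof (rule fun_cat_arr_eqI[OF CY.Comp_in_Hom[OF DIs counit_Hom[OF H]] CY.Comp_in_Hom[OF counit_Hom[OF G] s]])
    fix q assume q: "q \<in> Ob ElY"
    note cG = counit_body(1)[OF G q] and cH = counit_body(1)[OF H q]
      and sq = fun_cat_body(1)[OF s q] and dq = DI_body(1)[OF Is q]
    have "body (counit (tgt s)) q \<cdot>\<^bsub>A\<^esub> body (FAr DI (FAr II s)) q = body s q \<cdot>\<^bsub>A\<^esub> body (counit (src s)) q"
    proof (rule sum_cancel[OF IG q A.Comp_in_Hom[OF dq cH] A.Comp_in_Hom[OF cG sq]])
      fix x assume x: "x \<in> fibre X f q"
      note p = fibreD[OF q x]
      have Isx: "body (FAr II s) (fst q, x) = body s q"
        using precomp_simps(5)[OF p(1), of J s] p(2) by (simp only:)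
      have sH: "body s q \<in> Hom A (FOb (FOb II (src s)) (fst q, x)) (FOb (FOb II (tgt s)) (fst q, x))"
        using sq II_FOb_fibre[OF q x] by simp
      have "body (counit (tgt s)) q \<cdot>\<^bsub>A\<^esub> body (FAr DI (FAr II s)) q \<cdot>\<^bsub>A\<^esub> sum_in (FOb II (src s)) q x
          = body (counit (tgt s)) q \<cdot>\<^bsub>A\<^esub> (sum_in (FOb II (tgt s)) q x \<cdot>\<^bsub>A\<^esub> body s q)"
        using A.Comp_assoc[OF sum_in_Hom[OF IG q x] dq cH] DI_body(2)[OF Is q x] Isx by simp
      also have "\<dots> = body s q"
        using A.Comp_assoc[OF sH sum_in_Hom[OF IH q x] cH] counit_body(2)[OF H q x] A.Comp_Ide_left[OF sq]
        by simp
      also have "\<dots> = body s q \<cdot>\<^bsub>A\<^esub> body (counit (src s)) q \<cdot>\<^bsub>A\<^esub> sum_in (FOb II (src s)) q x"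
        using A.Comp_assoc[OF sum_in_Hom[OF IG q x] cG sq] counit_body(2)[OF G q x] A.Comp_Ide_right[OF sq]
        by simp
      finally show "body (counit (tgt s)) q \<cdot>\<^bsub>A\<^esub> body (FAr DI (FAr II s)) q \<cdot>\<^bsub>A\<^esub> sum_in (FOb II (src s)) q x
          = body s q \<cdot>\<^bsub>A\<^esub> body (counit (src s)) q \<cdot>\<^bsub>A\<^esub> sum_in (FOb II (src s)) q x" .
    qed
    then show "body (counit (tgt s) \<cdot>\<^bsub>CY\<^esub> FAr DI (FAr II s)) q = body (s \<cdot>\<^bsub>CY\<^esub> counit (src s)) q"
      using q by simp
  qed
  then show "counit (Cod CY s) \<cdot>\<^bsub>CY\<^esub> FAr (functor_comp DI II) s = FAr id_functor s \<cdot>\<^bsub>CY\<^esub> counit (Dom CY s)"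
    by (simp only: fun_cat_simps(1,2) id_functor_simps FAr_functor_comp)
qed

text \<open>On the summand of \<open>x\<close>, the unit enters the copy of
  \<open>sum_ob F q\<close> that is labelled by \<open>x\<close> among the summands of the repeated
  direct image, and the codiagonal maps this copy identically.\<close>

lemma triangle_identity:
  assumes F: "F \<in> Ob CX"
  shows "counit (FOb DI F) \<cdot>\<^bsub>CY\<^esub> FAr DI (unit F) = Ide CY (FOb DI F)"
proof -
  note DF = DI_Ob[OF F] and u = unit_Hom[OF F]
  note IDF = II_Ob[OF DF]
  show ?thesis
  proof (rule fun_cat_arr_eqI[OF CY.Comp_in_Hom[OF DI_Hom[OF u] counit_Hom[OF DF]] CY.Ide_in_Hom[OF DF]])
    fix q assume q: "q \<in> Ob ElY"
    note cq = counit_body(1)[OF DF q] and uq = DI_body(1)[OF u q]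
    have cq': "body (counit (FOb DI F)) q \<in> Hom A (sum_ob (FOb II (FOb DI F)) q) (sum_ob F q)"
      using cq DI_FOb[OF F q] by simp
    have "body (counit (FOb DI F)) q \<cdot>\<^bsub>A\<^esub> body (FAr DI (unit F)) q = Ide A (sum_ob F q)"
    proof (rule sum_cancel[OF F q A.Comp_in_Hom[OF uq cq'] A.Ide_in_Hom[OF sum_Ob[OF F q]]])
      fix x assume x: "x \<in> fibre X f q"
      note p = fibreD[OF q x]
      have ux: "body (unit F) (fst q, x) = sum_in F q x"
        using unit_body[OF p(1), of F] unfolding p(2) by simp
      \<comment> \<open>The same injection, its target now read as the copy of
        \<open>sum_ob F q\<close> that the restricted direct image has at
        \<open>(fst q, x)\<close>.\<close>
      have in_H: "sum_in F q x \<in> Hom A (FOb F (fst q, x)) (FOb (FOb II (FOb DI F)) (fst q, x))"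
        using sum_in_Hom[OF F q x] II_FOb_fibre[OF q x] DI_FOb[OF F q] by simp
      have "body (counit (FOb DI F)) q \<cdot>\<^bsub>A\<^esub> body (FAr DI (unit F)) q \<cdot>\<^bsub>A\<^esub> sum_in F q x
          = body (counit (FOb DI F)) q \<cdot>\<^bsub>A\<^esub> (sum_in (FOb II (FOb DI F)) q x \<cdot>\<^bsub>A\<^esub> sum_in F q x)"
        using A.Comp_assoc[OF sum_in_Hom[OF F q x] uq cq] DI_body(2)[OF u q x] ux by simp
      also have "\<dots> = Ide A (sum_ob F q) \<cdot>\<^bsub>A\<^esub> sum_in F q x"
        using A.Comp_assoc[OF in_H sum_in_Hom[OF IDF q x] cq] counit_body(2)[OF DF q x] DI_FOb[OF F q] by simp
      finally show "body (counit (FOb DI F)) q \<cdot>\<^bsub>A\<^esub> body (FAr DI (unit F)) q \<cdot>\<^bsub>A\<^esub> sum_in F q x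
          = Ide A (sum_ob F q) \<cdot>\<^bsub>A\<^esub> sum_in F q x" .
    qed
    then show "body (counit (FOb DI F) \<cdot>\<^bsub>CY\<^esub> FAr DI (unit F)) q = body (Ide CY (FOb DI F)) q"
      using q DI_FOb[OF F q] by simp
  qed
qed

text \<open>A left Kan extension does not change the colimit. Here this is visible directly:
  grouping the legs of a cocone on \<open>F\<close> by fibres gives a cocone on the coproducts
  \<open>sum_ob F q\<close>, and conversely, so even the vertex \<open>c\<close> is the
  same.\<close>

lemma colimit_direct_image:
  assumes F: "F \<in> Ob CX" and c: "is_colimit ElY A (FOb DI F) c \<iota>"
  shows "is_colimit ElX A F c (\<lambda>p. \<iota> (FOb J p) \<cdot>\<^bsub>A\<^esub> sum_in F (FOb J p) (snd p))"
proof -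
  note DF = fun_cat_functor[OF DI_Ob[OF F]] and fF = functor_F[OF F]
  have \<iota>: "\<iota> q \<in> Hom A (sum_ob F q) c" if "q \<in> Ob ElY" for q
    using is_colimit_Hom[OF c that] DI_FOb[OF F that] by simp
  let ?\<iota> = "\<lambda>p. \<iota> (FOb J p) \<cdot>\<^bsub>A\<^esub> sum_in F (FOb J p) (snd p)"
  have H: "?\<iota> p \<in> Hom A (FOb F p) c" if "p \<in> Ob ElX" for p
    using A.Comp_in_Hom[OF sum_in_J_Hom[OF F that] \<iota>[OF J_Ob[OF that]]] .
  have cocone: "?\<iota> r \<cdot>\<^bsub>A\<^esub> FAr F u = ?\<iota> p" if u: "u \<in> Hom ElX p r" for u p r
  proof -
    have p: "p \<in> Ob ElX" and r: "r \<in> Ob ElX" using ElX.C.Hom_Ob[OF u] .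
    note Ju = functor_Hom[OF functor_J u]
    show ?thesis
      using A.Comp_assoc[OF functor_Hom[OF fF u] sum_in_J_Hom[OF F r] \<iota>[OF J_Ob[OF r]]]
        A.Comp_assoc[OF sum_in_J_Hom[OF F p] DI_FAr(1)[OF F Ju] \<iota>[OF J_Ob[OF r]]]
        sum_in_J_natural[OF F u] is_colimit_cocone[OF c Ju] by metis
  qed
  have univ: "\<exists>!h. h \<in> Hom A c z \<and> (\<forall>p\<in>Ob ElX. h \<cdot>\<^bsub>A\<^esub> ?\<iota> p = \<kappa> p)"
    if z: "z \<in> Ob A" and \<kappa>: "\<forall>p\<in>Ob ElX. \<kappa> p \<in> Hom A (FOb F p) z"
      and \<kappa>c: "\<forall>u\<in>Arr ElX. \<kappa> (Cod ElX u) \<cdot>\<^bsub>A\<^esub> FAr F u = \<kappa> (Dom ElX u)" for z \<kappa>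
  proof -
    \<comment> \<open>The legs of \<open>\<kappa>\<close> over \<open>q\<close>, collected into one
      arrow out of the coproduct; \<open>lc\<close> shows that these arrows form a cocone on the
      direct image.\<close>
    define \<mu> where "\<mu> q = sum_desc F q z (\<lambda>x. \<kappa> (fst q, x))" for q
    have \<kappa>H: "\<kappa> (fst q, x) \<in> Hom A (FOb F (fst q, x)) z" if "q \<in> Ob ElY" "x \<in> fibre X f q" for q x
      using \<kappa> fibreD(1)[OF that] by blast
    have lH: "\<mu> q \<in> Hom A (sum_ob F q) z" if q: "q \<in> Ob ElY" for q
      unfolding \<mu>_def by (rule sum_desc_Hom[OF F q _ z \<kappa>H[OF q]])
    have lin: "\<mu> q \<cdot>\<^bsub>A\<^esub> sum_in F q x = \<kappa> (fst q, x)" if q: "q \<in> Ob ElY" and x: "x \<in> fibre X f q" for q x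
      unfolding \<mu>_def by (rule sum_desc_in[OF F q _ z \<kappa>H[OF q] x])
    have lc: "\<mu> q \<cdot>\<^bsub>A\<^esub> FAr (FOb DI F) b = \<mu> r" if b: "b \<in> Hom ElY r q" for b r q
    proof -
      have r: "r \<in> Ob ElY" and q: "q \<in> Ob ElY" using ElY.C.Hom_Ob[OF b] .
      note Db = DI_FAr(1)[OF F b]
      show ?thesis
      proof (rule sum_cancel[OF F r A.Comp_in_Hom[OF Db lH[OF q]] lH[OF r]])
        fix x assume x: "x \<in> fibre X f r"
        define x' where "x' = body (FAr X (body b)) x"
        have x': "x' \<in> fibre X f q" unfolding x'_def by (rule fibre_arrow(1)[OF b x])
        let ?b = "Mor (fst q, x') (body b) (fst r, x)"
        have bX: "?b \<in> Hom ElX (fst r, x) (fst q, x')" unfolding x'_def by (rule fibre_arrow(2)[OF b x])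
        have "\<mu> q \<cdot>\<^bsub>A\<^esub> FAr (FOb DI F) b \<cdot>\<^bsub>A\<^esub> sum_in F r x = \<mu> q \<cdot>\<^bsub>A\<^esub> (sum_in F q x' \<cdot>\<^bsub>A\<^esub> FAr F ?b)"
          using A.Comp_assoc[OF sum_in_Hom[OF F r x] Db lH[OF q]] DI_FAr(2)[OF F b x] by (simp add: x'_def)
        also have "\<dots> = \<kappa> (fst q, x') \<cdot>\<^bsub>A\<^esub> FAr F ?b"
          using A.Comp_assoc[OF functor_Hom[OF fF bX] sum_in_Hom[OF F q x'] lH[OF q]] lin[OF q x'] by simp
        also have "\<dots> = \<kappa> (fst r, x)"
          using bspec[OF \<kappa>c, of ?b] bX by (simp add: Hom_iff)
        also have "\<dots> = \<mu> r \<cdot>\<^bsub>A\<^esub> sum_in F r x" using lin[OF r x] by simp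
        finally show "\<mu> q \<cdot>\<^bsub>A\<^esub> FAr (FOb DI F) b \<cdot>\<^bsub>A\<^esub> sum_in F r x = \<mu> r \<cdot>\<^bsub>A\<^esub> sum_in F r x" .
      qed
    qed
    have lH': "\<mu> q \<in> Hom A (FOb (FOb DI F) q) z" if "q \<in> Ob ElY" for q
      using lH[OF that] DI_FOb[OF F that] by simp
    obtain h where h: "h \<in> Hom A c z" and h\<iota>: "\<And>q. q \<in> Ob ElY \<Longrightarrow> h \<cdot>\<^bsub>A\<^esub> \<iota> q = \<mu> q"
      using is_colimit_univ[OF c z lH' lc] by blast
    have ex: "h \<cdot>\<^bsub>A\<^esub> ?\<iota> p = \<kappa> p" if p: "p \<in> Ob ElX" for p
      using A.Comp_assoc[OF sum_in_J_Hom[OF F p] \<iota>[OF J_Ob[OF p]] h] h\<iota>[OF J_Ob[OF p]]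
        lin[OF J_Ob[OF p] fibreI[OF p]] by simp
    \<comment> \<open>The legs \<open>\<iota> q\<close> are jointly epic and so are the injections
      over each \<open>q\<close>, hence arrows that agree on all the composites are equal.\<close>
    have "k = h" if k: "k \<in> Hom A c z" and k\<iota>: "\<And>p. p \<in> Ob ElX \<Longrightarrow> k \<cdot>\<^bsub>A\<^esub> ?\<iota> p = \<kappa> p" for k
    proof (rule is_colimit_cancel[OF A.category_axioms ElY.C.category_axioms DF c k h])
      fix q assume q: "q \<in> Ob ElY"
      show "k \<cdot>\<^bsub>A\<^esub> \<iota> q = h \<cdot>\<^bsub>A\<^esub> \<iota> q"
      proof (rule sum_cancel[OF F q A.Comp_in_Hom[OF \<iota>[OF q] k] A.Comp_in_Hom[OF \<iota>[OF q] h]])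
        fix x assume x: "x \<in> fibre X f q"
        note p = fibreD[OF q x]
        have "k \<cdot>\<^bsub>A\<^esub> (\<iota> q \<cdot>\<^bsub>A\<^esub> sum_in F q x) = h \<cdot>\<^bsub>A\<^esub> (\<iota> q \<cdot>\<^bsub>A\<^esub> sum_in F q x)"
          using k\<iota>[OF p(1)] ex[OF p(1)] unfolding p(2) by simp
        then show "k \<cdot>\<^bsub>A\<^esub> \<iota> q \<cdot>\<^bsub>A\<^esub> sum_in F q x = h \<cdot>\<^bsub>A\<^esub> \<iota> q \<cdot>\<^bsub>A\<^esub> sum_in F q x"
          using A.Comp_assoc[OF sum_in_Hom[OF F q x] \<iota>[OF q] k]
            A.Comp_assoc[OF sum_in_Hom[OF F q x] \<iota>[OF q] h] by simp
      qed
    qed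
    then show ?thesis using h ex by blast
  qed
  have "\<forall>u\<in>Arr ElX. ?\<iota> (Cod ElX u) \<cdot>\<^bsub>A\<^esub> FAr F u = ?\<iota> (Dom ElX u)"
    using cocone ElX.C.ArrD by blast
  then show ?thesis
    unfolding is_colimit_def using is_colimit_Ob[OF c] H univ by blast
qed

text \<open>Adds naturality in \<open>F\<close> to the comparison of colimits. The composite with
  \<open>DI\<close> is then one more choice of colimit functor over \<open>ElX\<close>, to which
  uniqueness of colimit functors applies.\<close>

lemma colimit_functor_direct_image:
  assumes L: "is_colimit_functor ElY A L"
  shows "is_colimit_functor ElX A (functor_comp L DI)"
proof -
  have fL: "is_functor CY A L" using L by (simp add: is_colimit_functor_def)
  obtain \<iota> where \<iota>: "\<And>F. F \<in> Ob CY \<Longrightarrow> is_colimit ElY A F (FOb L F) (\<iota> F)"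
    and \<iota>s: "\<And>s q. s \<in> Arr CY \<Longrightarrow> q \<in> Ob ElY \<Longrightarrow>
      FAr L s \<cdot>\<^bsub>A\<^esub> \<iota> (src s) q = \<iota> (tgt s) q \<cdot>\<^bsub>A\<^esub> body s q"
    using L unfolding is_colimit_functor_def by blast
  define \<kappa> where "\<kappa> F p = \<iota> (FOb DI F) (FOb J p) \<cdot>\<^bsub>A\<^esub> sum_in F (FOb J p) (snd p)" for F p
  have "is_colimit ElX A F (FOb (functor_comp L DI) F) (\<kappa> F)" if F: "F \<in> Ob CX" for F
    using colimit_direct_image[OF F \<iota>[OF DI_Ob[OF F]]] unfolding \<kappa>_def by simp
  moreover have "FAr (functor_comp L DI) s \<cdot>\<^bsub>A\<^esub> \<kappa> (src s) p = \<kappa> (tgt s) p \<cdot>\<^bsub>A\<^esub> body s p"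
    if s': "s \<in> Arr CX" and p: "p \<in> Ob ElX" for s p
  proof -
    have s: "s \<in> Hom CX (src s) (tgt s)" and F: "src s \<in> Ob CX" and G: "tgt s \<in> Ob CX"
      using s' by (simp_all add: Hom_iff Arr_fun_cat)
    note q = J_Ob[OF p] and DF = DI_Ob[OF F] and DG = DI_Ob[OF G] and Ds = DI_Hom[OF s]
    have \<iota>F: "\<iota> (FOb DI (src s)) (FOb J p) \<in> Hom A (sum_ob (src s) (FOb J p)) (FOb L (FOb DI (src s)))"
      using is_colimit_Hom[OF \<iota>[OF DF] q] DI_FOb[OF F q] by simp
    have \<iota>G: "\<iota> (FOb DI (tgt s)) (FOb J p) \<in> Hom A (sum_ob (tgt s) (FOb J p)) (FOb L (FOb DI (tgt s)))"
      using is_colimit_Hom[OF \<iota>[OF DG] q] DI_FOb[OF G q] by simp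
    have "FAr L (FAr DI s) \<cdot>\<^bsub>A\<^esub> \<iota> (FOb DI (src s)) (FOb J p)
        = \<iota> (FOb DI (tgt s)) (FOb J p) \<cdot>\<^bsub>A\<^esub> body (FAr DI s) (FOb J p)"
      using \<iota>s[OF _ q, of "FAr DI s"] Ds by (simp add: Hom_iff)
    moreover have "body (FAr DI s) (FOb J p) \<cdot>\<^bsub>A\<^esub> sum_in (src s) (FOb J p) (snd p)
        = sum_in (tgt s) (FOb J p) (snd p) \<cdot>\<^bsub>A\<^esub> body s p"
      using DI_body(2)[OF s q fibreI[OF p]] by simp
    ultimately show ?thesis
      unfolding \<kappa>_def FAr_functor_comp
      using A.Comp_assoc[OF sum_in_J_Hom[OF F p] \<iota>F functor_Hom[OF fL Ds]]
        A.Comp_assoc[OF sum_in_J_Hom[OF F p] DI_body(1)[OF s q] \<iota>G]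
        A.Comp_assoc[OF fun_cat_body(1)[OF s p] sum_in_J_Hom[OF G p] \<iota>G] by metis
  qed
  ultimately show ?thesis
    unfolding is_colimit_functor_def using is_functor_functor_comp[OF functor_DI fL] by blast
qed

text \<open>What remains is the degree-zero isomorphism \<open>\<theta>\<close>. It is composed of
  \<open>T\<^sub>0 \<cong> L\<close>, the uniqueness isomorphism
  \<open>L \<cong> M f\<^sub>*\<close>, and the inverse of \<open>S\<^sub>0 \<cong> M\<close>
  whiskered with \<open>f\<^sub>*\<close>.\<close>

lemma satellites_direct_image:
  assumes T: "is_colim_satellites ElX A T" and S: "is_colim_satellites ElY A S"
  shows "\<exists>\<phi>. is_nat_iso CX A (deg T n) (functor_comp (deg S n) DI) \<phi>"
proof -
  obtain L \<alpha> where L: "is_colimit_functor ElX A L" and uT: "is_universal_delta_functor CX A T"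
    and \<alpha>: "is_nat_iso CX A (deg T 0) L \<alpha>"
    using T unfolding is_colim_satellites_def is_left_satellites_def by blast
  obtain M \<beta> where M: "is_colimit_functor ElY A M" and uS: "is_universal_delta_functor CY A S"
    and \<beta>: "is_nat_iso CY A (deg S 0) M \<beta>"
    using S unfolding is_colim_satellites_def is_left_satellites_def by blast
  note fT = delta_functor_deg(2)[OF universal_delta_functorD(1)[OF uT], of 0]
    and fS = delta_functor_deg(2)[OF universal_delta_functorD(1)[OF uS], of 0]
  have fL: "is_functor CX A L" and fM: "is_functor CY A M"
    using L M by (simp_all add: is_colimit_functor_def)
  note fMD = is_functor_functor_comp[OF functor_DI fM] and fSD = is_functor_functor_comp[OF functor_DI fS]
  obtain \<gamma> where \<gamma>: "is_nat_iso CX A L (functor_comp M DI) \<gamma>"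
    using colimit_functor_unique[OF A.category_axioms ElX.C.category_axioms L
        colimit_functor_direct_image[OF M]] by blast
  obtain \<beta>' where "is_nat_iso CX A (functor_comp M DI) (functor_comp (deg S 0) DI) \<beta>'"
    using nat_iso_sym[OF A.category_axioms CX.category_axioms fSD fMD
        nat_iso_whisker_right[OF functor_DI \<beta>]] by blast
  moreover obtain \<delta> where "is_nat_iso CX A (deg T 0) (functor_comp M DI) \<delta>"
    using nat_iso_trans[OF A.category_axioms CX.category_axioms fT fL fMD \<alpha> \<gamma>] by blast
  ultimately obtain \<theta> where \<theta>: "is_nat_iso CX A (deg T 0) (functor_comp (deg S 0) DI) \<theta>"
    using nat_iso_trans[OF A.category_axioms CX.category_axioms fT fMD fSD] by blast
  show ?thesis
    by (rule universal_delta_functor_exact_adjunction[OF A.category_axioms CX.category_axioms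
          CY.category_axioms uT uS exact_DI exact_II unit_natural counit_natural triangle_identity \<theta>])
qed

end

theorem theorem3p6:
  fixes D :: "('o, 'm) category"
    and A :: "('a, 'b) preadditive"
    and X Y :: "('o, 'm, 'u set, ('u set, 'u \<Rightarrow> 'u) mor) functor_data"
    and f :: "'o \<Rightarrow> ('u set, 'u \<Rightarrow> 'u) mor"
  assumes "infinite (UNIV :: 'u set)"
    and "AB4_category TYPE('u) A"
    and "small_category TYPE('u) D"
    and "is_functor (op D) set_cat X"
    and "is_functor (op D) set_cat Y"
    and "is_nat_trans (op D) set_cat X Y f"
    and "is_colim_satellites (op (elements_cat D X)) A T"
    and "is_colim_satellites (op (elements_cat D Y)) A S"
  shows "\<forall>n. \<exists>\<phi>. is_nat_iso (fun_cat (op (elements_cat D X)) A) A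
                   (deg T n) (functor_comp (deg S n) (direct_image D A X Y f)) \<phi>"
proof -
  interpret direct_image_setup D A X Y f
    using assms(2-6) by (intro direct_image_setup.intro) (simp_all add: small_category_def)
  show ?thesis using satellites_direct_image[OF assms(7,8)] by blast
qed

end
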